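(* Let $d,e,m\ge 0$ be integers with $d+e<m$. Let $P_T$ be the $(m-d)\times(e+1)$ matrix $$P_T=\begin{bmatrix} c_m & c_{m-1} & \cdots & c_{m-e}\\ c_{m-1} & c_{m-2} & \cdots & c_{m-e-1}\\ \vdots & \vdots & \ddots & \vdots\\ c_{d+2} & c_{d+1} & \cdots & c_{d-e+2}\\ c_{d+1} & c_d & \cdots & c_{d-e+1}\end{bmatrix}$$ over the polynomial ring $\mathbb{C}[c]=\mathbb{C}[c_0,c_1,\ldots,c_m]$, where $c_i=0$ whenever $i<0$. Then the ideal $I_{e+1}(P_T)\subset\mathbb{C}[c]$ generated by the $(e+1)\times(e+1)$ minors of $P_T$ is prime, and it defines an irreducible projective variety of dimension $d+e$ in $\mathbb{P}^m$.
   Context: $\mathbb{P}^m$ is complex projective space with homogeneous coordinates $(c_0:c_1:\cdots:c_m)$. The variables $c_0,\dots,c_m$ are independent indeterminates. *)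

theory Defs
  imports
    "HOL-Algebra.Ideal"
    "HOL-Library.Extended_Nat"
    "HOL-Library.Poly_Mapping"
    "Jordan_Normal_Form.Determinant"
    "Jordan_Normal_Form.DL_Submatrix"
begin

section \<open>The polynomial ring \<open>\<complex>[c\<^sub>0, \<dots>, c\<^sub>m]\<close>\<close>

text \<open>
  A monomial is a finitely supported exponent function on the variable indices, and a polynomial
  is a finitely supported coefficient function on the monomials; the library multiplication on
  \<^typ>\<open>'a \<Rightarrow>\<^sub>0 'b\<close> is convolution, so this type is the polynomial ring in the variables
  \<open>c\<^sub>0, c\<^sub>1, c\<^sub>2, \<dots>\<close>. The ring in \<open>c\<^sub>0, \<dots>, c\<^sub>m\<close> is the subring whose monomials involve only
  indices up to \<open>m\<close>.
\<close>

type_synonym monomial = "nat \<Rightarrow>\<^sub>0 nat"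
type_synonym cpoly = "monomial \<Rightarrow>\<^sub>0 complex"

definition poly_ring :: "nat \<Rightarrow> cpoly ring" where
  "poly_ring m =
     \<lparr>carrier = {f. \<forall>a \<in> Poly_Mapping.keys f. Poly_Mapping.keys a \<subseteq> {..m}},
      monoid.mult = (*), one = 1, zero = 0, add = (+)\<rparr>"

definition var :: "nat \<Rightarrow> cpoly" where
  "var i = Poly_Mapping.single (Poly_Mapping.single i 1) 1"

definition poly_eval :: "cpoly \<Rightarrow> complex vec \<Rightarrow> complex" where
  "poly_eval f v =
     (\<Sum>a \<in> Poly_Mapping.keys f. Poly_Mapping.lookup f a *
        (\<Prod>i \<in> Poly_Mapping.keys a. (v $ i) ^ Poly_Mapping.lookup a i))"

definition homogeneous :: "cpoly \<Rightarrow> bool" where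
  "homogeneous f \<longleftrightarrow>
     (\<exists>n. \<forall>a \<in> Poly_Mapping.keys f. (\<Sum>i \<in> Poly_Mapping.keys a. Poly_Mapping.lookup a i) = n)"


section \<open>Determinantal ideals\<close>

definition minors :: "nat \<Rightarrow> 'a::comm_ring_1 mat \<Rightarrow> 'a set" where
  "minors k A =
     {det (submatrix A I J) | I J.
        I \<subseteq> {..<dim_row A} \<and> J \<subseteq> {..<dim_col A} \<and> card I = k \<and> card J = k}"

definition minors_ideal :: "nat \<Rightarrow> nat \<Rightarrow> cpoly mat \<Rightarrow> cpoly set" where
  "minors_ideal m k A = Idl\<^bsub>poly_ring m\<^esub> (minors k A)"

text \<open>
  Rows and columns are counted from \<open>0\<close>. The subscript \<open>m - i - j\<close> is an integer because it may
  be negative, in which case the entry is \<open>0\<close>.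
\<close>

definition P_T :: "nat \<Rightarrow> nat \<Rightarrow> nat \<Rightarrow> cpoly mat" where
  "P_T d e m =
     mat (m - d) (e + 1)
       (\<lambda>(i, j). let k = int m - int i - int j in if k < 0 then 0 else var (nat k))"


section \<open>Projective space and its Zariski topology\<close>

definition proj_rel :: "nat \<Rightarrow> (complex vec \<times> complex vec) set" where
  "proj_rel m =
     {(v, w). v \<in> carrier_vec (m + 1) - {0\<^sub>v (m + 1)} \<and> (\<exists>t. t \<noteq> 0 \<and> w = t \<cdot>\<^sub>v v)}"

definition proj_space :: "nat \<Rightarrow> complex vec set set" where
  "proj_space m = (carrier_vec (m + 1) - {0\<^sub>v (m + 1)}) // proj_rel m"

text \<open>
  A polynomial vanishes at a point if it vanishes at every representative of that point. For a
  homogeneous polynomial one representative suffices; in general it means that every homogeneous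
  component vanishes there, so the zero locus of a homogeneous ideal is the same whether it is
  computed from all its elements or from its homogeneous elements only.
\<close>

definition proj_zeros :: "nat \<Rightarrow> cpoly set \<Rightarrow> complex vec set set" where
  "proj_zeros m T = {p \<in> proj_space m. \<forall>f \<in> T. \<forall>v \<in> p. poly_eval f v = 0}"

definition zariski_closed :: "nat \<Rightarrow> complex vec set set \<Rightarrow> bool" where
  "zariski_closed m Z \<longleftrightarrow>
     (\<exists>T \<subseteq> carrier (poly_ring m). (\<forall>f \<in> T. homogeneous f) \<and> Z = proj_zeros m T)"

definition irreducible_proj_variety :: "nat \<Rightarrow> complex vec set set \<Rightarrow> bool" where
  "irreducible_proj_variety m Z \<longleftrightarrow>
     zariski_closed m Z \<and> Z \<noteq> {} \<and>
     (\<forall>A B. zariski_closed m A \<longrightarrow> zariski_closed m B \<longrightarrow> Z = A \<union> B \<longrightarrow> Z = A \<or> Z = B)"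

text \<open>
  The Krull dimension of the topological space \<open>Z\<close>, for \<open>Z\<close> closed: the supremum of the lengths
  \<open>n\<close> of chains \<open>C\<^sub>0 \<subset> C\<^sub>1 \<subset> \<dots> \<subset> C\<^sub>n\<close> of irreducible closed subsets of \<open>Z\<close>.
\<close>

definition proj_dim :: "nat \<Rightarrow> complex vec set set \<Rightarrow> enat" where
  "proj_dim m Z =
     Sup {enat n | n. \<exists>C :: nat \<Rightarrow> complex vec set set.
       (\<forall>i \<le> n. irreducible_proj_variety m (C i) \<and> C i \<subseteq> Z) \<and> (\<forall>i < n. C i \<subset> C (Suc i))}"

end

theory Submission
  imports Defs
begin

text \<open>
  Order monomials by the sum of the squares of the indices of their variables. By the rearrangement
  inequality the main diagonal is the unique smallest term of a maximal minor, and the main diagonals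
  are exactly the monomials of degree \<open>e + 1\<close> in \<open>c\<^bsub>d+1\<^esub>, \<dots>, c\<^bsub>m-e\<^esub>\<close>. Expanding determinants with a
  repeated column shows that the minors behave like a Groebner basis: modulo the ideal, the
  monomials of degree at most \<open>e\<close> in these variables form a basis over the polynomial ring \<open>R\<close> in the
  other \<open>d + e + 1\<close> variables.

  Let \<open>\<Delta>\<close> be the \<open>e\<close>-minor with all diagonal entries equal to \<open>c\<^sub>d\<close>. It is \<open>c\<^sub>d\<^sup>e\<close> modulo
  \<open>c\<^sub>0, \<dots>, c\<^bsub>d-1\<^esub>\<close>, so by freeness over \<open>R\<close> it is regular modulo the ideal. After inverting it, each
  \<open>c\<^sub>k\<close> with \<open>k > d + e\<close> is a function of \<open>c\<^sub>0, \<dots>, c\<^bsub>d+e\<^esub>\<close>, and these remain algebraically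
  independent because every point with \<open>\<Delta> \<noteq> 0\<close> extends to a zero by a linear recurrence. Hence the
  ideal is prime and contains every polynomial that vanishes on its zero locus.

  A chain of \<open>n + 1\<close> irreducible closed sets yields about \<open>D\<^sup>n\<close> independent forms of degree \<open>D\<close> on
  the variety, while the basis leaves room for only a multiple of \<open>D\<^bsup>d+e\<^esup>\<close>. Conversely,
  increasing first \<open>d\<close> and then \<open>e\<close> gives a chain of length \<open>d + e\<close> of varieties of the same kind.
\<close>

section \<open>Polynomials and monomials\<close>

text \<open>The squares are chosen because a term of a minor with row subscripts \<open>k i\<close>
  and permutation \<open>p\<close> has as weight the sum of \<open>(k i - p i)\<^sup>2\<close>, a
  constant minus twice the sum of \<open>k i * p i\<close>. This weight is no total order on
  monomials and need not be: one strictly lightest term per minor suffices. The obstacle is that a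
  monomial can contain several diagonals, so that several multiples of minors share a leading
  monomial. Once these are known to differ by heavier multiples only, one multiple per monomial
  spans the ideal, and independence can be read off from the weights. The Toeplitz shape enters
  here: moving to the next column lowers the subscript by one, so that deleting either of two
  neighbouring rows can give the same leading monomial. Regularity of \<open>Delta\<close> lets
  denominators be cancelled, so membership in the ideal is tested by evaluating polynomials in the
  free variables \<open>c_0, ..., c_(d+e)\<close>, without a general Nullstellensatz. The growth
  exponent \<open>d + e\<close> is one less than the number of free variables because the degree is
  fixed.\<close>

abbreviation coef :: "('a \<Rightarrow>\<^sub>0 'b::zero) \<Rightarrow> 'a \<Rightarrow> 'b" where "coef \<equiv> Poly_Mapping.lookup"
abbreviation supp :: "('a \<Rightarrow>\<^sub>0 'b::zero) \<Rightarrow> 'a set" where "supp \<equiv> Poly_Mapping.keys"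
abbreviation sgl :: "'a \<Rightarrow> 'b::zero \<Rightarrow> ('a \<Rightarrow>\<^sub>0 'b)" where "sgl \<equiv> Poly_Mapping.single"

lemma coef_single: "coef (sgl a c) b = (if a = b then c else 0)"
  by (simp add: lookup_single when_def)

lemma poly_mapping_sum_single: "f = (\<Sum>a\<in>supp f. sgl a (coef f a))"
proof (rule poly_mapping_eqI)
  fix b
  have "coef (\<Sum>a\<in>supp f. sgl a (coef f a)) b = (\<Sum>a\<in>supp f. if a = b then coef f a else 0)"
    by (simp add: lookup_sum coef_single)
  also have "\<dots> = coef f b" by (simp add: in_keys_iff)
  finally show "coef f b = coef (\<Sum>a\<in>supp f. sgl a (coef f a)) b" by simp
qed

text \<open>A free weight per variable, because four additive gradings are needed: total degree, sum
  of squared indices, degree in the middle variables \<open>c_(d+1), ..., c_(m-e)\<close>, and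
  degree in \<open>c_0, ..., c_(d-1)\<close>.\<close>

definition wt :: "(nat \<Rightarrow> nat) \<Rightarrow> monomial \<Rightarrow> nat" where
  "wt u a = (\<Sum>i\<in>supp a. coef a i * u i)"

lemma wt_superset: "finite A \<Longrightarrow> supp a \<subseteq> A \<Longrightarrow> wt u a = (\<Sum>i\<in>A. coef a i * u i)"
  unfolding wt_def by (rule sum.mono_neutral_left) (auto simp: in_keys_iff)

lemma supp_add_monomial: "supp (a + b :: monomial) = supp a \<union> supp b"
  by (auto simp: in_keys_iff lookup_add)

lemma wt_add: "wt u (a + b) = wt u a + wt u b"
proof -
  have "wt u c = (\<Sum>i\<in>supp a \<union> supp b. coef c i * u i)" if "supp c \<subseteq> supp a \<union> supp b" for c
    using that by (intro wt_superset) auto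
  then show ?thesis
    by (simp add: supp_add_monomial lookup_add algebra_simps sum.distrib)
qed

lemma wt_zero [simp]: "wt u 0 = 0" by (simp add: wt_def)

lemma wt_single [simp]: "wt u (sgl i n) = n * u i" by (simp add: wt_def)

text \<open>With monomials as multisets of variable indices, divisibility is multiset inclusion,
  quotients are differences, and the factors can be listed in order.\<close>

definition mon :: "nat multiset \<Rightarrow> monomial" where
  "mon X = (\<Sum>i\<in>#X. sgl i 1)"

lemma mon_empty [simp]: "mon {#} = 0" by (simp add: mon_def)
lemma mon_add_mset [simp]: "mon (add_mset i X) = sgl i 1 + mon X" by (simp add: mon_def)
lemma mon_union: "mon (X + Y) = mon X + mon Y" by (simp add: mon_def)

lemma coef_mon: "coef (mon X) i = count X i"
  by (induction X) (auto simp: lookup_add coef_single)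

lemma supp_mon: "supp (mon X) = set_mset X"
  by (auto simp: in_keys_iff coef_mon)

lemma wt_mon: "wt u (mon X) = (\<Sum>i\<in>#X. u i)"
  by (induction X) (auto simp: wt_add)

lemma mon_inject: "mon X = mon Y \<longleftrightarrow> X = Y"
  by (metis coef_mon multiset_eqI)

lemma mon_surj: "\<exists>X. a = mon X"
proof -
  have "finite {i. 0 < coef a i}" by simp
  then have "count (Abs_multiset (coef a)) = coef a" by (simp add: Abs_multiset_inverse)
  then have "a = mon (Abs_multiset (coef a))" by (intro poly_mapping_eqI) (simp add: coef_mon)
  then show ?thesis by blast
qed

lemma supp_uminus: "supp (- f) = supp (f :: cpoly)"
  by (auto simp: in_keys_iff)

lemma supp_sum: "supp (sum f A) \<subseteq> (\<Union>x\<in>A. supp (f x :: cpoly))"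
proof
  fix b assume "b \<in> supp (sum f A)"
  then have "(\<Sum>x\<in>A. coef (f x) b) \<noteq> 0" by (simp add: in_keys_iff lookup_sum)
  then obtain x where "x \<in> A" "coef (f x) b \<noteq> 0" by (meson sum.neutral)
  then show "b \<in> (\<Union>x\<in>A. supp (f x))" by (auto simp: in_keys_iff)
qed

lemma coef_scale: "coef (sgl 0 c * f :: cpoly) a = c * coef f a"
proof -
  have "sgl 0 c * f = (\<Sum>a\<in>supp f. sgl a (c * coef f a))"
    by (subst poly_mapping_sum_single[of f]) (simp add: sum_distrib_left mult_single)
  then have "coef (sgl 0 c * f) a = (\<Sum>b\<in>supp f. if b = a then c * coef f b else 0)"
    by (simp add: lookup_sum coef_single)
  then show ?thesis by (simp add: in_keys_iff)
qed

lemma supp_single_mult: "supp (sgl a c * f :: cpoly) \<subseteq> (\<lambda>b. a + b) ` supp f"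
  using keys_mult[of "sgl a c" f] by (auto split: if_splits)

interpretation cpoly_vs: vector_space "\<lambda>c (f :: cpoly). sgl 0 c * f"
  by unfold_locales (auto simp: algebra_simps single_add mult_single mult.assoc[symmetric])

section \<open>Evaluation at points\<close>

lemma poly_eval_superset:
  "finite A \<Longrightarrow> supp f \<subseteq> A \<Longrightarrow>
    poly_eval f v = (\<Sum>a\<in>A. coef f a * (\<Prod>i\<in>supp a. (v $ i) ^ coef a i))"
  unfolding poly_eval_def by (rule sum.mono_neutral_left) (auto simp: in_keys_iff)

lemma poly_eval_add: "poly_eval (f + g) v = poly_eval f v + poly_eval g v"
proof -
  have "poly_eval h v = (\<Sum>a\<in>supp f \<union> supp g. coef h a * (\<Prod>i\<in>supp a. (v $ i) ^ coef a i))"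
    if "supp h \<subseteq> supp f \<union> supp g" for h
    using that by (intro poly_eval_superset) auto
  then show ?thesis using keys_add[of f g]
    by (simp add: lookup_add algebra_simps sum.distrib)
qed

lemma poly_eval_zero [simp]: "poly_eval 0 v = 0" by (simp add: poly_eval_def)

lemma poly_eval_sum: "poly_eval (sum f A) v = (\<Sum>x\<in>A. poly_eval (f x) v)"
  by (induction A rule: infinite_finite_induct) (auto simp: poly_eval_add)

lemma poly_eval_single: "poly_eval (sgl a c) v = c * (\<Prod>i\<in>supp a. (v $ i) ^ coef a i)"
  by (simp add: poly_eval_def)

lemma poly_eval_single_add:
  "poly_eval (sgl (a + b) (c * c')) v = poly_eval (sgl a c) v * poly_eval (sgl b c') v"
proof -
  have *: "(\<Prod>i\<in>supp x. (v $ i) ^ coef x i) = (\<Prod>i\<in>supp a \<union> supp b. (v $ i) ^ coef x i)"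
    if "supp x \<subseteq> supp a \<union> supp b" for x
    using that by (intro prod.mono_neutral_left) (auto simp: in_keys_iff)
  show ?thesis
    unfolding poly_eval_single
    by (subst (1 2 3) *) (auto simp: supp_add_monomial lookup_add power_add prod.distrib)
qed

lemma poly_eval_mult: "poly_eval (f * g) v = poly_eval f v * poly_eval g v"
proof -
  have "f * g = (\<Sum>a\<in>supp f. sgl a (coef f a)) * (\<Sum>b\<in>supp g. sgl b (coef g b))"
    using poly_mapping_sum_single by metis
  also have "\<dots> = (\<Sum>a\<in>supp f. \<Sum>b\<in>supp g. sgl (a + b) (coef f a * coef g b))"
    by (simp add: sum_product mult_single)
  finally have "poly_eval (f * g) v =
      (\<Sum>a\<in>supp f. poly_eval (sgl a (coef f a)) v) * (\<Sum>b\<in>supp g. poly_eval (sgl b (coef g b)) v)"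
    by (simp add: poly_eval_sum poly_eval_single_add sum_product)
  then show ?thesis
    by (simp add: poly_eval_sum[symmetric] poly_mapping_sum_single[symmetric])
qed

lemma poly_eval_one [simp]: "poly_eval 1 v = 1"
  using poly_eval_single[of 0 1 v] by simp

lemma poly_eval_const [simp]: "poly_eval (sgl 0 c) v = c"
  by (simp add: poly_eval_single)

lemma poly_eval_var [simp]: "poly_eval (var i) v = v $ i"
  by (simp add: poly_eval_single var_def)

lemma poly_eval_uminus: "poly_eval (- f) v = - poly_eval f v"
  using poly_eval_add[of f "- f" v] by (simp add: eq_neg_iff_add_eq_0 add.commute)

lemma poly_eval_diff: "poly_eval (f - g) v = poly_eval f v - poly_eval g v"
  using poly_eval_add[of f "- g" v] by (simp add: poly_eval_uminus)

lemma poly_eval_power: "poly_eval (f ^ n) v = poly_eval f v ^ n"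
  by (induction n) (auto simp: poly_eval_mult)

lemma poly_eval_hom: "comm_ring_hom (\<lambda>f. poly_eval f v)"
  by unfold_locales (auto simp: poly_eval_add poly_eval_mult)

lemma poly_eval_det: "poly_eval (det A) v = det (map_mat (\<lambda>f. poly_eval f v) A)"
proof -
  interpret comm_ring_hom "\<lambda>f. poly_eval f v" by (rule poly_eval_hom)
  show ?thesis by simp
qed

definition deg :: "monomial \<Rightarrow> nat" where "deg = wt (\<lambda>_. 1)"

lemma deg_zero [simp]: "deg 0 = 0" by (simp add: deg_def)
lemma deg_single [simp]: "deg (sgl i n) = n" by (simp add: deg_def)
lemma deg_add: "deg (a + b) = deg a + deg b" by (simp add: deg_def wt_add)
lemma deg_mon: "deg (mon X) = size X" by (simp add: deg_def wt_mon)

lemma homogeneous_iff: "homogeneous f \<longleftrightarrow> (\<exists>n. \<forall>a\<in>supp f. deg a = n)"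
  by (simp add: homogeneous_def deg_def wt_def)

lemma poly_eval_smult:
  assumes "\<forall>a\<in>supp f. deg a = n" "\<forall>a\<in>supp f. supp a \<subseteq> {..<dim_vec v}"
  shows "poly_eval f (t \<cdot>\<^sub>v v) = t ^ n * poly_eval f v"
proof -
  have "(\<Prod>i\<in>supp a. ((t \<cdot>\<^sub>v v) $ i) ^ coef a i) = t ^ n * (\<Prod>i\<in>supp a. (v $ i) ^ coef a i)"
    if "a \<in> supp f" for a
  proof -
    have "(\<Prod>i\<in>supp a. ((t \<cdot>\<^sub>v v) $ i) ^ coef a i) =
        (\<Prod>i\<in>supp a. t ^ coef a i * (v $ i) ^ coef a i)"
      using assms(2) that by (intro prod.cong) (auto simp: power_mult_distrib subset_iff)
    also have "\<dots> = t ^ deg a * (\<Prod>i\<in>supp a. (v $ i) ^ coef a i)"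
      by (simp add: prod.distrib deg_def wt_def power_sum)
    finally show ?thesis using assms(1) that by simp
  qed
  then show ?thesis unfolding poly_eval_def by (simp add: sum_distrib_left algebra_simps)
qed

text \<open>Kronecker substitution: the exponents of the monomials become distinct numbers in base \<open>B\<close>.\<close>

lemma digits_inj:
  fixes B :: nat
  assumes "(\<Sum>i<n. a i * B ^ i) = (\<Sum>i<n. b i * B ^ i)" "\<forall>i<n. a i < B" "\<forall>i<n. b i < B" "i < n"
  shows "a i = b i"
  using assms
proof (induction n arbitrary: a b i)
  case (Suc n)
  have s: "(\<Sum>i<Suc n. c i * B ^ i) = c 0 + B * (\<Sum>i<n. c (Suc i) * B ^ i)" for c
    by (subst sum.lessThan_Suc_shift) (simp add: sum_distrib_left algebra_simps)
  have "(a 0 + B * (\<Sum>i<n. a (Suc i) * B ^ i)) mod B = (b 0 + B * (\<Sum>i<n. b (Suc i) * B ^ i)) mod B"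
    using Suc.prems(1) unfolding s by simp
  then have 0: "a 0 = b 0" using Suc.prems(2,3) by simp
  have "B > 0" using Suc.prems(2) by (metis gr_zeroI less_nat_zero_code zero_less_Suc)
  then have "(\<Sum>i<n. a (Suc i) * B ^ i) = (\<Sum>i<n. b (Suc i) * B ^ i)"
    using Suc.prems(1) 0 unfolding s by simp
  then have "a (Suc j) = b (Suc j)" if "j < n" for j
    using Suc.IH[of "\<lambda>i. a (Suc i)" "\<lambda>i. b (Suc i)" j] Suc.prems that by auto
  then show ?case using 0 Suc.prems(4) by (cases i) auto
qed simp

lemma poly_eval_eq_zero_imp:
  assumes c: "\<forall>a\<in>supp f. supp a \<subseteq> {..<n}" and z: "\<And>v. v \<in> carrier_vec n \<Longrightarrow> poly_eval f v = 0"
  shows "f = 0"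
proof (rule ccontr)
  assume f: "f \<noteq> 0"
  obtain B where B: "\<And>a i. a \<in> supp f \<Longrightarrow> coef a i < B"
  proof -
    have fin: "finite (\<Union>a\<in>supp f. coef a ` supp a)" by simp
    define B where "B = Suc (Max (insert 0 (\<Union>a\<in>supp f. coef a ` supp a)))"
    have "coef a i < B" if "a \<in> supp f" for a i
    proof (cases "i \<in> supp a")
      case True
      then have "coef a i \<in> insert 0 (\<Union>a\<in>supp f. coef a ` supp a)" using that by blast
      then have "coef a i \<le> Max (insert 0 (\<Union>a\<in>supp f. coef a ` supp a))"
        using fin by (intro Max_ge) auto
      then show ?thesis by (simp add: B_def)
    next
      case False
      then show ?thesis by (simp add: B_def in_keys_iff)
    qed
    then show ?thesis using that by blast
  qed
  define N where "N a = (\<Sum>i<n. coef a i * B ^ i)" for a :: monomial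
  have inj: "inj_on N (supp f)"
  proof (rule inj_onI)
    fix a b assume ab: "a \<in> supp f" "b \<in> supp f" "N a = N b"
    have "coef a i = coef b i" for i
    proof (cases "i < n")
      case True
      then show ?thesis using digits_inj[of "coef a" B n "coef b" i] ab B by (auto simp: N_def)
    next
      case False
      then have "i \<notin> supp a" "i \<notin> supp b" using c ab by (auto simp: subset_iff)
      then show ?thesis by (simp add: in_keys_iff)
    qed
    then show "a = b" by (rule poly_mapping_eqI)
  qed
  define p :: "complex poly" where "p = (\<Sum>a\<in>supp f. monom (coef f a) (N a))"
  have "poly p t = 0" for t
  proof -
    define v where "v = vec n (\<lambda>i. t ^ (B ^ i))"
    have "(\<Prod>i\<in>supp a. (v $ i) ^ coef a i) = t ^ N a" if "a \<in> supp f" for a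
    proof -
      have "(\<Prod>i\<in>supp a. (v $ i) ^ coef a i) = (\<Prod>i<n. (v $ i) ^ coef a i)"
        using c that by (intro prod.mono_neutral_left) (auto simp: in_keys_iff)
      also have "\<dots> = (\<Prod>i<n. t ^ (coef a i * B ^ i))"
        by (intro prod.cong) (auto simp: v_def power_mult[symmetric] mult.commute)
      finally show ?thesis by (simp add: N_def power_sum)
    qed
    then have "poly p t = poly_eval f v"
      by (simp add: p_def poly_sum poly_monom poly_eval_def)
    also have "\<dots> = 0" by (rule z) (simp add: v_def)
    finally show ?thesis .
  qed
  then have p0: "p = 0" by (metis poly_all_0_iff_0)
  obtain a where a: "a \<in> supp f" using f by (metis all_not_in_conv keys_eq_empty poly_mapping_eqI lookup_zero in_keys_iff)
  have "coeff p (N a) = (\<Sum>b\<in>supp f. if b = a then coef f b else 0)"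
    unfolding p_def using inj a by (auto simp: coeff_sum inj_on_eq_iff intro!: sum.cong)
  also have "\<dots> = coef f a" using a by simp
  finally show False using a p0 by (simp add: in_keys_iff)
qed

section \<open>Minors with prescribed rows\<close>

text \<open>If \<open>q\<close> is the preimage of the top index, exchanging the values of
  \<open>p\<close> at \<open>q\<close> and \<open>n\<close> gains \<open>s * t\<close>, the product
  of the two increments, and leaves a permutation of the smaller range. When \<open>t = 0\<close>
  the exchange changes no value of \<open>g\<close>, and strictness is inherited from the induction
  hypothesis. Since \<open>g\<close> is only weakly increasing (it will be a column assignment with
  a repetition), strictness asks for a changed value of \<open>g\<close>, not for a nontrivial
  permutation.\<close>

lemma rearrangement:
  fixes l g :: "nat \<Rightarrow> nat"
  assumes "p permutes {..<n}" "\<And>i j. i < j \<Longrightarrow> j < n \<Longrightarrow> l i < l j" "\<And>i j. i \<le> j \<Longrightarrow> j < n \<Longrightarrow> g i \<le> g j"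
  shows "(\<Sum>i<n. l i * g (p i)) \<le> (\<Sum>i<n. l i * g i) \<and>
    ((\<exists>i<n. g (p i) \<noteq> g i) \<longrightarrow> (\<Sum>i<n. l i * g (p i)) < (\<Sum>i<n. l i * g i))"
  using assms
proof (induction n arbitrary: p)
  case (Suc n)
  have l: "\<And>i j. i < j \<Longrightarrow> j < n \<Longrightarrow> l i < l j" and g: "\<And>i j. i \<le> j \<Longrightarrow> j < n \<Longrightarrow> g i \<le> g j"
    using Suc.prems by auto
  show ?case
  proof (cases "p n = n")
    case True
    have "p permutes {..<n}"
      by (rule permutes_superset[OF Suc.prems(1)]) (use True in \<open>auto simp: less_Suc_eq\<close>)
    then have "(\<Sum>i<n. l i * g (p i)) \<le> (\<Sum>i<n. l i * g i) \<and>
      ((\<exists>i<n. g (p i) \<noteq> g i) \<longrightarrow> (\<Sum>i<n. l i * g (p i)) < (\<Sum>i<n. l i * g i))"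
      by (rule Suc.IH) (use l g in auto)
    with True show ?thesis by (auto simp: less_Suc_eq)
  next
    case False
    obtain q where pq: "p q = n" using permutes_surj[OF Suc.prems(1)] by (metis surjD)
    have inj: "p x = p y \<longleftrightarrow> x = y" for x y
      using permutes_inj[OF Suc.prems(1)] by (auto dest: injD)
    have q: "q < n"
    proof -
      have "q \<in> {..<Suc n}" using permutes_in_image[OF Suc.prems(1), of q] pq by simp
      moreover have "q \<noteq> n" using pq False by metis
      ultimately show ?thesis by simp
    qed
    have pn: "p n < n"
      using permutes_in_image[OF Suc.prems(1), of n] False by auto
    define r where "r = p \<circ> transpose q n"
    have rq: "r q = p n" and rn: "r n = n" and ri: "\<And>i. i \<noteq> q \<Longrightarrow> i \<noteq> n \<Longrightarrow> r i = p i"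
      using pq by (auto simp: r_def transpose_def)
    have "r permutes {..<Suc n}" unfolding r_def
      by (rule permutes_compose[OF permutes_swap_id Suc.prems(1)]) (use q in auto)
    then have "r permutes {..<n}"
      by (rule permutes_superset) (use rn in \<open>auto simp: less_Suc_eq\<close>)
    then have IH: "(\<Sum>i<n. l i * g (r i)) \<le> (\<Sum>i<n. l i * g i) \<and>
      ((\<exists>i<n. g (r i) \<noteq> g i) \<longrightarrow> (\<Sum>i<n. l i * g (r i)) < (\<Sum>i<n. l i * g i))"
      by (rule Suc.IH) (use l g in auto)
    have split: "(\<Sum>i<Suc n. f i) = (\<Sum>i\<in>{..<n} - {q}. f i) + f q + f n" for f :: "nat \<Rightarrow> nat"
      using q by (simp add: sum.remove[of "{..<n}" q])
    have "(\<Sum>i<Suc n. l i * g (r i)) = (\<Sum>i\<in>{..<n} - {q}. l i * g (p i)) + l q * g (p n) + l n * g n"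
      unfolding split by (simp add: rq rn) (auto intro!: sum.cong simp: ri)
    moreover have "(\<Sum>i<Suc n. l i * g (p i)) = (\<Sum>i\<in>{..<n} - {q}. l i * g (p i)) + l q * g n + l n * g (p n)"
      unfolding split by (simp add: pq)
    moreover have lt: "l q < l n" using Suc.prems(2) q by simp
    moreover have le: "g (p n) \<le> g n" using Suc.prems(3) pn by simp
    moreover obtain s where s: "l n = l q + s" "s > 0" using lt by (metis less_imp_add_positive)
    moreover obtain t where t: "g n = g (p n) + t" using le by (metis le_add_diff_inverse)
    ultimately have *: "(\<Sum>i<Suc n. l i * g (p i)) + s * t = (\<Sum>i<Suc n. l i * g (r i))"
      by (simp add: algebra_simps)
    have "(\<Sum>i<Suc n. l i * g (r i)) \<le> (\<Sum>i<Suc n. l i * g i)"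
      using IH rn by simp
    moreover have "(\<Sum>i<Suc n. l i * g (r i)) < (\<Sum>i<Suc n. l i * g i)"
      if ex: "\<exists>i<Suc n. g (p i) \<noteq> g i" and "t = 0"
    proof -
      have gn: "g (p n) = g n" using t that(2) by simp
      have e: "g (r i) = g (p i)" for i
      proof (cases "i = q \<or> i = n")
        case True
        then show ?thesis using gn pq rq rn by metis
      next
        case False
        then show ?thesis using ri by simp
      qed
      obtain i where i: "i < Suc n" "g (p i) \<noteq> g i" using ex by metis
      have "i \<noteq> n"
      proof
        assume "i = n"
        then show False using gn i(2) by simp
      qed
      then have "i < n" "g (r i) \<noteq> g i" using i e by simp_all
      then have "\<exists>i<n. g (r i) \<noteq> g i" by blast
      then have "(\<Sum>i<n. l i * g (r i)) < (\<Sum>i<n. l i * g i)" using IH by blast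
      then show ?thesis by (simp add: rn)
    qed
    moreover have "s * t > 0" if "t \<noteq> 0" using that s(2) by simp
    ultimately show ?thesis
    proof (cases "t = 0")
      case True
      assume le: "(\<Sum>i<Suc n. l i * g (r i)) \<le> (\<Sum>i<Suc n. l i * g i)"
        and lt: "\<lbrakk>\<exists>i<Suc n. g (p i) \<noteq> g i; t = 0\<rbrakk> \<Longrightarrow>
          (\<Sum>i<Suc n. l i * g (r i)) < (\<Sum>i<Suc n. l i * g i)"
      have "(\<Sum>i<Suc n. l i * g (p i)) = (\<Sum>i<Suc n. l i * g (r i))" using * True by simp
      then show ?thesis using le lt True by presburger
    next
      case False
      assume "(\<Sum>i<Suc n. l i * g (r i)) \<le> (\<Sum>i<Suc n. l i * g i)" "t \<noteq> 0 \<Longrightarrow> 0 < s * t"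
      then have "(\<Sum>i<Suc n. l i * g (p i)) < (\<Sum>i<Suc n. l i * g i)" using * False by linarith
      then show ?thesis by linarith
    qed
  qed
qed simp

text \<open>After expanding the squares only the mixed terms depend on the order of the values, so
  the rearrangement inequality applies with reversed sign. The expansion runs over the integers; the
  bounds by \<open>l i\<close> make the truncated differences genuine.\<close>

lemma sum_square_diff_less:
  fixes l g g' :: "nat \<Rightarrow> nat"
  assumes "mset (map g' [0..<n]) = mset (map g [0..<n])"
    and l: "\<And>i j. i < j \<Longrightarrow> j < n \<Longrightarrow> l i < l j" and g: "\<And>i j. i \<le> j \<Longrightarrow> j < n \<Longrightarrow> g i \<le> g j"
    and gl: "\<And>i. i < n \<Longrightarrow> g i \<le> l i" "\<And>i. i < n \<Longrightarrow> g' i \<le> l i"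
    and ne: "i0 < n" "g' i0 \<noteq> g i0"
  shows "(\<Sum>i<n. (l i - g i)\<^sup>2) < (\<Sum>i<n. (l i - g' i)\<^sup>2)"
proof -
  obtain p where "p permutes {..<length (map g [0..<n])}" and P: "permute_list p (map g [0..<n]) = map g' [0..<n]"
    using mset_eq_permutation[OF assms(1)] by blast
  then have p: "p permutes {..<n}" by simp
  have gp: "g' i = g (p i)" if "i < n" for i
  proof -
    have "map g' [0..<n] ! i = permute_list p (map g [0..<n]) ! i" using P by simp
    then show ?thesis
      using that p permutes_in_image[OF p, of i] by (simp add: permute_list_nth)
  qed
  have "(\<Sum>i<n. l i * g (p i)) < (\<Sum>i<n. l i * g i)"
  proof -
    have "(\<Sum>i<n. l i * g (p i)) \<le> (\<Sum>i<n. l i * g i) \<and>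
        ((\<exists>i<n. g (p i) \<noteq> g i) \<longrightarrow> (\<Sum>i<n. l i * g (p i)) < (\<Sum>i<n. l i * g i))"
      by (rule rearrangement[OF p]) (erule (1) l, erule (1) g)
    moreover have "\<exists>i<n. g (p i) \<noteq> g i" using ne gp[OF ne(1)] by (intro exI[of _ i0]) simp
    ultimately show ?thesis by blast
  qed
  then have "(\<Sum>i<n. int (l i) * int (g' i)) < (\<Sum>i<n. int (l i) * int (g i))"
    by (simp add: gp flip: of_nat_mult of_nat_sum)
  moreover have "(\<Sum>i<n. (int (g' i))\<^sup>2) = (\<Sum>i<n. (int (g i))\<^sup>2)"
  proof -
    have "sum_mset (image_mset (\<lambda>x. (int x)\<^sup>2) (mset (map g' [0..<n]))) =
        sum_mset (image_mset (\<lambda>x. (int x)\<^sup>2) (mset (map g [0..<n])))"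
      using assms(1) by simp
    then show ?thesis
      by (simp add: image_mset.compositionality comp_def sum_mset_sum_list atLeast0LessThan interv_sum_list_conv_sum_set_nat flip: mset_map)
  qed
  moreover have "(\<Sum>i<n. (int (l i) - int (h i))\<^sup>2) =
      (\<Sum>i<n. (int (l i))\<^sup>2) + (\<Sum>i<n. (int (h i))\<^sup>2) - 2 * (\<Sum>i<n. int (l i) * int (h i))" for h
    by (simp add: power2_diff sum.distrib sum_subtractf sum_distrib_left algebra_simps)
  ultimately have less: "(\<Sum>i<n. (int (l i) - int (g i))\<^sup>2) < (\<Sum>i<n. (int (l i) - int (g' i))\<^sup>2)"
    by simp
  have "(\<Sum>i<n. (int (l i) - int (h i))\<^sup>2) = int (\<Sum>i<n. (l i - h i)\<^sup>2)"
    if "\<And>i. i < n \<Longrightarrow> h i \<le> l i" for h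
    using that by (simp add: of_nat_diff)
  from this[of g, OF gl(1)] this[of g', OF gl(2)] show ?thesis using less by linarith
qed

text \<open>A row is addressed by the subscript \<open>k\<close> of its entry in column
  \<open>0\<close>. Minors then mention neither \<open>d\<close> nor \<open>m\<close>, which makes
  the ideals for different parameters comparable.\<close>

definition toeplitz_entry :: "nat \<Rightarrow> nat \<Rightarrow> cpoly" where
  "toeplitz_entry k j = (if j \<le> k then var (k - j) else 0)"

definition row_minor :: "nat \<Rightarrow> (nat \<Rightarrow> nat) \<Rightarrow> cpoly" where
  "row_minor e k = det (mat (Suc e) (Suc e) (\<lambda>(i, j). toeplitz_entry (k i) j))"

lemma row_minor_cong: "(\<And>i. i \<le> e \<Longrightarrow> k i = k' i) \<Longrightarrow> row_minor e k = row_minor e k'"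
  unfolding row_minor_def by (intro arg_cong[of _ _ det] cong_mat) auto

lemma prod_toeplitz_entry:
  "finite A \<Longrightarrow> (\<Prod>i\<in>A. toeplitz_entry (k i) (p i)) =
    (if \<forall>i\<in>A. p i \<le> k i then sgl (\<Sum>i\<in>A. sgl (k i - p i) 1) 1 else 0)"
  by (induction A rule: finite_induct) (auto simp: toeplitz_entry_def var_def mult_single)

lemma wt_sum: "wt u (sum f A) = (\<Sum>x\<in>A. wt u (f x))"
  by (induction A rule: infinite_finite_induct) (auto simp: wt_add)

lemma deg_sum: "deg (sum f A) = (\<Sum>x\<in>A. deg (f x))"
  by (simp add: deg_def wt_sum)

lemma supp_sum_monomial: "finite A \<Longrightarrow> supp (sum f A :: monomial) = (\<Union>x\<in>A. supp (f x))"
  by (induction A rule: finite_induct) (auto simp: supp_add_monomial)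

abbreviation W :: "monomial \<Rightarrow> nat" where "W \<equiv> wt (\<lambda>i. i\<^sup>2)"

text \<open>In the Leibniz formula a permutation \<open>p\<close> contributes, up to sign, one
  monomial whose weight is the sum of \<open>(k i - p i)\<^sup>2\<close>, or nothing at all. The
  identity does contribute, because a strictly increasing \<open>k\<close> satisfies
  \<open>i \<le> k i\<close>; every other contribution is strictly heavier by rearrangement.\<close>

lemma row_minor_lead:
  assumes k: "\<And>i j. i < j \<Longrightarrow> j \<le> e \<Longrightarrow> k i < k j" and km: "\<And>i. i \<le> e \<Longrightarrow> k i \<le> m"
  defines "x \<equiv> (\<Sum>i<Suc e. sgl (k i - i) 1) :: monomial"
  shows "supp (row_minor e k - sgl x 1) \<subseteq> {a. supp a \<subseteq> {..m} \<and> deg a = Suc e \<and> W x < W a}"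
proof -
  have ki: "i \<le> k i" if "i \<le> e" for i
    using that
  proof (induction i)
    case (Suc i)
    have "i \<le> k i" by (rule Suc.IH) (use Suc.prems in simp)
    moreover have "k i < k (Suc i)" by (rule k) (use Suc.prems in simp_all)
    ultimately show ?case by simp
  qed simp
  define T where "T p = signof p * (\<Prod>i=0..<Suc e. toeplitz_entry (k i) (p i))" for p
  have D: "row_minor e k = (\<Sum>p | p permutes {0..<Suc e}. T p)"
  proof -
    define A where "A = mat (Suc e) (Suc e) (\<lambda>(i, j). toeplitz_entry (k i) j)"
    have A: "A \<in> carrier_mat (Suc e) (Suc e)" by (simp add: A_def)
    have "(\<Prod>i=0..<Suc e. A $$ (i, p i)) = (\<Prod>i=0..<Suc e. toeplitz_entry (k i) (p i))"
      if "p permutes {0..<Suc e}" for p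
    proof (rule prod.cong)
      fix i assume i: "i \<in> {0..<Suc e}"
      then have "p i \<in> {0..<Suc e}" using that by (simp only: permutes_in_image)
      with i show "A $$ (i, p i) = toeplitz_entry (k i) (p i)" by (simp add: A_def)
    qed simp
    then show ?thesis
      unfolding row_minor_def A_def[symmetric] T_def det_def'[OF A] by (intro sum.cong) (simp_all only: mem_Collect_eq)
  qed
  have fin: "finite {p. p permutes {0..<Suc e}}" by (simp add: finite_permutations)
  have TT0: "T p = 0" if "\<not> (\<forall>i\<in>{..<Suc e}. p i \<le> k i)" for p
    unfolding T_def atLeast0LessThan prod_toeplitz_entry[OF finite_lessThan] if_not_P[OF that] by (rule mult_zero_right)
  have TT1: "T p = signof p * sgl (\<Sum>i<Suc e. sgl (k i - p i) 1) 1" if "\<forall>i\<in>{..<Suc e}. p i \<le> k i" for p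
    unfolding T_def atLeast0LessThan prod_toeplitz_entry[OF finite_lessThan] if_P[OF that] by (rule refl)
  have "T id = sgl x 1"
    unfolding x_def by (subst TT1) (use ki in \<open>simp_all add: sign_id less_Suc_eq_le del: sum.lessThan_Suc\<close>)
  then have "row_minor e k - sgl x 1 = (\<Sum>p\<in>{p. p permutes {0..<Suc e}} - {id}. T p)"
    unfolding D by (subst sum.remove[OF fin, of id]) (auto simp: permutes_id)
  also have "supp \<dots> \<subseteq> (\<Union>p\<in>{p. p permutes {0..<Suc e}} - {id}. supp (T p))" by (rule supp_sum)
  also have "\<dots> \<subseteq> {a. supp a \<subseteq> {..m} \<and> deg a = Suc e \<and> W x < W a}"
  proof (rule UN_least)
    fix p assume "p \<in> {p. p permutes {0..<Suc e}} - {id}"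
    then have p: "p permutes {..<Suc e}" and pid: "p \<noteq> id" by (auto simp: atLeast0LessThan)
    show "supp (T p) \<subseteq> {a. supp a \<subseteq> {..m} \<and> deg a = Suc e \<and> W x < W a}"
    proof (cases "\<forall>i\<in>{..<Suc e}. p i \<le> k i")
      case False
      then show ?thesis unfolding TT0[OF False] by simp
    next
      case True
      define y :: monomial where "y = (\<Sum>i<Suc e. sgl (k i - p i) 1)"
      have "T p = signof p * sgl y 1"
        unfolding y_def by (rule TT1[OF True])
      then have sT: "supp (T p) \<subseteq> {y}" by (simp add: sign_def supp_uminus)
      obtain i0 where i0: "p i0 \<noteq> i0" using pid by (auto simp: fun_eq_iff)
      then have i0e: "i0 < Suc e" using p by (metis lessThan_iff permutes_not_in)
      have ms: "mset (map p [0..<Suc e]) = mset (map (\<lambda>i. i) [0..<Suc e])"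
      proof -
        have "image_mset p (mset_set {0..<Suc e}) = mset_set {0..<Suc e}"
          using permutes_image_mset[of p "{0..<Suc e}"] p by (simp only: atLeast0LessThan)
        then show ?thesis by (simp only: mset_map mset_upt list.map_ident)
      qed
      have "(\<Sum>i<Suc e. (k i - i)\<^sup>2) < (\<Sum>i<Suc e. (k i - p i)\<^sup>2)"
        by (rule sum_square_diff_less[OF ms _ _ _ _ i0e i0]) (use k ki True in auto)
      then have "W x < W y" by (simp only: x_def y_def wt_sum wt_single mult_1)
      moreover have "deg y = Suc e" by (simp add: y_def deg_sum del: sum.lessThan_Suc)
      moreover have "supp y \<subseteq> {..m}"
      proof -
        have "k i - p i \<le> m" if "i < Suc e" for i using km[of i] that by simp
        then show ?thesis unfolding y_def by (subst supp_sum_monomial) auto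
      qed
      ultimately show ?thesis using sT by blast
    qed
  qed
  finally show ?thesis .
qed

text \<open>This is the Laplace expansion along column \<open>j\<close> of the matrix on
  \<open>e + 2\<close> rows with columns \<open>0, ..., j, j, ..., e\<close>. Two equal columns make
  its determinant zero, and deleting one of them leaves the usual columns.\<close>

lemma row_minor_exchange:
  assumes "j \<le> e"
  shows "(\<Sum>i<Suc (Suc e). (-1) ^ (i + j) * toeplitz_entry (l i) j * row_minor e (\<lambda>i'. l (insert_index i i'))) = 0"
proof -
  define A where "A = mat (Suc (Suc e)) (Suc (Suc e)) (\<lambda>(i, q). toeplitz_entry (l i) (if q \<le> j then q else q - 1))"
  have A: "A \<in> carrier_mat (Suc (Suc e)) (Suc (Suc e))" by (simp add: A_def)
  have "det A = 0"
    by (rule det_identical_columns[OF A, of j "Suc j"]) (use assms in \<open>auto simp: A_def\<close>)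
  moreover have "det A = (\<Sum>i<Suc (Suc e). A $$ (i, j) * cofactor A i j)"
    by (rule laplace_expansion_column[OF A]) (use assms in simp)
  moreover have "A $$ (i, j) * cofactor A i j = (-1) ^ (i + j) * toeplitz_entry (l i) j * row_minor e (\<lambda>i'. l (insert_index i i'))"
    if "i < Suc (Suc e)" for i
  proof -
    have "mat_delete A i j = mat (Suc e) (Suc e) (\<lambda>(i', j'). toeplitz_entry (l (insert_index i i')) j')"
      using that assms by (intro eq_matI) (auto simp: mat_delete_def A_def insert_index_def)
    then show ?thesis using that assms by (simp add: cofactor_def row_minor_def A_def)
  qed
  ultimately show ?thesis by (metis (no_types, lifting) lessThan_iff sum.cong)
qed

lemma mset_insert_index:
  assumes "i < Suc n"
  shows "mset (map f [0..<Suc n]) = add_mset (f i) (mset (map (\<lambda>i'. f (insert_index i i')) [0..<n]))"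
proof -
  have im: "{0..<Suc n} = insert i (insert_index i ` {0..<n})"
    using assms insert_index_image[of i "n"] by (auto simp: insert_index_image)
  have ni: "i \<notin> insert_index i ` {0..<n}" by (auto simp: insert_index_def)
  have inj: "inj_on (insert_index i) {0..<n}" by (rule insert_index_inj_on)
  have "mset (map f [0..<Suc n]) = image_mset f (mset_set {0..<Suc n})"
    by (simp only: mset_map mset_upt)
  also have "\<dots> = add_mset (f i) (image_mset f (image_mset (insert_index i) (mset_set {0..<n})))"
    unfolding im using ni inj by (subst mset_set.insert) (auto simp: image_mset_mset_set)
  also have "\<dots> = add_mset (f i) (mset (map (\<lambda>i'. f (insert_index i i')) [0..<n]))"
    by (simp add: image_mset.compositionality comp_def flip: mset_upt)
  finally show ?thesis .
qed

section \<open>Exchange relations between the minors\<close>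

text \<open>If \<open>q\<close> is in the kernel of the matrix, the product of the polynomial with
  coefficients \<open>q\<close> and the series with coefficients \<open>c_k\<close> has no terms in
  degrees \<open>d + 1\<close> to \<open>m\<close>. This is the linear system of Pade approximation
  with numerator degree \<open>d\<close> and denominator degree \<open>e\<close>.\<close>

locale pade =
  fixes d e m :: nat
  assumes dem: "d + e < m"
begin

section \<open>Diagonals and multiples of minors\<close>

definition good :: "nat multiset \<Rightarrow> bool" where
  "good X \<longleftrightarrow> size X = Suc e \<and> set_mset X \<subseteq> {Suc d..m - e}"

text \<open>A minor is recorded by its main diagonal \<open>X\<close>: row \<open>i\<close> starts with \<open>c\<^sub>k\<close> for
  \<open>k = rows X i\<close>, so that its \<open>i\<close>-th entry is the \<open>i\<close>-th smallest variable in \<open>X\<close>.\<close>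

definition rows :: "nat multiset \<Rightarrow> nat \<Rightarrow> nat" where
  "rows X i = sorted_list_of_multiset X ! i + i"

definition diag_minor :: "nat multiset \<Rightarrow> cpoly" where
  "diag_minor X = row_minor e (rows X)"

text \<open>The multiple of the minor with diagonal \<open>X\<close> that has leading monomial
  \<open>M\<close>. Several \<open>X\<close> inside one \<open>M\<close> give competing multiples,
  whose differences the exchange relations control.\<close>

definition minor_term :: "nat multiset \<Rightarrow> nat multiset \<Rightarrow> cpoly" where
  "minor_term M X = sgl (mon (M - X)) 1 * diag_minor X"

text \<open>The error space of the exchange relations. Fixing the degree \<open>n\<close> is what
  later bounds the weights.\<close>

definition higher_span :: "nat \<Rightarrow> nat \<Rightarrow> cpoly set" where
  "higher_span n w = cpoly_vs.span {minor_term M X | M X. good X \<and> X \<subseteq># M \<and> set_mset M \<subseteq> {..m} \<and> size M = n \<and> w < W (mon M)}"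

lemma good_list:
  assumes "good X"
  shows "length (sorted_list_of_multiset X) = Suc e" "sorted (sorted_list_of_multiset X)"
    "\<And>i. i \<le> e \<Longrightarrow> sorted_list_of_multiset X ! i \<in> {Suc d..m - e}"
proof -
  have X: "mset (sorted_list_of_multiset X) = X" by simp
  then show l: "length (sorted_list_of_multiset X) = Suc e" using assms good_def by (metis size_mset)
  show "sorted (sorted_list_of_multiset X)" by simp
  show "sorted_list_of_multiset X ! i \<in> {Suc d..m - e}" if "i \<le> e" for i
    using nth_mem[of i "sorted_list_of_multiset X"] l that assms unfolding good_def by auto
qed

lemma good_rows:
  assumes "good X"
  shows "\<And>i j. i < j \<Longrightarrow> j \<le> e \<Longrightarrow> rows X i < rows X j" "\<And>i. i \<le> e \<Longrightarrow> d < rows X i \<and> rows X i \<le> m"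
proof -
  show "rows X i < rows X j" if "i < j" "j \<le> e" for i j
    using sorted_nth_mono[OF good_list(2)[OF assms], of i j] good_list(1)[OF assms] that
    by (simp add: rows_def)
  show "d < rows X i \<and> rows X i \<le> m" if "i \<le> e" for i
    using good_list(3)[OF assms that] that dem by (auto simp: rows_def)
qed

lemma mon_rows:
  assumes "good X"
  shows "(\<Sum>i<Suc e. sgl (rows X i - i) 1) = mon X"
proof -
  have "mon X = mon (mset (sorted_list_of_multiset X))" by simp
  also have "\<dots> = sum_list (map (\<lambda>i. sgl i 1) (sorted_list_of_multiset X))"
    unfolding mon_def by (metis mset_map sum_mset_sum_list)
  also have "\<dots> = (\<Sum>i<Suc e. sgl (sorted_list_of_multiset X ! i) 1)"
    using good_list(1)[OF assms] by (simp add: sum_list_sum_nth atLeast0LessThan del: sum.lessThan_Suc)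
  finally show ?thesis by (simp add: rows_def)
qed

lemma diag_minor_lead:
  assumes "good X"
  shows "supp (diag_minor X - sgl (mon X) 1) \<subseteq> {a. supp a \<subseteq> {..m} \<and> deg a = Suc e \<and> W (mon X) < W a}"
  unfolding diag_minor_def mon_rows[OF assms, symmetric]
  by (rule row_minor_lead) (use good_rows[OF assms] in blast)+

text \<open>Subtracting \<open>i\<close> turns strictly increasing subscripts between
  \<open>d + 1\<close> and \<open>m\<close> into weakly increasing ones between \<open>d + 1\<close>
  and \<open>m - e\<close>: the lower bound comes from counting up from row \<open>0\<close>, the
  upper one from counting down from row \<open>e\<close>. With \<open>good_rows\<close> this shows
  that good multisets index all maximal minors.\<close>

lemma row_minor_eq_diag_minor:
  assumes k: "\<And>i j. i < j \<Longrightarrow> j \<le> e \<Longrightarrow> k i < k j" and km: "\<And>i. i \<le> e \<Longrightarrow> d < k i \<and> k i \<le> m"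
  defines "X \<equiv> mset (map (\<lambda>i. k i - i) [0..<Suc e])"
  shows "good X \<and> row_minor e k = diag_minor X"
proof -
  have low: "d + i < k i" if "i \<le> e" for i
    using that
  proof (induction i)
    case 0
    then show ?case using km[of 0] by simp
  next
    case (Suc i)
    have "d + i < k i" by (rule Suc.IH) (use Suc.prems in simp)
    moreover have "k i < k (Suc i)" by (rule k) (use Suc.prems in simp_all)
    ultimately show ?case by simp
  qed
  have high: "k (e - i) \<le> m - i" if "i \<le> e" for i
    using that
  proof (induction i)
    case 0
    then show ?case using km[of e] by simp
  next
    case (Suc i)
    have "k (e - i) \<le> m - i" by (rule Suc.IH) (use Suc.prems in simp)
    moreover have "k (e - Suc i) < k (e - i)" by (rule k) (use Suc.prems in simp_all)
    ultimately show ?case by simp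
  qed
  have range: "k i - i \<in> {Suc d..m - e}" if "i \<le> e" for i
    using low[OF that] high[of "e - i"] that by auto
  have mono: "k i - i \<le> k j - j" if "i \<le> j" "j \<le> e" for i j
    using that
  proof (induction j rule: dec_induct)
    case (step n)
    have "k i - i \<le> k n - n" by (rule step.IH) (use step.prems in simp)
    moreover have "k n < k (Suc n)" by (rule k) (use step.prems in simp_all)
    ultimately show ?case by simp
  qed simp
  have "sorted (map (\<lambda>i. k i - i) [0..<Suc e])"
    by (subst sorted_iff_nth_mono) (use mono in \<open>auto simp del: upt_Suc\<close>)
  then have s: "sorted_list_of_multiset X = map (\<lambda>i. k i - i) [0..<Suc e]"
    unfolding X_def sorted_list_of_multiset_mset by (rule sorted_sort_id)
  have "good X"
    unfolding good_def X_def using range by (auto simp del: upt_Suc)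
  moreover have "row_minor e k = diag_minor X"
    unfolding diag_minor_def
  proof (rule row_minor_cong)
    fix i assume i: "i \<le> e"
    then show "k i = rows X i" using low[OF i] by (simp add: rows_def s del: upt_Suc)
  qed
  ultimately show ?thesis by blast
qed

lemma higher_span_mult:
  assumes "f \<in> higher_span n w" "set_mset R \<subseteq> {..m}"
  shows "sgl (mon R) 1 * f \<in> higher_span (n + size R) (w + W (mon R))"
  using assms(1) unfolding higher_span_def
proof (induction rule: cpoly_vs.span_induct_alt)
  case base
  then show ?case by (simp add: cpoly_vs.span_zero)
next
  case (step c x y)
  from step(1) obtain M X where x: "x = minor_term M X" "good X" "X \<subseteq># M" "set_mset M \<subseteq> {..m}" "size M = n" "w < W (mon M)" by blast
  have "sgl (mon R) 1 * x = minor_term (M + R) X"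
  proof -
    have "M + R - X = R + (M - X)" using x(3) by (metis add.commute subset_mset.add_diff_assoc2)
    then show ?thesis by (simp add: x(1) minor_term_def mon_union mult_single flip: mult.assoc)
  qed
  moreover have "minor_term (M + R) X \<in> cpoly_vs.span {minor_term M X |M X. good X \<and> X \<subseteq># M \<and> set_mset M \<subseteq> {..m} \<and> size M = n + size R \<and> w + W (mon R) < W (mon M)}"
    by (rule cpoly_vs.span_base, rule CollectI, rule exI[of _ "M + R"], rule exI[of _ X])
      (use x assms(2) in \<open>auto simp: mon_union wt_add intro: subset_mset.add_increasing2\<close>)
  ultimately have "sgl 0 c * (sgl (mon R) 1 * x) + sgl (mon R) 1 * y \<in> cpoly_vs.span {minor_term M X |M X. good X \<and> X \<subseteq># M \<and> set_mset M \<subseteq> {..m} \<and> size M = n + size R \<and> w + W (mon R) < W (mon M)}"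
    using step by (intro cpoly_vs.span_add cpoly_vs.span_scale) auto
  then show ?case by (simp add: algebra_simps)
qed

lemma W_mset_map: "W (mon (mset (map f [0..<n]))) = (\<Sum>i<n. (f i)\<^sup>2)"
  by (simp add: wt_mon sum_mset_sum_list interv_sum_list_conv_sum_set_nat atLeast0LessThan comp_def flip: mset_map)

text \<open>The column assignment of the \<open>i\<close>-th summand in the expansion along the repeated column \<open>j\<close>.\<close>

definition cols :: "nat \<Rightarrow> nat \<Rightarrow> nat \<Rightarrow> nat" where
  "cols j i q = (if q = i then j else if q < i then q else q - 1)"

lemma cols_insert_index: "cols j i (insert_index i q) = q" "cols j i i = j"
  by (auto simp: cols_def insert_index_def)

lemma mset_cols:
  assumes "i < Suc n"
  shows "mset (map (cols j i) [0..<Suc n]) = add_mset j (mset [0..<n])"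
  using mset_insert_index[OF assms, of "cols j i"] by (simp add: cols_insert_index del: upt_Suc)

text \<open>In the expansion along the repeated column only the summands \<open>j\<close> and \<open>j + 1\<close> have a monotone
  column assignment; by rearrangement all others have larger weight.\<close>

lemma exchange_step:
  assumes bs: "sorted bs" "length bs = Suc (Suc e)" "set bs \<subseteq> {Suc d..m - e}" and j: "j \<le> e"
  defines "B \<equiv> mset bs"
  shows "var (bs ! j) * diag_minor (B - {#bs ! j#}) - var (bs ! Suc j) * diag_minor (B - {#bs ! Suc j#})
    \<in> higher_span (Suc (Suc e)) (W (mon B))"
proof (cases "bs ! j = bs ! Suc j")
  case True
  then show ?thesis by (simp add: higher_span_def cpoly_vs.span_zero)
next
  case False
  have mono: "bs ! i \<le> bs ! i'" if "i \<le> i'" "i' \<le> Suc e" for i i'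
    using sorted_nth_mono[OF bs(1), of i i'] bs(2) that by simp
  have range: "bs ! i \<in> {Suc d..m - e}" if "i \<le> Suc e" for i
  proof -
    have "bs ! i \<in> set bs" using bs(2) that by simp
    then show ?thesis using bs(3) by blast
  qed
  have lt: "bs ! j < bs ! Suc j" using mono[of j "Suc j"] j False by simp
  \<comment> \<open>The rows are chosen so that \<open>cols j j\<close> and
    \<open>cols j (Suc j)\<close>, which are the same function, both read off the entries
    \<open>bs ! i\<close>. Rows \<open>j\<close> and \<open>j + 1\<close> share column
    \<open>j\<close>, so \<open>l\<close> is strictly increasing only thanks to
    \<open>bs ! j < bs ! Suc j\<close>.\<close>
  define l where "l i = (if i \<le> j then bs ! i + i else bs ! i + i - 1)" for i
  have lmono: "l i < l i'" if i: "i < i'" "i' \<le> Suc e" for i i'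
  proof -
    have "bs ! i \<le> bs ! i'" using mono i by simp
    moreover have "bs ! i < bs ! i'" if "i \<le> j" "j < i'"
    proof -
      have "bs ! i \<le> bs ! j" by (rule mono) (use that j in simp_all)
      also have "\<dots> < bs ! Suc j" by (rule lt)
      also have "\<dots> \<le> bs ! i'" by (rule mono) (use that i in simp_all)
      finally show ?thesis .
    qed
    ultimately show ?thesis using i by (auto simp: l_def)
  qed
  have lrange: "d < l i \<and> l i \<le> m" if "i \<le> Suc e" for i
    using range[OF that] that j dem by (auto simp: l_def)
  define k where "k i i' = l (insert_index i i')" for i i'
  define X where "X i = mset (map (\<lambda>i'. k i i' - i') [0..<Suc e])" for i
  have X: "good (X i) \<and> row_minor e (k i) = diag_minor (X i)" for i
    unfolding X_def
    by (rule row_minor_eq_diag_minor) (use lmono lrange in \<open>auto simp: k_def insert_index_def\<close>)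
  have addX: "add_mset (l i - j) (X i) = mset (map (\<lambda>q. l q - cols j i q) [0..<Suc (Suc e)])"
    if "i \<le> Suc e" for i
    using mset_insert_index[of i "Suc e" "\<lambda>q. l q - cols j i q"] that
    by (simp add: X_def k_def cols_insert_index del: upt_Suc)
  have lb: "l q - cols j j q = bs ! q" if "q \<le> Suc e" for q
    by (auto simp: l_def cols_def)
  have lb': "l q - cols j (Suc j) q = bs ! q" if "q \<le> Suc e" for q
    by (auto simp: l_def cols_def)
  have mapbs: "mset (map (\<lambda>q. bs ! q) [0..<Suc (Suc e)]) = B"
    using bs(2) B_def by (metis map_nth)
  have lj: "l j - j = bs ! j" "l (Suc j) - j = bs ! Suc j" by (auto simp: l_def)
  have maplb: "map (\<lambda>q. l q - cols j j q) [0..<Suc (Suc e)] = map (\<lambda>q. bs ! q) [0..<Suc (Suc e)]"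
    by (rule map_cong[OF refl]) (use lb in \<open>simp del: upt_Suc\<close>)
  have maplb': "map (\<lambda>q. l q - cols j (Suc j) q) [0..<Suc (Suc e)] = map (\<lambda>q. bs ! q) [0..<Suc (Suc e)]"
    by (rule map_cong[OF refl]) (use lb' in \<open>simp del: upt_Suc\<close>)
  have B1: "add_mset (bs ! j) (X j) = B"
    using addX[of j] j unfolding mapbs[symmetric] maplb lj by simp
  have B2: "add_mset (bs ! Suc j) (X (Suc j)) = B"
    using addX[of "Suc j"] j unfolding mapbs[symmetric] maplb' lj by simp
  have X1: "X j = B - {#bs ! j#}" by (simp flip: B1)
  have X2: "X (Suc j) = B - {#bs ! Suc j#}" by (simp flip: B2)
  define s where "s i = (-1) ^ (i + j) * toeplitz_entry (l i) j * diag_minor (X i)" for i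
  have s0: "(\<Sum>i<Suc (Suc e). s i) = 0"
  proof -
    have "row_minor e (\<lambda>i'. l (insert_index i i')) = diag_minor (X i)" for i
      using X[of i] by (simp only: k_def[abs_def])
    then show ?thesis using row_minor_exchange[OF j, of l] by (simp only: s_def)
  qed
  have s1: "(\<Sum>i<Suc (Suc e). s i) = s j + s (Suc j) + (\<Sum>i\<in>{..<Suc (Suc e)} - {j, Suc j}. s i)"
  proof -
    have eq: "{..<Suc (Suc e)} = {j, Suc j} \<union> ({..<Suc (Suc e)} - {j, Suc j})" using j by auto
    show ?thesis by (subst eq, subst sum.union_disjoint) auto
  qed
  have s2: "s j = var (bs ! j) * diag_minor (B - {#bs ! j#})"
    unfolding s_def X1 by (simp add: toeplitz_entry_def lj) (auto simp: l_def)
  have s3: "s (Suc j) = - var (bs ! Suc j) * diag_minor (B - {#bs ! Suc j#})"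
    unfolding s_def X2 by (simp add: toeplitz_entry_def lj) (use lt in \<open>auto simp: l_def\<close>)
  have "s i \<in> higher_span (Suc (Suc e)) (W (mon B))" if i: "i \<in> {..<Suc (Suc e)} - {j, Suc j}" for i
  proof (cases "j \<le> l i")
    case False
    then show ?thesis by (simp add: s_def toeplitz_entry_def higher_span_def cpoly_vs.span_zero)
  next
    case True
    define M where "M = add_mset (l i - j) (X i)"
    have "W (mon B) = (\<Sum>q<Suc (Suc e). (l q - cols j j q)\<^sup>2)"
      unfolding mapbs[symmetric] W_mset_map by (rule sum.cong) (use lb in auto)
    also have "\<dots> < (\<Sum>q<Suc (Suc e). (l q - cols j i q)\<^sup>2)"
    proof (rule sum_square_diff_less)
      show "mset (map (cols j i) [0..<Suc (Suc e)]) = mset (map (cols j j) [0..<Suc (Suc e)])"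
      proof -
        have "i < Suc (Suc e)" "j < Suc (Suc e)" using i j by simp_all
        then show ?thesis by (simp only: mset_cols)
      qed
      have lq': "q \<le> l q" if "q \<le> Suc e" for q using range[OF that] by (auto simp: l_def)
      show "cols j j q \<le> l q" if "q < Suc (Suc e)" for q using lq'[of q] that by (auto simp: cols_def)
      show "cols j i q \<le> l q" if "q < Suc (Suc e)" for q using lq'[of q] True that by (auto simp: cols_def)
      show "i < Suc (Suc e)" using i by simp
      show "cols j i i \<noteq> cols j j i" using i by (auto simp: cols_def)
    qed (auto simp: cols_def intro: lmono)
    also have "\<dots> = W (mon M)"
    proof -
      have ie: "i \<le> Suc e" using i by simp
      show ?thesis unfolding M_def addX[OF ie] W_mset_map by (rule refl)
    qed
    finally have w: "W (mon B) < W (mon M)" .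
    have tm: "minor_term M (X i) \<in> higher_span (Suc (Suc e)) (W (mon B))"
      unfolding higher_span_def
    proof (rule cpoly_vs.span_base, rule CollectI, rule exI[of _ M], rule exI[of _ "X i"], intro conjI refl)
      have g: "good (X i)" using X by blast
      show "good (X i)" by (rule g)
      have "x \<le> m" if "x \<in># X i" for x
      proof -
        have "x \<in> {Suc d..m - e}" using g that unfolding good_def by blast
        then show ?thesis by (meson atLeastAtMost_iff diff_le_self le_trans)
      qed
      then show "set_mset M \<subseteq> {..m}" using lrange[of i] i by (auto simp: M_def)
      show "size M = Suc (Suc e)" using g by (simp add: M_def good_def)
    qed (use w in \<open>auto simp: M_def\<close>)
    have si: "s i = sgl 0 ((-1) ^ (i + j)) * minor_term M (X i)"
    proof -
      have "(-1 :: cpoly) ^ n = sgl 0 ((-1) ^ n)" for n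
        by (induction n) (auto simp: mult_single simp flip: single_uminus)
      then show ?thesis using True by (simp add: s_def minor_term_def M_def toeplitz_entry_def var_def mult.assoc)
    qed
    show ?thesis unfolding si using tm unfolding higher_span_def by (rule cpoly_vs.span_scale)
  qed
  then have "(\<Sum>i\<in>{..<Suc (Suc e)} - {j, Suc j}. s i) \<in> higher_span (Suc (Suc e)) (W (mon B))"
    unfolding higher_span_def by (rule cpoly_vs.span_sum)
  then have "- (\<Sum>i\<in>{..<Suc (Suc e)} - {j, Suc j}. s i) \<in> higher_span (Suc (Suc e)) (W (mon B))"
    unfolding higher_span_def by (rule cpoly_vs.span_neg)
  moreover have "var (bs ! j) * diag_minor (B - {#bs ! j#}) - var (bs ! Suc j) * diag_minor (B - {#bs ! Suc j#}) =
    - (\<Sum>i\<in>{..<Suc (Suc e)} - {j, Suc j}. s i)"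
  proof -
    have "x + - y * z + S = 0 \<Longrightarrow> x - y * z = - S" for x y z S :: cpoly
      by (simp add: algebra_simps eq_neg_iff_add_eq_0)
    then show ?thesis using s0 unfolding s1 s2 s3 .
  qed
  ultimately show ?thesis by (simp only:)
qed

text \<open>Terms for neighbouring entries of the sorted list agree up to heavier ones, and the
  bound \<open>W (mon B)\<close> is the same for each pair, so the differences telescope.\<close>

lemma exchange:
  assumes B: "size B = Suc (Suc e)" "set_mset B \<subseteq> {Suc d..m - e}" and ab: "a \<in># B" "b \<in># B"
  shows "var a * diag_minor (B - {#a#}) - var b * diag_minor (B - {#b#}) \<in> higher_span (Suc (Suc e)) (W (mon B))"
proof -
  define bs where "bs = sorted_list_of_multiset B"
  have bs: "mset bs = B" "sorted bs" by (simp_all add: bs_def)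
  have len: "length bs = Suc (Suc e)" using B(1) bs(1) by (metis size_mset)
  have set: "set bs \<subseteq> {Suc d..m - e}" using B(2) bs(1) by (metis set_mset_mset)
  define F where "F p = var (bs ! p) * diag_minor (B - {#bs ! p#})" for p
  have step: "F p - F (Suc p) \<in> higher_span (Suc (Suc e)) (W (mon B))" if "p \<le> e" for p
    using exchange_step[OF bs(2) len set that] by (simp only: F_def bs(1))
  have F0: "F 0 - F p \<in> higher_span (Suc (Suc e)) (W (mon B))" if "p \<le> Suc e" for p
    using that
  proof (induction p)
    case 0
    then show ?case by (simp add: higher_span_def cpoly_vs.span_zero)
  next
    case (Suc p)
    have "(F 0 - F p) + (F p - F (Suc p)) \<in> higher_span (Suc (Suc e)) (W (mon B))"
      using Suc.IH step[of p] Suc.prems unfolding higher_span_def by (intro cpoly_vs.span_add) simp_all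
    then show ?case by simp
  qed
  obtain p q where pq: "p \<le> Suc e" "a = bs ! p" "q \<le> Suc e" "b = bs ! q"
    using ab len bs(1) by (metis in_set_conv_nth less_Suc_eq_le set_mset_mset)
  have "(F 0 - F q) - (F 0 - F p) \<in> higher_span (Suc (Suc e)) (W (mon B))"
    using F0[OF pq(3)] F0[OF pq(1)] unfolding higher_span_def by (rule cpoly_vs.span_diff)
  then show ?thesis using pq by (simp add: F_def)
qed

text \<open>Both \<open>X\<close> and \<open>X'\<close> arise from \<open>add_mset a X\<close>, of
  size \<open>e + 2\<close>, by dropping one element, so the exchange relation compares them; the
  rest of \<open>M\<close> is a common monomial factor.\<close>

lemma minor_term_swap:
  assumes "good X" "X \<subseteq># M" "set_mset M \<subseteq> {..m}" "a \<in># M - X" "a \<in> {Suc d..m - e}" "b \<in># X"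
  defines "X' \<equiv> add_mset a X - {#b#}"
  shows "good X'" "X' \<subseteq># M" "minor_term M X - minor_term M X' \<in> higher_span (size M) (W (mon M))"
proof -
  define B where "B = add_mset a X"
  have "B \<subseteq># M"
  proof (rule mset_subset_eqI)
    fix x
    have "count X x \<le> count M x" using assms(2) by (rule mset_subset_eq_count)
    moreover have "count X a < count M a" using assms(4) by (simp add: in_diff_count)
    ultimately show "count B x \<le> count M x" by (auto simp: B_def)
  qed
  then obtain R where M: "M = B + R" by (metis subset_mset.le_iff_add)
  have sB: "size B = Suc (Suc e)" "set_mset B \<subseteq> {Suc d..m - e}"
    using assms(1,5) by (auto simp: B_def good_def)
  have bB: "b \<in># B" "a \<in># B" using assms(6) by (simp_all add: B_def)
  have BX': "B = add_mset b X'" using bB by (simp add: X'_def B_def)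
  show "good X'" using sB unfolding BX' good_def by simp
  show "X' \<subseteq># M" unfolding M BX' by simp
  have "M - X = add_mset a R" by (simp add: M B_def)
  moreover have "M - X' = add_mset b R" by (simp add: M BX')
  moreover have "B - {#a#} = X" "B - {#b#} = X'" by (simp add: B_def, simp add: BX')
  ultimately have "minor_term M X - minor_term M X' = sgl (mon R) 1 * (var a * diag_minor (B - {#a#}) - var b * diag_minor (B - {#b#}))"
    by (simp add: minor_term_def var_def right_diff_distrib mult_single flip: mult.assoc) (simp add: add.commute)
  moreover have "set_mset R \<subseteq> {..m}" using assms(3) M by simp
  ultimately show "minor_term M X - minor_term M X' \<in> higher_span (size M) (W (mon M))"
    using higher_span_mult[OF exchange[OF sB bB(2,1)], of R] by (simp add: M mon_union wt_add sB)
qed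

text \<open>Swapping an element of \<open>X - X'\<close> for one of \<open>X' - X\<close> stays
  inside \<open>M\<close> and brings \<open>X\<close> one step closer to \<open>X'\<close>, as for
  bases of a matroid. All swaps have their errors in the same \<open>higher_span\<close>.\<close>

lemma minor_term_connected:
  assumes "good X" "X \<subseteq># M" "good X'" "X' \<subseteq># M" "set_mset M \<subseteq> {..m}"
  shows "minor_term M X - minor_term M X' \<in> higher_span (size M) (W (mon M))"
  using assms(1,2)
proof (induction "size (X - X')" arbitrary: X)
  case 0
  then have "X \<subseteq># X'" by (simp add: Diff_eq_empty_iff_mset)
  moreover have "size X = size X'" using 0 assms(3) by (simp add: good_def)
  ultimately have "X = X'" by (metis mset_subset_size nat_less_le subset_mset.le_neq_trans)
  then show ?case by (simp add: higher_span_def cpoly_vs.span_zero)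
next
  case (Suc n)
  have sz: "size X = size X'" using Suc.prems assms(3) by (simp add: good_def)
  obtain b where b: "b \<in># X - X'" using Suc.hyps(2) by (metis multiset_nonemptyE size_empty nat.distinct(1))
  have "X' - X \<noteq> {#}"
  proof
    assume "X' - X = {#}"
    then have "X' \<subseteq># X" by (simp add: Diff_eq_empty_iff_mset)
    then have "X' = X" using sz by (metis mset_subset_size nat_less_le subset_mset.le_neq_trans)
    then show False using b by simp
  qed
  then obtain a where a: "a \<in># X' - X" by blast
  have ca: "count X a < count X' a" using a by (simp add: in_diff_count)
  have cb: "count X' b < count X b" using b by (simp add: in_diff_count)
  have "count X' a \<le> count M a" using assms(4) by (rule mset_subset_eq_count)
  then have aM: "a \<in># M - X" using ca by (simp add: in_diff_count)
  have "a \<in># X'" using a by (rule in_diffD)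
  then have aY: "a \<in> {Suc d..m - e}" using assms(3) unfolding good_def by blast
  have bX: "b \<in># X" using b by (rule in_diffD)
  define X2 where "X2 = add_mset a X - {#b#}"
  note sw = minor_term_swap[OF Suc.prems assms(5) aM aY bX, folded X2_def]
  have "add_mset b (X2 - X') = X - X'"
    by (rule multiset_eqI) (use ca cb in \<open>auto simp: X2_def\<close>)
  then have "size (X2 - X') = n" using Suc.hyps(2) by (metis size_add_mset nat.inject)
  then have "minor_term M X2 - minor_term M X' \<in> higher_span (size M) (W (mon M))"
    by (intro Suc.hyps(1) sw(1,2)) simp
  from cpoly_vs.span_add[OF sw(3)[unfolded higher_span_def] this[unfolded higher_span_def]]
  show ?case by (simp add: higher_span_def)
qed

section \<open>One generator for each leading monomial\<close>

definition admissible :: "nat multiset \<Rightarrow> bool" where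
  "admissible M \<longleftrightarrow> set_mset M \<subseteq> {..m} \<and> (\<exists>X. good X \<and> X \<subseteq># M)"

text \<open>An arbitrary choice among the competing multiples; by
  \<open>minor_term_connected\<close> another choice differs only by heavier multiples.\<close>

definition std_gen :: "nat multiset \<Rightarrow> cpoly" where
  "std_gen M = minor_term M (SOME X. good X \<and> X \<subseteq># M)"

lemma std_gen_obtain:
  assumes "admissible M"
  obtains X where "good X" "X \<subseteq># M" "std_gen M = minor_term M X"
  using someI_ex[of "\<lambda>X. good X \<and> X \<subseteq># M"] assms unfolding admissible_def std_gen_def by blast

definition gen_span :: "cpoly set" where
  "gen_span = cpoly_vs.span (std_gen ` {M. admissible M})"

text \<open>Weights are bounded in a fixed degree, so replacing multiples of minors by heavier ones
  terminates, with measure \<open>size M * m\<^sup>2 - W (mon M)\<close>.\<close>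

lemma W_le: "set_mset M \<subseteq> {..m} \<Longrightarrow> W (mon M) \<le> size M * m\<^sup>2"
proof (induction M)
  case (add x M)
  then have "x\<^sup>2 \<le> m\<^sup>2" by (simp add: power_mono del: power2_eq_iff_nonneg)
  moreover have "W (mon M) \<le> size M * m\<^sup>2" using add by simp
  ultimately have "x\<^sup>2 + W (mon M) \<le> m\<^sup>2 + size M * m\<^sup>2" by (rule add_mono)
  then show ?case by (simp add: wt_add)
qed simp

text \<open>Modulo strictly heavier multiples of the same degree, which lie in the span by
  induction, \<open>minor_term M X\<close> equals the chosen generator for \<open>M\<close>.\<close>

lemma minor_term_in_gen_span:
  assumes "good X" "X \<subseteq># M" "set_mset M \<subseteq> {..m}"
  shows "minor_term M X \<in> gen_span"
  using assms
proof (induction "size M * m\<^sup>2 - W (mon M)" arbitrary: M X rule: less_induct)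
  case less
  have adm: "admissible M" using less.prems unfolding admissible_def by blast
  obtain X' where X': "good X'" "X' \<subseteq># M" "std_gen M = minor_term M X'" using std_gen_obtain[OF adm] .
  have "{minor_term M' X | M' X. good X \<and> X \<subseteq># M' \<and> set_mset M' \<subseteq> {..m} \<and> size M' = size M \<and> W (mon M) < W (mon M')} \<subseteq> gen_span"
  proof clarify
    fix M' X assume a: "good X" "X \<subseteq># M'" "set_mset M' \<subseteq> {..m}" "size M' = size M" "W (mon M) < W (mon M')"
    have "size M' * m\<^sup>2 - W (mon M') < size M * m\<^sup>2 - W (mon M)"
      using W_le[OF a(3)] a(4,5) by simp
    then show "minor_term M' X \<in> gen_span" using a(1-3) by (rule less.hyps)
  qed
  then have "higher_span (size M) (W (mon M)) \<subseteq> gen_span"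
    unfolding higher_span_def by (rule cpoly_vs.span_minimal) (simp add: gen_span_def cpoly_vs.subspace_span)
  with minor_term_connected[OF less.prems(1,2) X'(1,2) less.prems(3)]
  have "minor_term M X - std_gen M \<in> gen_span" unfolding X'(3) by blast
  moreover have "std_gen M \<in> gen_span" unfolding gen_span_def using adm by (intro cpoly_vs.span_base) simp
  ultimately have "(minor_term M X - std_gen M) + std_gen M \<in> gen_span" unfolding gen_span_def by (rule cpoly_vs.span_add)
  then show ?case by simp
qed

lemma std_gen_lead:
  assumes "admissible M" "a \<in> supp (std_gen M - sgl (mon M) 1)"
  shows "W (mon M) < W a"
proof -
  obtain X where X: "good X" "X \<subseteq># M" "std_gen M = minor_term M X" using std_gen_obtain[OF assms(1)] .
  have M: "mon M = mon (M - X) + mon X" using X(2) by (simp flip: mon_union)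
  have "std_gen M - sgl (mon M) 1 = sgl (mon (M - X)) 1 * (diag_minor X - sgl (mon X) 1)"
    unfolding X(3) minor_term_def M by (simp add: right_diff_distrib mult_single)
  then obtain b where b: "b \<in> supp (diag_minor X - sgl (mon X) 1)" "a = mon (M - X) + b"
    using assms(2) supp_single_mult[of "mon (M - X)" 1 "diag_minor X - sgl (mon X) 1"] by auto
  then show ?thesis using diag_minor_lead[OF X(1)] by (auto simp: M wt_add)
qed

text \<open>The generators are unitriangular with respect to weight. Distinct leading monomials of
  equal weight do not interfere, since all further terms of a generator are strictly
  heavier.\<close>

lemma std_gen_coef:
  assumes "admissible M" "W a \<le> W (mon M)"
  shows "coef (std_gen M) a = (if a = mon M then 1 else 0)"
proof -
  have "a \<notin> supp (std_gen M - sgl (mon M) 1)" using std_gen_lead[OF assms(1), of a] assms(2) by auto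
  then show ?thesis by (simp add: in_keys_iff lookup_minus coef_single)
qed

definition Ydeg :: "monomial \<Rightarrow> nat" where
  "Ydeg = wt (\<lambda>i. if i \<in> {Suc d..m - e} then 1 else 0)"

text \<open>Every multiset of \<open>e + 1\<close> middle indices is good, so containing a diagonal
  is a condition on the degree in the middle variables alone. The leading monomials of the minors
  thus generate the \<open>(e + 1)\<close>-st power of the ideal of these variables.\<close>

lemma admissible_iff:
  "admissible M \<longleftrightarrow> set_mset M \<subseteq> {..m} \<and> e < Ydeg (mon M)"
proof -
  have Y: "Ydeg (mon M) = size (filter_mset (\<lambda>i. i \<in> {Suc d..m - e}) M)"
    unfolding Ydeg_def by (induction M) (auto simp: wt_add)
  have "(\<exists>X. good X \<and> X \<subseteq># M) \<longleftrightarrow> e < size (filter_mset (\<lambda>i. i \<in> {Suc d..m - e}) M)"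
  proof
    assume "\<exists>X. good X \<and> X \<subseteq># M"
    then obtain X where X: "good X" "X \<subseteq># M" by blast
    have "filter_mset (\<lambda>i. i \<in> {Suc d..m - e}) X = X"
      using X(1) unfolding good_def filter_mset_eq_conv by auto
    then have "X \<subseteq># filter_mset (\<lambda>i. i \<in> {Suc d..m - e}) M"
      using multiset_filter_mono[OF X(2)] by metis
    then show "e < size (filter_mset (\<lambda>i. i \<in> {Suc d..m - e}) M)"
      using size_mset_mono[of X] X(1) by (fastforce simp: good_def)
  next
    assume e: "e < size (filter_mset (\<lambda>i. i \<in> {Suc d..m - e}) M)"
    define xs where "xs = sorted_list_of_multiset (filter_mset (\<lambda>i. i \<in> {Suc d..m - e}) M)"
    have xs: "mset xs = filter_mset (\<lambda>i. i \<in> {Suc d..m - e}) M" by (simp add: xs_def)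
    have sub: "mset (take (Suc e) xs) \<subseteq># filter_mset (\<lambda>i. i \<in> {Suc d..m - e}) M"
      unfolding xs[symmetric] by (metis append_take_drop_id mset_append mset_subset_eq_add_left)
    have "length xs > e" using e unfolding xs[symmetric] by simp
    then have "good (mset (take (Suc e) xs))"
      using set_mset_mono[OF sub] by (auto simp: good_def)
    moreover have "mset (take (Suc e) xs) \<subseteq># M"
      using sub multiset_filter_subset subset_mset.order_trans by blast
    ultimately show "\<exists>X. good X \<and> X \<subseteq># M" by blast
  qed
  then show ?thesis by (simp add: admissible_def Y)
qed

text \<open>In a combination with nonzero coefficients, take a generator of least leading weight: by
  unitriangularity its leading monomial receives no contribution from the others and
  survives.\<close>

lemma gen_span_nonzero:
  assumes "f \<in> gen_span" "f \<noteq> 0"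
  shows "\<exists>a\<in>supp f. e < Ydeg a"
proof -
  from assms(1) obtain t r where t: "finite t" "t \<subseteq> std_gen ` {M. admissible M}"
      and f: "f = (\<Sum>b\<in>t. sgl 0 (r b) * b)"
    unfolding gen_span_def cpoly_vs.span_explicit by blast
  define t' where "t' = {b \<in> t. r b \<noteq> 0}"
  have f': "f = (\<Sum>b\<in>t'. sgl 0 (r b) * b)"
    unfolding f t'_def by (rule sum.mono_neutral_right) (use t(1) in auto)
  have "\<forall>b\<in>t'. \<exists>M. admissible M \<and> b = std_gen M" using t(2) unfolding t'_def by blast
  then obtain N where N: "\<And>b. b \<in> t' \<Longrightarrow> admissible (N b) \<and> b = std_gen (N b)" by metis
  have ft: "finite t'" using t(1) by (simp add: t'_def)
  have "t' \<noteq> {}" using f' assms(2) by auto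
  then obtain b1 where "b1 \<in> t'" by blast
  from ex_has_least_nat[of "\<lambda>b. b \<in> t'", OF this, of "\<lambda>b. W (mon (N b))"]
  obtain b0 where b0: "b0 \<in> t'" "\<And>b. b \<in> t' \<Longrightarrow> W (mon (N b0)) \<le> W (mon (N b))" by blast
  have "coef f (mon (N b0)) = (\<Sum>b\<in>t'. if b = b0 then r b else 0)"
    unfolding f' lookup_sum
  proof (rule sum.cong)
    fix b assume b: "b \<in> t'"
    have Nb: "admissible (N b)" "b = std_gen (N b)" using N[OF b] by blast+
    have "coef b (mon (N b0)) = coef (std_gen (N b)) (mon (N b0))" by (simp only: Nb(2)[symmetric])
    also have "\<dots> = (if mon (N b0) = mon (N b) then 1 else 0)"
      by (rule std_gen_coef[OF Nb(1) b0(2)[OF b]])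
    also have "mon (N b0) = mon (N b) \<longleftrightarrow> b = b0"
      using N[OF b] N[OF b0(1)] mon_inject by metis
    finally show "coef (sgl 0 (r b) * b) (mon (N b0)) = (if b = b0 then r b else 0)"
      by (simp add: coef_scale)
  qed simp
  also have "\<dots> = r b0" using ft b0(1) by simp
  finally have "mon (N b0) \<in> supp f" using b0(1) by (simp add: t'_def in_keys_iff)
  then show ?thesis using N[OF b0(1)] admissible_iff by blast
qed

end

section \<open>The polynomial ring and the minors of \<open>P_T\<close>\<close>

lemma carrier_poly_ring: "f \<in> carrier (poly_ring m) \<longleftrightarrow> (\<forall>a\<in>supp f. supp a \<subseteq> {..m})"
  by (simp add: poly_ring_def)

lemma poly_ring_simps [simp]:
  "f \<otimes>\<^bsub>poly_ring m\<^esub> g = f * g" "f \<oplus>\<^bsub>poly_ring m\<^esub> g = f + g"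
  "\<one>\<^bsub>poly_ring m\<^esub> = 1" "\<zero>\<^bsub>poly_ring m\<^esub> = 0"
  by (simp_all add: poly_ring_def)

lemma carrier_add:
  assumes "f \<in> carrier (poly_ring m)" "g \<in> carrier (poly_ring m)"
  shows "f + g \<in> carrier (poly_ring m)"
  unfolding carrier_poly_ring
proof
  fix a assume "a \<in> supp (f + g)"
  then have "a \<in> supp f \<union> supp g" using keys_add[of f g] by (rule rev_subsetD)
  then show "supp a \<subseteq> {..m}" using assms unfolding carrier_poly_ring by blast
qed

lemma carrier_mult:
  assumes "f \<in> carrier (poly_ring m)" "g \<in> carrier (poly_ring m)"
  shows "f * g \<in> carrier (poly_ring m)"
  unfolding carrier_poly_ring
proof
  fix a assume "a \<in> supp (f * g)"
  then obtain b c where "b \<in> supp f" "c \<in> supp g" "a = b + c" using keys_mult[of f g] by blast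
  then show "supp a \<subseteq> {..m}" using assms unfolding carrier_poly_ring by (simp add: supp_add_monomial)
qed

lemma carrier_uminus: "f \<in> carrier (poly_ring m) \<Longrightarrow> - f \<in> carrier (poly_ring m)"
  by (simp add: carrier_poly_ring supp_uminus)

lemma carrier_single: "supp a \<subseteq> {..m} \<Longrightarrow> sgl a c \<in> carrier (poly_ring m)"
  by (simp add: carrier_poly_ring)

lemma carrier_var: "i \<le> m \<Longrightarrow> var i \<in> carrier (poly_ring m)"
  by (simp add: carrier_poly_ring var_def)

lemma carrier_zero: "0 \<in> carrier (poly_ring m)"
  by (simp add: carrier_poly_ring)

lemma carrier_one: "1 \<in> carrier (poly_ring m)"
  by (simp add: carrier_poly_ring)

lemma carrier_sum: "(\<And>x. x \<in> A \<Longrightarrow> f x \<in> carrier (poly_ring m)) \<Longrightarrow> sum f A \<in> carrier (poly_ring m)"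
  by (induction A rule: infinite_finite_induct) (simp_all add: carrier_zero carrier_add)

lemma carrier_power: "f \<in> carrier (poly_ring m) \<Longrightarrow> f ^ n \<in> carrier (poly_ring m)"
  by (induction n) (simp_all add: carrier_one carrier_mult)

lemma carrier_prod: "(\<And>x. x \<in> A \<Longrightarrow> f x \<in> carrier (poly_ring m)) \<Longrightarrow> prod f A \<in> carrier (poly_ring m)"
  by (induction A rule: infinite_finite_induct) (simp_all add: carrier_one carrier_mult)

lemma cring_poly_ring: "cring (poly_ring m)"
proof (rule cringI)
  show "abelian_group (poly_ring m)"
  proof (rule abelian_groupI)
    fix f assume "f \<in> carrier (poly_ring m)"
    then show "\<exists>g\<in>carrier (poly_ring m). g \<oplus>\<^bsub>poly_ring m\<^esub> f = \<zero>\<^bsub>poly_ring m\<^esub>"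
      by (intro bexI[of _ "- f"]) (simp_all add: carrier_uminus)
  qed (simp_all add: carrier_add carrier_zero add.assoc add.commute)
  show "Group.comm_monoid (poly_ring m)"
    by (rule comm_monoidI) (simp_all add: carrier_mult carrier_one mult.assoc mult.commute)
qed (simp add: distrib_right)

lemma poly_ring_a_inv:
  assumes "f \<in> carrier (poly_ring m)"
  shows "\<ominus>\<^bsub>poly_ring m\<^esub> f = - f"
proof -
  interpret cring "poly_ring m" by (rule cring_poly_ring)
  show ?thesis by (rule minus_equality) (simp_all add: assms carrier_uminus)
qed

lemma poly_ring_idealI:
  assumes sub: "J \<subseteq> carrier (poly_ring m)" and "0 \<in> J" "\<And>f g. f \<in> J \<Longrightarrow> g \<in> J \<Longrightarrow> f + g \<in> J"
    and mult: "\<And>f g. f \<in> J \<Longrightarrow> g \<in> carrier (poly_ring m) \<Longrightarrow> g * f \<in> J"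
  shows "ideal J (poly_ring m)"
proof -
  interpret cring "poly_ring m" by (rule cring_poly_ring)
  have inv: "- f \<in> J" if "f \<in> J" for f
    using mult[OF that carrier_uminus[OF carrier_one]] by simp
  show ?thesis
  proof (rule idealI)
    show "ring (poly_ring m)" by unfold_locales
    show "subgroup J (add_monoid (poly_ring m))"
    proof
      fix f assume f: "f \<in> J"
      then have "inv\<^bsub>add_monoid (poly_ring m)\<^esub> f = - f"
        using poly_ring_a_inv sub unfolding a_inv_def by blast
      then show "inv\<^bsub>add_monoid (poly_ring m)\<^esub> f \<in> J" using inv[OF f] by simp
    qed (use assms in simp_all)
  qed (use mult in \<open>simp_all add: mult.commute\<close>)
qed

text \<open>A finite set of naturals has only one strictly increasing enumeration, so
  \<open>pick I\<close> can be replaced by an explicit one.\<close>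

lemma pick_unique:
  assumes "\<And>i j. i < j \<Longrightarrow> j < n \<Longrightarrow> f i < (f j :: nat)" "f ` {..<n} = I" "i < n"
  shows "pick I i = f i"
proof -
  have inj: "inj_on f {..<n}"
    by (rule inj_onI) (metis assms(1) lessThan_iff linorder_neqE_nat nat_neq_iff)
  then have cI: "card I = n" using assms(2) card_image[OF inj] by simp
  have pin: "pick I i \<in> I" if "i < n" for i using pick_in_set_le[of i I] cI that by simp
  have pm: "pick I i < pick I j" if "i < j" "j < n" for i j using pick_mono_le[of j I i] cI that by simp
  have "inj_on (pick I) {..<n}"
    by (rule inj_onI) (metis pm lessThan_iff linorder_neqE_nat nat_neq_iff)
  then have "card (pick I ` {..<n}) = n" by (simp add: card_image)
  moreover have "finite I" using assms(2) by auto
  ultimately have pI: "pick I ` {..<n} = I" using pin cI by (intro card_subset_eq) auto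
  have s: "sorted_wrt (<) (map h [0..<n])" if "\<And>i j. i < j \<Longrightarrow> j < n \<Longrightarrow> h i < (h j :: nat)" for h
    using that by (simp add: sorted_wrt_iff_nth_less)
  have "map (pick I) [0..<n] = map f [0..<n]"
    by (rule strict_sorted_equal[OF s s]) (use assms(1) pm pI assms(2) in \<open>auto simp: atLeast0LessThan\<close>)
  then show ?thesis using assms(3) by (metis add_0 length_upt map_eq_conv nth_map nth_upt diff_zero)
qed

text \<open>Leading subscripts decrease down the rows of \<open>P_T\<close>, whereas
  \<open>row_minor\<close> lists them increasingly. Reversing the rows costs one sign, the same for
  all minors.\<close>

definition rev_perm :: "nat \<Rightarrow> nat \<Rightarrow> nat" where
  "rev_perm e i = (if i \<le> e then e - i else i)"

lemma rev_perm_permutes: "rev_perm e permutes {0..<Suc e}"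
  by (rule bij_imp_permutes[OF bij_betw_byWitness[of _ "rev_perm e"]]) (auto simp: rev_perm_def)

text \<open>Row \<open>i\<close> of \<open>P_T\<close> has subscript \<open>m - i\<close> in column
  \<open>0\<close>, so a row set \<open>I\<close> corresponds to the sequence
  \<open>m - pick I (e - i)\<close>. The column set is forced, as there are just
  \<open>e + 1\<close> columns.\<close>

lemma minors_P_T:
  assumes "d + e < m"
  shows "minors (Suc e) (P_T d e m) =
    {signof (rev_perm e) * row_minor e k | k. (\<forall>i j. i < j \<longrightarrow> j \<le> e \<longrightarrow> k i < k j) \<and> (\<forall>i\<le>e. d < k i \<and> k i \<le> m)}"
    (is "_ = ?R")
proof -
  have dimP: "dim_row (P_T d e m) = m - d" "dim_col (P_T d e m) = Suc e" by (simp_all add: P_T_def)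
  have det_sub: "det (submatrix (P_T d e m) I {..<Suc e}) = signof (rev_perm e) * row_minor e (\<lambda>i. m - pick I (e - i))"
    if I: "I \<subseteq> {..<m - d}" "card I = Suc e" for I
  proof -
    define A where "A = mat (Suc e) (Suc e) (\<lambda>(i, j). toeplitz_entry (m - pick I (e - i)) j)"
    have A: "A \<in> carrier_mat (Suc e) (Suc e)" by (simp add: A_def)
    have cI: "{i. i < m - d \<and> i \<in> I} = I" "{j. j < Suc e \<and> j \<in> {..<Suc e}} = {..<Suc e}" using I by auto
    have "submatrix (P_T d e m) I {..<Suc e} = mat (Suc e) (Suc e) (\<lambda>(i, j). A $$ (rev_perm e i, j))"
    proof (rule eq_matI)
      fix i j assume ij: "i < dim_row (mat (Suc e) (Suc e) (\<lambda>(i, j). A $$ (rev_perm e i, j)))"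
        "j < dim_col (mat (Suc e) (Suc e) (\<lambda>(i, j). A $$ (rev_perm e i, j)))"
      then have ij: "i < Suc e" "j < Suc e" by simp_all
      have pj: "pick {..<Suc e} j = j" by (rule pick_unique[of "Suc e" "\<lambda>x. x"]) (use ij in auto)
      have pi: "pick I i < m - d" using pick_in_set_le[of i I] I ij by auto
      have "submatrix (P_T d e m) I {..<Suc e} $$ (i, j) = P_T d e m $$ (pick I i, pick {..<Suc e} j)"
        by (rule submatrix_index) (use ij I cI dimP in simp_all)
      also have "\<dots> = toeplitz_entry (m - pick I i) j"
        unfolding pj P_T_def toeplitz_entry_def using pi ij by (auto simp: Let_def nat_diff_distrib of_nat_diff simp flip: of_nat_diff)
      also have "\<dots> = A $$ (rev_perm e i, j)" using ij by (simp add: A_def rev_perm_def)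
      finally show "submatrix (P_T d e m) I {..<Suc e} $$ (i, j) = mat (Suc e) (Suc e) (\<lambda>(i, j). A $$ (rev_perm e i, j)) $$ (i, j)"
        using ij by simp
    qed (use dim_submatrix[of "P_T d e m" I "{..<Suc e}"] cI dimP I in simp_all)
    then show ?thesis using det_permute_rows[OF A rev_perm_permutes] by (simp add: row_minor_def A_def)
  qed
  show ?thesis
  proof (rule equalityI; rule subsetI)
    fix f assume "f \<in> minors (Suc e) (P_T d e m)"
    then obtain I J where IJ: "f = det (submatrix (P_T d e m) I J)" "I \<subseteq> {..<m - d}" "J \<subseteq> {..<Suc e}"
      "card I = Suc e" "card J = Suc e"
      unfolding minors_def dimP by blast
    have "J = {..<Suc e}" using IJ by (intro card_subset_eq) auto
    then have f: "f = signof (rev_perm e) * row_minor e (\<lambda>i. m - pick I (e - i))"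
      using det_sub IJ by simp
    have p: "pick I i < m - d" if "i \<le> e" for i using pick_in_set_le[of i I] IJ that by auto
    have pm: "pick I i < pick I j" if "i < j" "j \<le> e" for i j using pick_mono_le[of j I i] IJ that by simp
    show "f \<in> ?R"
    proof (rule CollectI, rule exI, intro conjI allI impI)
      show "f = signof (rev_perm e) * row_minor e (\<lambda>i. m - pick I (e - i))" by (rule f)
      show "m - pick I (e - i) < m - pick I (e - j)" if "i < j" "j \<le> e" for i j
      proof -
        have "e - j < e - i" "e - i \<le> e" using that by simp_all
        then show ?thesis using p[of "e - i"] pm[of "e - j" "e - i"] by linarith
      qed
      show "d < m - pick I (e - i)" if "i \<le> e" for i using p[of "e - i"] by simp
      show "m - pick I (e - i) \<le> m" for i by simp
    qed
  next
    fix f assume "f \<in> ?R"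
    then obtain k where f: "f = signof (rev_perm e) * row_minor e k" and k: "\<And>i j. i < j \<Longrightarrow> j \<le> e \<Longrightarrow> k i < k j"
      and kr: "\<And>i. i \<le> e \<Longrightarrow> d < k i \<and> k i \<le> m" by blast
    define g where "g i = m - k (e - i)" for i
    define I where "I = g ` {..<Suc e}"
    have gm: "g i < g j" if "i < j" "j < Suc e" for i j
    proof -
      have "e - j < e - i" "e - i \<le> e" using that by simp_all
      then show ?thesis using k[of "e - j" "e - i"] kr[of "e - i"] unfolding g_def by linarith
    qed
    have pg: "pick I i = g i" if "i < Suc e" for i
      by (rule pick_unique[of "Suc e" g]) (use gm that I_def in auto)
    have Isub: "I \<subseteq> {..<m - d}"
    proof -
      have "g i < m - d" if "i < Suc e" for i
        using kr[of "e - i"] that unfolding g_def by (simp, linarith)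
      then show ?thesis by (auto simp: I_def)
    qed
    have "inj_on g {..<Suc e}"
      by (rule inj_onI) (metis gm lessThan_iff linorder_neqE_nat nat_neq_iff)
    then have cI: "card I = Suc e" by (simp add: I_def card_image)
    have "row_minor e (\<lambda>i. m - pick I (e - i)) = row_minor e k"
    proof (rule row_minor_cong)
      fix i assume "i \<le> e"
      then show "m - pick I (e - i) = k i" using kr[of i] by (simp add: pg g_def)
    qed
    then have "f = det (submatrix (P_T d e m) I {..<Suc e})"
      using det_sub[OF Isub cI] f by simp
    then show "f \<in> minors (Suc e) (P_T d e m)"
      unfolding minors_def dimP using Isub cI by (intro CollectI exI[of _ I] exI[of _ "{..<Suc e}"]) simp
  qed
qed

section \<open>Normal forms modulo the ideal\<close>

context pade
begin

section \<open>The determinantal ideal and its spanning set\<close>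

definition I :: "cpoly set" where
  "I = minors_ideal m (Suc e) (P_T d e m)"

lemma diag_minor_carrier:
  assumes "good X"
  shows "diag_minor X \<in> carrier (poly_ring m)"
proof -
  have "diag_minor X - sgl (mon X) 1 \<in> carrier (poly_ring m)"
    using diag_minor_lead[OF assms] unfolding carrier_poly_ring by blast
  moreover have "set_mset X \<subseteq> {..m}" using assms unfolding good_def by fastforce
  then have "sgl (mon X) 1 \<in> carrier (poly_ring m)" by (intro carrier_single) (simp add: supp_mon)
  ultimately have "diag_minor X - sgl (mon X) 1 + sgl (mon X) 1 \<in> carrier (poly_ring m)" by (rule carrier_add)
  then show ?thesis by simp
qed

lemma minors_eq: "minors (Suc e) (P_T d e m) = {signof (rev_perm e) * diag_minor X | X. good X}"
proof (rule equalityI; rule subsetI)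
  fix f assume "f \<in> minors (Suc e) (P_T d e m)"
  then obtain k where f: "f = signof (rev_perm e) * row_minor e k"
    and k: "\<And>i j. i < j \<Longrightarrow> j \<le> e \<Longrightarrow> k i < k j" "\<And>i. i \<le> e \<Longrightarrow> d < k i \<and> k i \<le> m"
    unfolding minors_P_T[OF dem] by blast
  have "good (mset (map (\<lambda>i. k i - i) [0..<Suc e])) \<and> row_minor e k = diag_minor (mset (map (\<lambda>i. k i - i) [0..<Suc e]))"
    by (rule row_minor_eq_diag_minor) (use k in blast)+
  then show "f \<in> {signof (rev_perm e) * diag_minor X | X. good X}"
    unfolding f by (intro CollectI exI[of _ "mset (map (\<lambda>i. k i - i) [0..<Suc e])"]) simp
next
  fix f assume "f \<in> {signof (rev_perm e) * diag_minor X | X. good X}"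
  then obtain X where X: "good X" "f = signof (rev_perm e) * diag_minor X" by blast
  then show "f \<in> minors (Suc e) (P_T d e m)"
    unfolding minors_P_T[OF dem] diag_minor_def using good_rows[OF X(1)]
    by (intro CollectI exI[of _ "rows X"] conjI allI impI) blast+
qed

lemma minors_carrier: "minors (Suc e) (P_T d e m) \<subseteq> carrier (poly_ring m)"
proof -
  have "signof p * diag_minor X \<in> carrier (poly_ring m)" if "good X" for p X
    using diag_minor_carrier[OF that] by (simp add: sign_def carrier_uminus)
  then show ?thesis unfolding minors_eq by blast
qed

lemma ideal_I: "ideal I (poly_ring m)"
proof -
  interpret cring "poly_ring m" by (rule cring_poly_ring)
  show ?thesis unfolding I_def minors_ideal_def by (rule genideal_ideal[OF minors_carrier])
qed

lemma minors_subset_I: "minors (Suc e) (P_T d e m) \<subseteq> I"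
proof -
  interpret cring "poly_ring m" by (rule cring_poly_ring)
  show ?thesis unfolding I_def minors_ideal_def by (rule genideal_self[OF minors_carrier])
qed

lemma I_minimal: "ideal J (poly_ring m) \<Longrightarrow> minors (Suc e) (P_T d e m) \<subseteq> J \<Longrightarrow> I \<subseteq> J"
proof -
  interpret cring "poly_ring m" by (rule cring_poly_ring)
  show "ideal J (poly_ring m) \<Longrightarrow> minors (Suc e) (P_T d e m) \<subseteq> J \<Longrightarrow> I \<subseteq> J"
    unfolding I_def minors_ideal_def by (rule genideal_minimal)
qed

lemma I_carrier: "f \<in> I \<Longrightarrow> f \<in> carrier (poly_ring m)"
  using ideal.Icarr[OF ideal_I] .

lemma I_mult: "f \<in> I \<Longrightarrow> g \<in> carrier (poly_ring m) \<Longrightarrow> g * f \<in> I"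
  using ideal.I_l_closed[OF ideal_I, of f g] by simp

lemma I_add: "f \<in> I \<Longrightarrow> g \<in> I \<Longrightarrow> f + g \<in> I"
  using additive_subgroup.a_closed[OF ideal.axioms(1)[OF ideal_I], of f g] by simp

lemma I_zero: "0 \<in> I"
  using additive_subgroup.zero_closed[OF ideal.axioms(1)[OF ideal_I]] by simp

lemma I_uminus: "f \<in> I \<Longrightarrow> - f \<in> I"
  using I_mult[OF _ carrier_uminus[OF carrier_one], of f] by simp

lemma I_diff: "f \<in> I \<Longrightarrow> g \<in> I \<Longrightarrow> f - g \<in> I"
  using I_add[of f "- g"] I_uminus[of g] by simp

lemma I_sum: "(\<And>x. x \<in> A \<Longrightarrow> f x \<in> I) \<Longrightarrow> sum f A \<in> I"
  by (induction A rule: infinite_finite_induct) (simp_all add: I_zero I_add)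

lemma diag_minor_in_I: "good X \<Longrightarrow> diag_minor X \<in> I"
proof -
  assume "good X"
  then have "signof (rev_perm e) * diag_minor X \<in> I" using minors_subset_I unfolding minors_eq by blast
  then show "diag_minor X \<in> I" using I_uminus[of "- diag_minor X"] by (auto simp: sign_def split: if_splits)
qed

text \<open>Multiplication by \<open>mon R\<close> keeps \<open>X\<close> inside
  \<open>M + R\<close>, so the product is again a multiple of a minor, though perhaps not the one
  chosen by \<open>std_gen\<close>; \<open>minor_term_in_gen_span\<close> absorbs the
  difference.\<close>

lemma single_mult_gen_span:
  assumes "supp r \<subseteq> {..m}" "f \<in> gen_span"
  shows "sgl r c * f \<in> gen_span"
  using assms(2) unfolding gen_span_def
proof (induction rule: cpoly_vs.span_induct_alt)
  case base
  then show ?case by (simp add: cpoly_vs.span_zero)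
next
  case (step c' x y)
  from step(1) obtain M where M: "admissible M" "x = std_gen M" by blast
  obtain R where R: "r = mon R" using mon_surj by blast
  have Rm: "set_mset R \<subseteq> {..m}" using assms(1) by (simp add: R supp_mon)
  obtain X where X: "good X" "X \<subseteq># M" "std_gen M = minor_term M X" using std_gen_obtain[OF M(1)] .
  have MR: "M + R - X = R + (M - X)" using X(2) by (metis add.commute subset_mset.add_diff_assoc2)
  have "sgl r c * x = sgl 0 c * minor_term (M + R) X"
    unfolding minor_term_def MR M X R mon_union by (simp add: mult_single flip: mult.assoc)
  moreover have "minor_term (M + R) X \<in> gen_span"
    by (rule minor_term_in_gen_span) (use X M Rm in \<open>auto simp: admissible_def intro: subset_mset.add_increasing2\<close>)
  then have "sgl 0 c' * (sgl 0 c * minor_term (M + R) X) + sgl r c * y \<in> cpoly_vs.span (std_gen ` {M. admissible M})"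
    unfolding gen_span_def using step(2) by (intro cpoly_vs.span_add cpoly_vs.span_scale)
  ultimately have "sgl 0 c' * (sgl r c * x) + sgl r c * y \<in> cpoly_vs.span (std_gen ` {M. admissible M})"
    by (simp only:)
  then show ?case by (simp add: algebra_simps)
qed

lemma gen_span_carrier: "gen_span \<subseteq> carrier (poly_ring m)"
proof
  fix f assume "f \<in> gen_span"
  then show "f \<in> carrier (poly_ring m)"
    unfolding gen_span_def
  proof (induction rule: cpoly_vs.span_induct_alt)
    case base
    show ?case by (rule carrier_zero)
  next
    case (step c x y)
    from step(1) obtain M where M: "admissible M" "x = std_gen M" by blast
    obtain X where X: "good X" "X \<subseteq># M" "std_gen M = minor_term M X" using std_gen_obtain[OF M(1)] .
    have "set_mset (M - X) \<subseteq> {..m}" using M(1) unfolding admissible_def by (meson in_diffD subset_iff)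
    then have "x \<in> carrier (poly_ring m)" unfolding M X minor_term_def
      by (intro carrier_mult carrier_single diag_minor_carrier) (simp_all add: supp_mon X)
    then show ?case using step(2) by (intro carrier_add carrier_mult carrier_single) simp_all
  qed
qed

lemma I_subset_gen_span: "I \<subseteq> gen_span"
proof (rule I_minimal)
  show "ideal gen_span (poly_ring m)"
  proof (rule poly_ring_idealI[OF gen_span_carrier])
    show "0 \<in> gen_span" unfolding gen_span_def by (rule cpoly_vs.span_zero)
    show "f + g \<in> gen_span" if "f \<in> gen_span" "g \<in> gen_span" for f g
      using that unfolding gen_span_def by (rule cpoly_vs.span_add)
    show "g * f \<in> gen_span" if f: "f \<in> gen_span" and g: "g \<in> carrier (poly_ring m)" for f g
    proof -
      have "g * f = (\<Sum>a\<in>supp g. sgl a (coef g a) * f)"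
        by (subst poly_mapping_sum_single[of g]) (simp add: sum_distrib_right)
      also have "\<dots> \<in> gen_span" unfolding gen_span_def
      proof (rule cpoly_vs.span_sum)
        fix a assume "a \<in> supp g"
        then have "supp a \<subseteq> {..m}" using g unfolding carrier_poly_ring by blast
        from single_mult_gen_span[OF this f]
        show "sgl a (coef g a) * f \<in> cpoly_vs.span (std_gen ` {M. admissible M})" unfolding gen_span_def .
      qed
      finally show ?thesis .
    qed
  qed
  show "minors (Suc e) (P_T d e m) \<subseteq> gen_span"
  proof -
    have "signof p * diag_minor X \<in> gen_span" if "good X" for p X
    proof -
      have "set_mset X \<subseteq> {..m}" using that unfolding good_def by fastforce
      then have "minor_term X X \<in> gen_span" by (intro minor_term_in_gen_span[OF that]) simp_all
      then show ?thesis by (auto simp: minor_term_def sign_def gen_span_def intro: cpoly_vs.span_neg)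
    qed
    then show ?thesis unfolding minors_eq by blast
  qed
qed

text \<open>Every nonzero element of \<open>I\<close> has a monomial that contains a diagonal. This
  is uniqueness of normal forms: monomials with \<open>Ydeg\<close> at most \<open>e\<close> are
  independent modulo \<open>I\<close>.\<close>

lemma I_reduced_zero:
  assumes "f \<in> I" "\<And>a. a \<in> supp f \<Longrightarrow> Ydeg a \<le> e"
  shows "f = 0"
proof (rule ccontr)
  assume "f \<noteq> 0"
  then obtain a where "a \<in> supp f" "e < Ydeg a"
    using gen_span_nonzero[of f] assms(1) I_subset_gen_span by blast
  then show False using assms(2)[of a] by simp
qed

text \<open>The filtration in which \<open>Delta\<close> starts with the \<open>e\<close>-th power
  of \<open>c_d\<close>. Diagonals contain none of the variables counted here, so reduction cannot
  lower this degree.\<close>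

definition Vdeg :: "monomial \<Rightarrow> nat" where
  "Vdeg = wt (\<lambda>i. if i < d then 1 else 0)"

text \<open>Besides being reduced, these monomials record two invariants of the reduction of
  \<open>a\<close>: the degree is preserved, for the dimension count, and \<open>Vdeg\<close> does
  not fall, for the regularity of \<open>Delta\<close>.\<close>

definition reduced_over :: "monomial \<Rightarrow> monomial set" where
  "reduced_over a = {b. supp b \<subseteq> {..m} \<and> Ydeg b \<le> e \<and> deg b = deg a \<and> Vdeg a \<le> Vdeg b}"

lemma normal_form_sum:
  assumes "\<And>b. b \<in> supp f \<Longrightarrow> \<exists>g. sgl b 1 - g \<in> I \<and> supp g \<subseteq> B"
  shows "\<exists>g. f - g \<in> I \<and> supp g \<subseteq> B"
proof -
  from assms obtain G where G: "\<And>b. b \<in> supp f \<Longrightarrow> sgl b 1 - G b \<in> I \<and> supp (G b) \<subseteq> B" by metis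
  define g where "g = (\<Sum>b\<in>supp f. sgl 0 (coef f b) * G b)"
  have "f - g = (\<Sum>b\<in>supp f. sgl 0 (coef f b) * (sgl b 1 - G b))"
    unfolding g_def by (subst (1) poly_mapping_sum_single[of f])
      (simp add: right_diff_distrib mult_single sum_subtractf)
  also have "\<dots> \<in> I" by (rule I_sum, rule I_mult) (use G in \<open>auto intro: carrier_single\<close>)
  finally have "f - g \<in> I" .
  moreover have "supp g \<subseteq> B"
  proof
    fix a assume "a \<in> supp g"
    then obtain b where b: "b \<in> supp f" "a \<in> supp (sgl 0 (coef f b) * G b)"
      using supp_sum[of "\<lambda>b. sgl 0 (coef f b) * G b" "supp f"] unfolding g_def by blast
    then have "a \<in> supp (G b)" by (simp add: in_keys_iff coef_scale)
    then show "a \<in> B" using G[OF b(1)] by blast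
  qed
  ultimately show ?thesis by blast
qed

text \<open>Split off a diagonal \<open>X\<close> dividing \<open>a\<close> and replace it by the
  other terms of its minor. They have the same degree and larger weight, and they can only gain in
  \<open>Vdeg\<close>, since \<open>Vdeg (mon X) = 0\<close>; boundedness of the weight ends the
  process.\<close>

lemma normal_form_monomial:
  assumes "supp a \<subseteq> {..m}"
  shows "\<exists>g. sgl a 1 - g \<in> I \<and> supp g \<subseteq> reduced_over a"
  using assms
proof (induction "deg a * m\<^sup>2 - W a" arbitrary: a rule: less_induct)
  case less
  show ?case
  proof (cases "Ydeg a \<le> e")
    case True
    then show ?thesis using less.prems by (intro exI[of _ "sgl a 1"]) (simp add: I_zero reduced_over_def)
  next
    case False
    obtain M where M: "a = mon M" using mon_surj by blast
    have Mm: "set_mset M \<subseteq> {..m}" using less.prems by (simp add: M supp_mon)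
    then have "admissible M" using False by (simp add: admissible_iff M)
    then obtain X where X: "good X" "X \<subseteq># M" unfolding admissible_def by blast
    define r where "r = mon (M - X)"
    have a: "a = r + mon X" unfolding M r_def using X(2) by (simp flip: mon_union)
    have rm: "supp r \<subseteq> {..m}" using less.prems a by (simp add: supp_add_monomial)
    define h where "h = sgl r 1 * (diag_minor X - sgl (mon X) 1)"
    have "Vdeg (mon X) = 0"
    proof -
      have "x \<notin> {..<d}" if "x \<in># X" for x
      proof -
        have "x \<in> {Suc d..m - e}" using X(1) that unfolding good_def by blast
        then show ?thesis by simp
      qed
      then show ?thesis unfolding Vdeg_def wt_mon by (simp add: sum_mset_0_iff)
    qed
    then have Va: "Vdeg a = Vdeg r" by (simp add: a Vdeg_def wt_add)
    have h: "supp b \<subseteq> {..m} \<and> deg b = deg a \<and> W a < W b \<and> Vdeg a \<le> Vdeg b" if b: "b \<in> supp h" for b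
    proof -
      obtain c where c: "c \<in> supp (diag_minor X - sgl (mon X) 1)" "b = r + c"
        using b supp_single_mult[of r 1 "diag_minor X - sgl (mon X) 1"] unfolding h_def by blast
      then have "supp c \<subseteq> {..m} \<and> deg c = Suc e \<and> W (mon X) < W c" using diag_minor_lead[OF X(1)] by blast
      moreover have "deg (mon X) = Suc e" using X(1) by (simp add: deg_mon good_def)
      ultimately show ?thesis using rm Va
        by (simp add: c(2) a supp_add_monomial deg_add wt_add Vdeg_def)
    qed
    have Wle: "W b \<le> deg b * m\<^sup>2" if "supp b \<subseteq> {..m}" for b
    proof -
      obtain N where N: "b = mon N" using mon_surj by blast
      show ?thesis unfolding N deg_mon by (rule W_le) (use that N supp_mon in auto)
    qed
    have "\<exists>g. - h - g \<in> I \<and> supp g \<subseteq> reduced_over a"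
    proof (rule normal_form_sum)
      fix b assume "b \<in> supp (- h)"
      then have b: "b \<in> supp h" by (simp add: supp_uminus)
      have "deg b * m\<^sup>2 - W b < deg a * m\<^sup>2 - W a" using h[OF b] Wle[of b] by auto
      then obtain g where "sgl b 1 - g \<in> I" "supp g \<subseteq> reduced_over b"
        using less.hyps h[OF b] by blast
      moreover have "reduced_over b \<subseteq> reduced_over a" using h[OF b] unfolding reduced_over_def by auto
      ultimately show "\<exists>g. sgl b 1 - g \<in> I \<and> supp g \<subseteq> reduced_over a" by blast
    qed
    then obtain g where g: "- h - g \<in> I" "supp g \<subseteq> reduced_over a" by blast
    have "sgl r 1 * diag_minor X + (- h - g) \<in> I"
      by (rule I_add[OF I_mult[OF diag_minor_in_I[OF X(1)] carrier_single[OF rm]] g(1)])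
    moreover have "sgl r 1 * diag_minor X + (- h - g) = sgl a 1 - g"
      unfolding h_def by (simp add: right_diff_distrib mult_single a)
    ultimately show ?thesis using g(2) by auto
  qed
qed

lemma normal_form:
  assumes "f \<in> carrier (poly_ring m)"
  shows "\<exists>g. f - g \<in> I \<and> supp g \<subseteq> (\<Union>a\<in>supp f. reduced_over a)"
proof (rule normal_form_sum)
  fix b assume b: "b \<in> supp f"
  then have "supp b \<subseteq> {..m}" using assms unfolding carrier_poly_ring by blast
  then show "\<exists>g. sgl b 1 - g \<in> I \<and> supp g \<subseteq> (\<Union>a\<in>supp f. reduced_over a)"
    using normal_form_monomial[of b] b by blast
qed

end

section \<open>A regular localizing element\<close>

lemma supp_power_single: "sgl (a :: monomial) (1::complex) ^ n = sgl (of_nat n * a) 1"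
  by (induction n) (simp_all add: mult_single algebra_simps)

lemma carrier_mono: "k \<le> m \<Longrightarrow> carrier (poly_ring k) \<subseteq> carrier (poly_ring m)"
  unfolding carrier_poly_ring subset_iff by (meson atMost_iff order_trans subset_iff)

lemma carrier_det:
  assumes "A \<in> carrier_mat n n" "\<And>i j. i < n \<Longrightarrow> j < n \<Longrightarrow> A $$ (i, j) \<in> carrier (poly_ring m)"
  shows "det A \<in> carrier (poly_ring m)"
proof -
  have "signof p * (\<Prod>i = 0..<n. A $$ (i, p i)) \<in> carrier (poly_ring m)" if p: "p permutes {0..<n}" for p
  proof -
    have "(\<Prod>i = 0..<n. A $$ (i, p i)) \<in> carrier (poly_ring m)"
    proof (rule carrier_prod)
      fix i assume i: "i \<in> {0..<n}"
      then have "p i \<in> {0..<n}" using p by (simp only: permutes_in_image)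
      then show "A $$ (i, p i) \<in> carrier (poly_ring m)" using assms(2) i by simp
    qed
    then show ?thesis by (simp add: sign_def carrier_uminus)
  qed
  then show ?thesis unfolding det_def'[OF assms(1)] by (intro carrier_sum) simp
qed

lemma toeplitz_entry_carrier: "k \<le> m \<Longrightarrow> toeplitz_entry k j \<in> carrier (poly_ring m)"
  unfolding toeplitz_entry_def by (simp add: carrier_var carrier_zero)

lemma poly_ring_generated:
  assumes const: "\<And>c. sgl 0 c \<in> G" and vars: "\<And>i. i \<le> k \<Longrightarrow> var i \<in> G"
    and add: "\<And>f g. f \<in> G \<Longrightarrow> g \<in> G \<Longrightarrow> f + g \<in> G" and mult: "\<And>f g. f \<in> G \<Longrightarrow> g \<in> G \<Longrightarrow> f * g \<in> G"
  shows "carrier (poly_ring k) \<subseteq> G"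
proof
  fix f assume f: "f \<in> carrier (poly_ring k)"
  have mon: "sgl (mon X) 1 \<in> G" if "set_mset X \<subseteq> {..k}" for X
    using that
  proof (induction X)
    case empty
    then show ?case using const[of 1] by simp
  next
    case (add x X)
    have "var x * sgl (mon X) 1 \<in> G" using add by (intro mult vars) simp_all
    then show ?case by (simp add: var_def mult_single)
  qed
  have t: "sgl a (coef f a) \<in> G" if "a \<in> supp f" for a
  proof -
    obtain X where X: "a = mon X" using mon_surj by blast
    have "supp a \<subseteq> {..k}" using f that unfolding carrier_poly_ring by blast
    then have "set_mset X \<subseteq> {..k}" by (simp add: X supp_mon)
    then have "sgl 0 (coef f a) * sgl a 1 \<in> G" using mon X by (intro mult const) simp
    then show ?thesis by (simp add: mult_single)
  qed
  have "(\<Sum>a\<in>A. sgl a (coef f a)) \<in> G" if "A \<subseteq> supp f" for A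
  proof (use finite_subset[OF that finite_keys] that in \<open>induction A rule: finite_induct\<close>)
    case empty
    then show ?case using const[of 0] by simp
  next
    case (insert a A)
    have "sgl a (coef f a) + (\<Sum>a\<in>A. sgl a (coef f a)) \<in> G" using insert by (intro add t) simp_all
    then show ?case using insert.hyps by simp
  qed
  then have "(\<Sum>a\<in>supp f. sgl a (coef f a)) \<in> G" by simp
  then show "f \<in> G" unfolding poly_mapping_sum_single[symmetric] .
qed

text \<open>Up to row order, the minor of \<open>P_T\<close> on the rows with subscripts
  \<open>d + 1, ..., d + e\<close> and all columns but the first. It is the determinant of the
  system for a kernel vector with first entry \<open>1\<close>; for \<open>e = 0\<close> it is
  \<open>1\<close>.\<close>

definition Delta :: "nat \<Rightarrow> nat \<Rightarrow> cpoly" where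
  "Delta d e = det (mat e e (\<lambda>(a, b). toeplitz_entry (d + a) b))"

lemma Delta_carrier: "Delta d e \<in> carrier (poly_ring (d + e))"
  unfolding Delta_def by (rule carrier_det[of _ e]) (auto intro: toeplitz_entry_carrier)

context pade
begin

lemma Delta_carrier': "Delta d e \<in> carrier (poly_ring m)"
  using Delta_carrier carrier_mono[of "d + e" m] dem by fastforce

text \<open>Modulo \<open>c\<^sub>0, \<dots>, c\<^bsub>d-1\<^esub>\<close> the matrix is upper triangular with diagonal entries \<open>c\<^sub>d\<close>.\<close>

lemma Delta_lead:
  "supp (Delta d e - sgl (of_nat e * sgl d 1) 1) \<subseteq> {a. supp a \<subseteq> {..m} \<and> 0 < Vdeg a}"
proof -
  define A where "A = mat e e (\<lambda>(a, b). toeplitz_entry (d + a) b)"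
  have A: "A \<in> carrier_mat e e" by (simp add: A_def)
  define U where "U p = signof p * (\<Prod>i = 0..<e. A $$ (i, p i))" for p
  have fin: "finite {p. p permutes {0..<e}}" by (simp add: finite_permutations)
  have Ap: "(\<Prod>i = 0..<e. A $$ (i, p i)) = (\<Prod>i = 0..<e. toeplitz_entry (d + i) (p i))" if "p permutes {0..<e}" for p
  proof (rule prod.cong)
    fix i assume i: "i \<in> {0..<e}"
    then have "p i \<in> {0..<e}" using that by (simp only: permutes_in_image)
    then show "A $$ (i, p i) = toeplitz_entry (d + i) (p i)" using i by (simp add: A_def)
  qed simp
  have "U id = (\<Prod>i = 0..<e. toeplitz_entry (d + i) i)" unfolding U_def Ap[OF permutes_id] by (simp add: sign_id)
  also have "\<dots> = sgl (of_nat e * sgl d 1) 1" by (simp add: toeplitz_entry_def var_def supp_power_single)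
  finally have Uid: "U id = sgl (of_nat e * sgl d 1) 1" .
  have "Delta d e - U id = (\<Sum>p\<in>{p. p permutes {0..<e}} - {id}. U p)"
    unfolding Delta_def A_def[symmetric] det_def'[OF A] U_def[symmetric]
    by (subst sum.remove[OF fin, of id]) (auto simp: permutes_id)
  also have "supp \<dots> \<subseteq> (\<Union>p\<in>{p. p permutes {0..<e}} - {id}. supp (U p))" by (rule supp_sum)
  also have "\<dots> \<subseteq> {a. supp a \<subseteq> {..m} \<and> 0 < Vdeg a}"
  proof (rule UN_least)
    fix p assume "p \<in> {p. p permutes {0..<e}} - {id}"
    then have p: "p permutes {0..<e}" and pid: "p \<noteq> id" by auto
    have pr: "(\<Prod>i = 0..<e. A $$ (i, p i)) =
        (if \<forall>i\<in>{0..<e}. p i \<le> d + i then sgl (\<Sum>i = 0..<e. sgl (d + i - p i) 1) 1 else 0)"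
      unfolding Ap[OF p] by (rule prod_toeplitz_entry) simp
    show "supp (U p) \<subseteq> {a. supp a \<subseteq> {..m} \<and> 0 < Vdeg a}"
    proof (cases "\<forall>i\<in>{0..<e}. p i \<le> d + i")
      case False
      then show ?thesis unfolding U_def pr if_not_P[OF False] by simp
    next
      case True
      define y :: monomial where "y = (\<Sum>i = 0..<e. sgl (d + i - p i) 1)"
      have "supp (U p) \<subseteq> {y}" unfolding U_def pr if_P[OF True] y_def[symmetric] by (simp add: sign_def supp_uminus)
      moreover have "supp y \<subseteq> {..m}" using dem unfolding y_def by (subst supp_sum_monomial) auto
      moreover have "0 < Vdeg y"
      proof -
        \<comment> \<open>A permutation with \<open>p i \<le> i\<close> everywhere is the identity,
          so some factor \<open>c_(d + i - p i)\<close> has subscript below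
          \<open>d\<close>.\<close>
        have "\<exists>i\<in>{0..<e}. i < p i"
        proof (rule ccontr)
          assume "\<not> (\<exists>i\<in>{0..<e}. i < p i)"
          then have "p i \<le> i" for i using permutes_not_in[OF p, of i] by (cases "i \<in> {0..<e}") (auto simp: not_less)
          then show False using permutes_natset_le[OF p] pid by blast
        qed
        then obtain i where i: "i \<in> {0..<e}" "i < p i" by blast
        then have "d + i - p i < d" using True by force
        then have "0 < Vdeg (sgl (d + i - p i) 1)" by (simp add: Vdeg_def)
        also have "\<dots> \<le> Vdeg y" unfolding y_def Vdeg_def wt_sum by (rule member_le_sum) (use i in auto)
        finally show ?thesis .
      qed
      ultimately show ?thesis by blast
    qed
  qed
  finally show ?thesis unfolding Uid .
qed

text \<open>Compare the components of least degree in \<open>c\<^sub>0, \<dots>, c\<^bsub>d-1\<^esub>\<close> of a normal form \<open>f\<close> and of \<open>Delta d e * f\<close>.\<close>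

lemma Delta_regular:
  assumes f: "f \<in> carrier (poly_ring m)" and Df: "Delta d e * f \<in> I"
  shows "f \<in> I"
proof -
  obtain g where g: "f - g \<in> I" "supp g \<subseteq> (\<Union>a\<in>supp f. reduced_over a)" using normal_form[OF f] by blast
  have g_red: "Ydeg b \<le> e \<and> supp b \<subseteq> {..m}" if "b \<in> supp g" for b
    using g(2) that unfolding reduced_over_def by blast
  have gc: "g \<in> carrier (poly_ring m)" using g_red unfolding carrier_poly_ring by blast
  have "Delta d e * f - Delta d e * (f - g) \<in> I" by (rule I_diff[OF Df I_mult[OF g(1) Delta_carrier']])
  then have Dg: "Delta d e * g \<in> I" by (simp add: right_diff_distrib)
  have "g = 0"
  proof (rule ccontr)
    assume "g \<noteq> 0"
    then obtain b1 where "b1 \<in> supp g" by (metis all_not_in_conv keys_eq_empty poly_mapping_eqI lookup_zero in_keys_iff)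
    from ex_has_least_nat[of "\<lambda>b. b \<in> supp g", OF this, of Vdeg]
    obtain b0 where b0: "b0 \<in> supp g" "\<And>b. b \<in> supp g \<Longrightarrow> Vdeg b0 \<le> Vdeg b" by blast
    define x :: monomial where "x = of_nat e * sgl d 1"
    have x: "x = mon (replicate_mset e d)"
      unfolding x_def by (induction e) (simp_all add: algebra_simps)
    \<comment> \<open>\<open>d\<close> lies outside both index ranges counted by \<open>Vdeg\<close>
      and \<open>Ydeg\<close>, so multiplication by \<open>x\<close> keeps \<open>g\<close> reduced
      and does not move it in the filtration.\<close>
    have x0: "Vdeg x = 0" "Ydeg x = 0" "supp x \<subseteq> {..m}"
      unfolding x Vdeg_def Ydeg_def wt_mon supp_mon using dem by (auto simp: image_replicate_mset)
    define h where "h = (Delta d e - sgl x 1) * g"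
    have hV: "Vdeg b0 < Vdeg b \<and> supp b \<subseteq> {..m}" if "b \<in> supp h" for b
    proof -
      obtain u v where uv: "b = u + v" "u \<in> supp (Delta d e - sgl x 1)" "v \<in> supp g"
        using keys_mult[of "Delta d e - sgl x 1" g] \<open>b \<in> supp h\<close> unfolding h_def by blast
      have "supp u \<subseteq> {..m} \<and> 0 < Vdeg u" using uv(2) Delta_lead unfolding x_def by blast
      then show ?thesis using b0(2)[OF uv(3)] g_red[OF uv(3)]
        by (auto simp: uv(1) Vdeg_def wt_add supp_add_monomial)
    qed
    then have hc: "h \<in> carrier (poly_ring m)" unfolding carrier_poly_ring by blast
    obtain k where k: "h - k \<in> I" "supp k \<subseteq> (\<Union>a\<in>supp h. reduced_over a)" using normal_form[OF hc] by blast
    have kV: "Vdeg b0 < Vdeg b \<and> Ydeg b \<le> e" if b: "b \<in> supp k" for b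
    proof -
      obtain a where "a \<in> supp h" "b \<in> reduced_over a" using k(2) b by blast
      then show ?thesis using hV[of a] unfolding reduced_over_def by auto
    qed
    have "Delta d e * g - (h - k) \<in> I" by (rule I_diff[OF Dg k(1)])
    moreover have "Delta d e * g - (h - k) = sgl x 1 * g + k" by (simp add: h_def algebra_simps)
    ultimately have sk: "sgl x 1 * g + k \<in> I" by simp
    \<comment> \<open>Both summands are reduced, so uniqueness of normal forms makes the sum vanish.
      At the monomial \<open>x + b0\<close> only the first contributes, because all of
      \<open>k\<close> has larger \<open>Vdeg\<close>.\<close>
    have "sgl x 1 * g + k = 0"
    proof (rule I_reduced_zero[OF sk])
      fix a assume "a \<in> supp (sgl x 1 * g + k)"
      then have "a \<in> supp (sgl x 1 * g) \<union> supp k" by (rule rev_subsetD[OF _ keys_add])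
      then show "Ydeg a \<le> e"
      proof
        assume "a \<in> supp (sgl x 1 * g)"
        then obtain b where "b \<in> supp g" "a = x + b" using supp_single_mult[of x 1 g] by blast
        then show ?thesis using g_red[of b] x0(2) by (simp add: Ydeg_def wt_add)
      qed (use kV in blast)
    qed
    moreover have "coef (sgl x 1 * g) (x + b0) = coef g b0"
    proof -
      have "coef (sgl x 1 * g) (x + b0) = (\<Sum>b\<in>supp g. coef (sgl (x + b) (coef g b)) (x + b0))"
        by (subst poly_mapping_sum_single[of g]) (simp add: sum_distrib_left mult_single lookup_sum)
      also have "\<dots> = (\<Sum>b\<in>supp g. if b = b0 then coef g b else 0)" by (simp add: coef_single)
      finally show ?thesis using b0(1) by simp
    qed
    moreover have "x + b0 \<notin> supp k"
    proof
      assume "x + b0 \<in> supp k"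
      then have "Vdeg b0 < Vdeg (x + b0)" using kV by blast
      then show False using x0(1) by (simp add: Vdeg_def wt_add)
    qed
    ultimately have "coef g b0 = 0" by (metis add.right_neutral in_keys_iff lookup_add lookup_zero)
    then show False using b0(1) by (simp add: in_keys_iff)
  qed
  then show ?thesis using g(1) by simp
qed

lemma Delta_power_regular:
  assumes f: "f \<in> carrier (poly_ring m)"
  shows "Delta d e ^ n * f \<in> I \<Longrightarrow> f \<in> I"
proof (induction n)
  case (Suc n)
  have "Delta d e * (Delta d e ^ n * f) \<in> I" using Suc.prems by (simp add: mult.assoc)
  then have "Delta d e ^ n * f \<in> I"
    by (rule Delta_regular[rotated]) (rule carrier_mult[OF carrier_power[OF Delta_carrier'] f])
  then show ?case by (rule Suc.IH)
qed simp

text \<open>In the minor with row subscripts \<open>d + 1, ..., d + e, k\<close> the variable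
  \<open>c_k\<close> occurs only as first entry of the last row, with cofactor \<open>Delta\<close>
  up to sign; all other entries have smaller subscripts. So the minor is a linear equation for
  \<open>c_k\<close>.\<close>

lemma var_elimination:
  assumes k: "d + e < k" "k \<le> m"
  shows "\<exists>g\<in>carrier (poly_ring (k - 1)). Delta d e * var k - g \<in> I"
proof -
  define l where "l i = (if i < e then Suc (d + i) else k)" for i
  have "good (mset (map (\<lambda>i. l i - i) [0..<Suc e])) \<and> row_minor e l = diag_minor (mset (map (\<lambda>i. l i - i) [0..<Suc e]))"
    by (rule row_minor_eq_diag_minor) (use k dem in \<open>auto simp: l_def\<close>)
  then have DI: "row_minor e l \<in> I" using diag_minor_in_I by simp
  define A where "A = mat (Suc e) (Suc e) (\<lambda>(i, j). toeplitz_entry (l i) j)"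
  have A: "A \<in> carrier_mat (Suc e) (Suc e)" by (simp add: A_def)
  have md: "mat_delete A e j = mat e e (\<lambda>(i, j'). toeplitz_entry (Suc (d + i)) (insert_index j j'))" if "j \<le> e" for j
    using that by (intro eq_matI) (auto simp: mat_delete_def A_def l_def insert_index_def)
  have cof: "cofactor A e j \<in> carrier (poly_ring (k - 1))" if "j \<le> e" for j
  proof -
    have "det (mat_delete A e j) \<in> carrier (poly_ring (k - 1))"
      unfolding md[OF that] by (rule carrier_det[of _ e]) (use k in \<open>auto intro!: toeplitz_entry_carrier\<close>)
    then show ?thesis unfolding cofactor_def
      by (intro carrier_mult carrier_power carrier_uminus carrier_one)
  qed
  \<comment> \<open>Deleting column \<open>0\<close> lowers the leading subscripts by one, so rows
    starting at \<open>d + 1\<close> become the rows of \<open>Delta\<close> starting at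
    \<open>d\<close>.\<close>
  have "mat_delete A e 0 = mat e e (\<lambda>(a, b). toeplitz_entry (d + a) b)"
    by (subst md) (auto intro!: cong_mat simp: toeplitz_entry_def insert_index_def)
  then have c0: "cofactor A e 0 = (-1) ^ e * Delta d e" by (simp add: cofactor_def Delta_def)
  have "row_minor e l = (\<Sum>j<Suc e. A $$ (e, j) * cofactor A e j)"
    unfolding row_minor_def A_def[symmetric] by (rule laplace_expansion_row[OF A]) simp
  also have "\<dots> = A $$ (e, 0) * cofactor A e 0 + (\<Sum>j<e. A $$ (e, Suc j) * cofactor A e (Suc j))"
    by (rule sum.lessThan_Suc_shift)
  also have "A $$ (e, 0) = var k" by (simp add: A_def l_def toeplitz_entry_def)
  finally have D: "row_minor e l = var k * ((-1) ^ e * Delta d e) + (\<Sum>j<e. A $$ (e, Suc j) * cofactor A e (Suc j))"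
    unfolding c0 .
  define g where "g = - ((-1) ^ e * (\<Sum>j<e. A $$ (e, Suc j) * cofactor A e (Suc j)))"
  have "A $$ (e, Suc j) \<in> carrier (poly_ring (k - 1))" if "j < e" for j
    using that k by (simp add: A_def l_def toeplitz_entry_def carrier_var carrier_zero)
  then have "g \<in> carrier (poly_ring (k - 1))"
    unfolding g_def using cof
    by (intro carrier_uminus carrier_mult carrier_power carrier_one carrier_sum) auto
  moreover have "Delta d e * var k - g = (-1) ^ e * row_minor e l"
    unfolding D g_def by (simp add: algebra_simps flip: power_add mult_2)
  then have "Delta d e * var k - g \<in> I"
    using I_mult[OF DI carrier_power[OF carrier_uminus[OF carrier_one]]] by simp
  ultimately show ?thesis by blast
qed

text \<open>The polynomials for which some power of \<open>Delta\<close> suffices are closed under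
  sums and products, as the exponents may be added. The variables belong to them by induction on the
  subscript, since each elimination leads to lower variables.\<close>

lemma Delta_clear_denominators:
  assumes "f \<in> carrier (poly_ring m)"
  shows "\<exists>n. \<exists>g\<in>carrier (poly_ring (d + e)). Delta d e ^ n * f - g \<in> I"
proof -
  define G where "G = {f \<in> carrier (poly_ring m). \<exists>n. \<exists>g\<in>carrier (poly_ring (d + e)). Delta d e ^ n * f - g \<in> I}"
  have sub: "carrier (poly_ring (d + e)) \<subseteq> carrier (poly_ring m)" using dem by (intro carrier_mono) simp
  have base: "f \<in> G" if "f \<in> carrier (poly_ring (d + e))" for f
    unfolding G_def using that sub by (intro CollectI conjI exI[of _ 0] bexI[of _ f]) (auto simp: I_zero)
  have mult: "f * f' \<in> G" if ff: "f \<in> G" "f' \<in> G" for f f'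
  proof -
    obtain n g n' g' where g: "g \<in> carrier (poly_ring (d + e))" "Delta d e ^ n * f - g \<in> I"
      and g': "g' \<in> carrier (poly_ring (d + e))" "Delta d e ^ n' * f' - g' \<in> I"
      and c: "f \<in> carrier (poly_ring m)" "f' \<in> carrier (poly_ring m)"
      using ff unfolding G_def by blast
    have "Delta d e ^ (n + n') * (f * f') - g * g' =
        (Delta d e ^ n' * f') * (Delta d e ^ n * f - g) + g * (Delta d e ^ n' * f' - g')"
      by (simp add: algebra_simps power_add)
    also have "\<dots> \<in> I"
      by (intro I_add I_mult g g' carrier_mult carrier_power Delta_carrier' c subsetD[OF sub])
    finally show ?thesis unfolding G_def using carrier_mult[OF g(1) g'(1)] carrier_mult[OF c] by blast
  qed
  have add: "f + f' \<in> G" if ff: "f \<in> G" "f' \<in> G" for f f'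
  proof -
    obtain n g n' g' where g: "g \<in> carrier (poly_ring (d + e))" "Delta d e ^ n * f - g \<in> I"
      and g': "g' \<in> carrier (poly_ring (d + e))" "Delta d e ^ n' * f' - g' \<in> I"
      and c: "f \<in> carrier (poly_ring m)" "f' \<in> carrier (poly_ring m)"
      using ff unfolding G_def by blast
    have "Delta d e ^ (n + n') * (f + f') - (Delta d e ^ n' * g + Delta d e ^ n * g') =
        Delta d e ^ n' * (Delta d e ^ n * f - g) + Delta d e ^ n * (Delta d e ^ n' * f' - g')"
      by (simp add: algebra_simps power_add)
    also have "\<dots> \<in> I" by (intro I_add I_mult g g' carrier_power Delta_carrier')
    finally have "Delta d e ^ (n + n') * (f + f') - (Delta d e ^ n' * g + Delta d e ^ n * g') \<in> I" .
    moreover have "Delta d e ^ n' * g + Delta d e ^ n * g' \<in> carrier (poly_ring (d + e))"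
      by (intro carrier_add carrier_mult carrier_power Delta_carrier g(1) g'(1))
    ultimately show ?thesis unfolding G_def using carrier_add[OF c] by blast
  qed
  have "carrier (poly_ring k) \<subseteq> G" if "k \<le> m" for k
    using that
  proof (induction k rule: less_induct)
    case (less k)
    show ?case
    proof (rule poly_ring_generated[OF _ _ add mult])
      show "sgl 0 c \<in> G" for c by (rule base) (simp add: carrier_single)
      fix i assume i: "i \<le> k"
      show "var i \<in> G"
      proof (cases "i \<le> d + e")
        case True
        then show ?thesis by (intro base carrier_var)
      next
        case False
        then obtain g where g: "g \<in> carrier (poly_ring (i - 1))" "Delta d e * var i - g \<in> I"
          using var_elimination[of i] i less.prems by auto
        have "g \<in> G" 
        proof -
          have "i - 1 < k" "i - 1 \<le> m" using False i less.prems by simp_all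
          then show ?thesis using less.IH[of "i - 1"] g(1) by blast
        qed
        then obtain n h where h: "h \<in> carrier (poly_ring (d + e))" "Delta d e ^ n * g - h \<in> I"
          unfolding G_def by blast
        have "Delta d e ^ Suc n * var i - h = Delta d e ^ n * (Delta d e * var i - g) + (Delta d e ^ n * g - h)"
          by (simp add: algebra_simps)
        also have "\<dots> \<in> I" by (intro I_add I_mult g h carrier_power Delta_carrier')
        finally have "Delta d e ^ Suc n * var i - h \<in> I" .
        moreover have "var i \<in> carrier (poly_ring m)" using i less.prems by (intro carrier_var) simp
        ultimately show ?thesis unfolding G_def using h(1) by blast
      qed
    qed
  qed
  then show ?thesis using assms unfolding G_def by blast
qed

end

section \<open>Zeros of the ideal and primality\<close>

lemma poly_eval_cong:
  assumes "f \<in> carrier (poly_ring k)" "\<And>i. i \<le> k \<Longrightarrow> v $ i = w $ i"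
  shows "poly_eval f v = poly_eval f w"
  unfolding poly_eval_def
proof (rule sum.cong)
  fix a assume "a \<in> supp f"
  then have "supp a \<subseteq> {..k}" using assms(1) unfolding carrier_poly_ring by blast
  then have "(\<Prod>i\<in>supp a. (v $ i) ^ coef a i) = (\<Prod>i\<in>supp a. (w $ i) ^ coef a i)"
    by (intro prod.cong) (use assms(2) in auto)
  then show "coef f a * (\<Prod>i\<in>supp a. (v $ i) ^ coef a i) = coef f a * (\<Prod>i\<in>supp a. (w $ i) ^ coef a i)"
    by simp
qed simp

lemma poly_eval_toeplitz_entry: "poly_eval (toeplitz_entry k j) w = (if j \<le> k then w $ (k - j) else 0)"
  by (simp add: toeplitz_entry_def)

lemma poly_eval_row_minor:
  "poly_eval (row_minor e k) w = det (mat (Suc e) (Suc e) (\<lambda>(i, j). if j \<le> k i then w $ (k i - j) else 0))"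
  unfolding row_minor_def poly_eval_det by (rule arg_cong[of _ _ det], rule eq_matI) (auto simp: poly_eval_toeplitz_entry)

lemma mat_mult_vec_index:
  assumes "i < n"
  shows "(mat n n' F *\<^sub>v vec n' x) $ i = (\<Sum>j<n'. F (i, j) * x j)"
  using assms by (simp add: scalar_prod_def row_def atLeast0LessThan)

lemma poly_eval_row_minor_zero:
  assumes "j0 \<le> e" "q j0 \<noteq> 0"
    and "\<And>i. i \<le> e \<Longrightarrow> (\<Sum>j<Suc e. (if j \<le> k i then w $ (k i - j) else 0) * q j) = 0"
  shows "poly_eval (row_minor e k) w = 0"
proof -
  define A where "A = mat (Suc e) (Suc e) (\<lambda>(i, j). if j \<le> k i then w $ (k i - j) else 0)"
  have A: "A \<in> carrier_mat (Suc e) (Suc e)" by (simp add: A_def)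
  define x where "x = vec (Suc e) q"
  have "x \<noteq> 0\<^sub>v (Suc e)"
  proof
    assume "x = 0\<^sub>v (Suc e)"
    then have "x $ j0 = 0\<^sub>v (Suc e) $ j0" by simp
    then show False using assms(1,2) by (simp add: x_def)
  qed
  moreover have "A *\<^sub>v x = 0\<^sub>v (Suc e)"
  proof (rule eq_vecI)
    fix i assume "i < dim_vec (0\<^sub>v (Suc e) :: complex vec)"
    then have i: "i < Suc e" by simp
    have "(A *\<^sub>v x) $ i = (\<Sum>j<Suc e. (if j \<le> k i then w $ (k i - j) else 0) * q j)"
      unfolding A_def x_def mat_mult_vec_index[OF i] by (simp only: prod.case)
    also have "\<dots> = 0" by (rule assms(3)) (use i in simp)
    finally show "(A *\<^sub>v x) $ i = 0\<^sub>v (Suc e) $ i" using i by simp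
  qed (simp add: A_def)
  moreover have "x \<in> carrier_vec (Suc e)" by (simp add: x_def)
  ultimately have "det A = 0" using det_0_iff_vec_prod_zero_field[OF A] by blast
  then show ?thesis by (simp only: poly_eval_row_minor A_def)
qed

lemma poly_eval_row_minor_nonzero:
  assumes "\<And>x. (\<And>i. i \<le> e \<Longrightarrow> (\<Sum>j<Suc e. (if j \<le> k i then w $ (k i - j) else 0) * x j) = 0)
    \<Longrightarrow> (\<And>j. j \<le> e \<Longrightarrow> x j = 0)"
  shows "poly_eval (row_minor e k) w \<noteq> 0"
proof
  define A where "A = mat (Suc e) (Suc e) (\<lambda>(i, j). if j \<le> k i then w $ (k i - j) else 0)"
  have A: "A \<in> carrier_mat (Suc e) (Suc e)" by (simp add: A_def)
  assume "poly_eval (row_minor e k) w = 0"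
  then have "det A = 0" by (simp only: poly_eval_row_minor A_def)
  then obtain x where x: "x \<in> carrier_vec (Suc e)" "x \<noteq> 0\<^sub>v (Suc e)" "A *\<^sub>v x = 0\<^sub>v (Suc e)"
    using det_0_iff_vec_prod_zero_field[OF A] by blast
  have vx: "vec (Suc e) (\<lambda>j. x $ j) = x" using x(1) by auto
  have "(\<Sum>j<Suc e. (if j \<le> k i then w $ (k i - j) else 0) * x $ j) = 0" if "i \<le> e" for i
  proof -
    have i: "i < Suc e" using that by simp
    have "(A *\<^sub>v x) $ i = (\<Sum>j<Suc e. (if j \<le> k i then w $ (k i - j) else 0) * x $ j)"
      using mat_mult_vec_index[OF i, of "Suc e" _ "\<lambda>j. x $ j"] unfolding vx A_def by (simp only: prod.case)
    then show ?thesis using x(3) i by simp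
  qed
  then have "x $ j = 0" if "j \<le> e" for j using assms[of "\<lambda>j. x $ j"] that by blast
  then have "x = 0\<^sub>v (Suc e)" using x(1) by (intro eq_vecI) auto
  then show False using x(2) by contradiction
qed

text \<open>Cramer's rule: apply the adjugate and divide by the determinant.\<close>

lemma linear_system_solution:
  fixes B :: "complex mat"
  assumes B: "B \<in> carrier_mat n n" and "det B \<noteq> 0" and y: "y \<in> carrier_vec n"
  shows "\<exists>x\<in>carrier_vec n. B *\<^sub>v x = y"
proof -
  define x where "x = (1 / det B) \<cdot>\<^sub>v (adj_mat B *\<^sub>v y)"
  have adj: "adj_mat B \<in> carrier_mat n n" "B * adj_mat B = det B \<cdot>\<^sub>m 1\<^sub>m n" using adj_mat[OF B] by blast+
  have xc: "adj_mat B *\<^sub>v y \<in> carrier_vec n" using adj(1) y by simp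
  have "B *\<^sub>v x = (1 / det B) \<cdot>\<^sub>v (B *\<^sub>v (adj_mat B *\<^sub>v y))"
    unfolding x_def using B xc by (rule mult_mat_vec)
  also have "B *\<^sub>v (adj_mat B *\<^sub>v y) = (B * adj_mat B) *\<^sub>v y" using B adj(1) y by simp
  also have "\<dots> = det B \<cdot>\<^sub>v y" 
  proof (rule eq_vecI)
    fix i assume "i < dim_vec (det B \<cdot>\<^sub>v y)"
    then have i: "i < n" using y by simp
    have "(B * adj_mat B *\<^sub>v y) $ i = (\<Sum>j = 0..<n. if i = j then det B * y $ j else 0)"
    proof -
      have "(B * adj_mat B *\<^sub>v y) $ i = (\<Sum>j = 0..<n. det B * (if j = i then 1 else 0) * y $ j)"
        unfolding adj(2) using i y by (simp add: scalar_prod_def)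
      also have "\<dots> = (\<Sum>j = 0..<n. if i = j then det B * y $ j else 0)" by (rule sum.cong) auto
      finally show ?thesis .
    qed
    then show "(B * adj_mat B *\<^sub>v y) $ i = (det B \<cdot>\<^sub>v y) $ i" using i y by simp
  qed (use B y adj(1) in simp)
  also have "(1 / det B) \<cdot>\<^sub>v \<dots> = y" using assms(2) by (simp add: smult_smult_assoc)
  finally show ?thesis using xc by (intro bexI[of _ x]) (simp_all add: x_def)
qed

text \<open>The linear recurrence with coefficients \<open>q\<close> that continues the initial
  values \<open>v\<close> beyond index \<open>n\<close>. In its application
  \<open>n = d + e\<close>, so \<open>k - Suc j\<close> with \<open>j < e\<close> is never
  truncated.\<close>

function ext_seq :: "nat \<Rightarrow> nat \<Rightarrow> (nat \<Rightarrow> complex) \<Rightarrow> (nat \<Rightarrow> complex) \<Rightarrow> nat \<Rightarrow> complex" where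
  "ext_seq n e q v k = (if k \<le> n then v k else - (\<Sum>j<e. ext_seq n e q v (k - Suc j) * q j))"
  by pat_completeness auto
termination by (relation "measure (\<lambda>(n, e, q, v, k). k)") auto

declare ext_seq.simps [simp del]

context pade
begin

definition vanishes_at :: "complex vec \<Rightarrow> bool" where
  "vanishes_at w \<longleftrightarrow> (\<forall>f\<in>I. poly_eval f w = 0)"

lemma vanishes_atI:
  assumes "\<And>X. good X \<Longrightarrow> poly_eval (diag_minor X) w = 0"
  shows "vanishes_at w"
proof -
  have "I \<subseteq> {f \<in> carrier (poly_ring m). poly_eval f w = 0}"
  proof (rule I_minimal)
    show "ideal {f \<in> carrier (poly_ring m). poly_eval f w = 0} (poly_ring m)"
      by (rule poly_ring_idealI) (simp_all add: carrier_zero carrier_add carrier_mult poly_eval_add poly_eval_mult)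
    have "poly_eval (signof p * diag_minor X) w = 0" if "good X" for p X
      using assms[OF that] by (simp add: sign_def poly_eval_uminus)
    then have "poly_eval f w = 0" if "f \<in> minors (Suc e) (P_T d e m)" for f
      using that unfolding minors_eq by blast
    then show "minors (Suc e) (P_T d e m) \<subseteq> {f \<in> carrier (poly_ring m). poly_eval f w = 0}"
      using minors_carrier by blast
  qed
  then show ?thesis unfolding vanishes_at_def by blast
qed

text \<open>One vector \<open>q\<close> annihilates all rows of the matrix at \<open>w\<close>,
  hence those of each maximal minor. The condition says that the convolution of \<open>q\<close>
  with \<open>w\<close> vanishes in degrees \<open>d + 1\<close> to \<open>m\<close>.\<close>

lemma vanishes_at_kernel:
  assumes "j0 \<le> e" "q j0 \<noteq> 0"
    and "\<And>k. d < k \<Longrightarrow> k \<le> m \<Longrightarrow> (\<Sum>j<Suc e. (if j \<le> k then w $ (k - j) else 0) * q j) = 0"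
  shows "vanishes_at w"
proof (rule vanishes_atI)
  fix X assume X: "good X"
  show "poly_eval (diag_minor X) w = 0"
    unfolding diag_minor_def
    by (rule poly_eval_row_minor_zero[of j0 e q, OF assms(1,2)]) (rule assms(3), use good_rows(2)[OF X] in blast, use good_rows(2)[OF X] in blast)
qed

text \<open>Normalise the kernel vector to first entry \<open>1\<close>. The equations in degrees
  \<open>d + 1\<close> to \<open>d + e\<close> involve only the given coordinates and can be solved
  for its other entries, as \<open>Delta\<close> does not vanish; each later equation then
  determines one new coordinate.\<close>

lemma point_extension:
  assumes v: "v \<in> carrier_vec (Suc (d + e))" and D: "poly_eval (Delta d e) v \<noteq> 0"
  shows "\<exists>w\<in>carrier_vec (m + 1). (\<forall>i\<le>d + e. w $ i = v $ i) \<and> vanishes_at w"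
proof -
  define F where "F = (\<lambda>(a, b). if b \<le> d + a then v $ (d + a - b) else 0)"
  define B where "B = mat e e F"
  have B: "B \<in> carrier_mat e e" by (simp add: B_def)
  have "poly_eval (Delta d e) v = det B"
    unfolding Delta_def poly_eval_det B_def F_def
    by (rule arg_cong[of _ _ det], rule eq_matI) (auto simp: poly_eval_toeplitz_entry)
  then have "det B \<noteq> 0" using D by simp
  then obtain x where x: "x \<in> carrier_vec e" "B *\<^sub>v x = vec e (\<lambda>a. - v $ (Suc (d + a)))"
    using linear_system_solution[OF B] by (metis vec_carrier)
  define q where "q j = x $ j" for j
  have vx: "vec e q = x" using x(1) by (auto simp: q_def)
  have sol: "(\<Sum>j<e. F (a, j) * q j) = - v $ (Suc (d + a))" if "a < e" for a
  proof -
    have "(B *\<^sub>v x) $ a = (\<Sum>j<e. F (a, j) * q j)"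
      unfolding B_def vx[symmetric] by (rule mat_mult_vec_index[OF that])
    then show ?thesis using x(2) that by simp
  qed
  define s where "s = ext_seq (d + e) e q (\<lambda>i. v $ i)"
  define w where "w = vec (m + 1) s"
  have slow: "s i = v $ i" if "i \<le> d + e" for i
    unfolding s_def by (subst ext_seq.simps) (use that in simp)
  have shigh: "s k = - (\<Sum>j<e. s (k - Suc j) * q j)" if "d + e < k" for k
    unfolding s_def by (subst ext_seq.simps) (use that in simp)
  define q' where "q' j = (case j of 0 \<Rightarrow> 1 | Suc i \<Rightarrow> q i)" for j
  have "vanishes_at w"
  proof (rule vanishes_at_kernel[of 0 q'])
    show "0 \<le> e" "q' 0 \<noteq> 0" by (simp_all add: q'_def)
    fix k assume k: "d < k" "k \<le> m"
    have "(\<Sum>j<Suc e. (if j \<le> k then w $ (k - j) else 0) * q' j) =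
        (if 0 \<le> k then w $ (k - 0) else 0) * q' 0 + (\<Sum>j<e. (if Suc j \<le> k then w $ (k - Suc j) else 0) * q' (Suc j))"
      by (rule sum.lessThan_Suc_shift)
    also have "\<dots> = s k + (\<Sum>j<e. (if Suc j \<le> k then s (k - Suc j) else 0) * q j)"
    proof -
      have "w $ i = s i" if "i \<le> k" for i using k that by (simp add: w_def)
      then show ?thesis by (auto simp: q'_def intro!: sum.cong)
    qed
    also have "\<dots> = 0"
    proof (cases "k \<le> d + e")
      case True
      define a where "a = k - Suc d"
      have a: "k = Suc (d + a)" "a < e" using True k unfolding a_def by linarith+
      have "(\<Sum>j<e. (if Suc j \<le> k then s (k - Suc j) else 0) * q j) = (\<Sum>j<e. F (a, j) * q j)"
        by (rule sum.cong) (use a in \<open>auto simp: F_def slow\<close>)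
      then show ?thesis using sol[OF a(2)] slow[OF True] a(1) by simp
    next
      case False
      then have "(\<Sum>j<e. (if Suc j \<le> k then s (k - Suc j) else 0) * q j) = (\<Sum>j<e. s (k - Suc j) * q j)"
        by (intro sum.cong) auto
      then show ?thesis using shigh[of k] False by simp
    qed
    finally show "(\<Sum>j<Suc e. (if j \<le> k then w $ (k - j) else 0) * q' j) = 0" .
  qed
  moreover have "\<forall>i\<le>d + e. w $ i = v $ i" using dem slow by (simp add: w_def)
  ultimately show ?thesis by (intro bexI[of _ w]) (simp_all add: w_def)
qed

lemma Delta_nonzero: "Delta d e \<noteq> 0"
proof
  assume D: "Delta d e = 0"
  define x :: monomial where "x = of_nat e * sgl d 1"
  have x: "x = mon (replicate_mset e d)"
    unfolding x_def by (induction e) (simp_all add: algebra_simps)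
  have "Vdeg x = 0" unfolding x Vdeg_def wt_mon by (simp add: image_replicate_mset)
  moreover have "x \<in> supp (Delta d e - sgl x 1)" by (simp add: D in_keys_iff lookup_minus)
  ultimately show False using Delta_lead unfolding x_def by fastforce
qed

text \<open>After multiplication by \<open>Delta * var 0\<close> the polynomial vanishes everywhere,
  because where both factors are nonzero the point extends to a zero of the ideal. The factor
  \<open>var 0\<close> ensures that the extension is not the zero vector, which represents no
  projective point.\<close>

lemma generic_vanishing:
  assumes g: "g \<in> carrier (poly_ring (d + e))"
    and van: "\<And>w. w \<in> carrier_vec (m + 1) \<Longrightarrow> w \<noteq> 0\<^sub>v (m + 1) \<Longrightarrow> vanishes_at w \<Longrightarrow> poly_eval g w = 0"
  shows "g = 0"
proof -
  have "g * (Delta d e * var 0) = 0"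
  proof (rule poly_eval_eq_zero_imp)
    have "g * (Delta d e * var 0) \<in> carrier (poly_ring (d + e))"
      by (intro carrier_mult g Delta_carrier carrier_var) simp
    then show "\<forall>a\<in>supp (g * (Delta d e * var 0)). supp a \<subseteq> {..<Suc (d + e)}"
      unfolding carrier_poly_ring lessThan_Suc_atMost .
    fix v :: "complex vec" assume v: "v \<in> carrier_vec (Suc (d + e))"
    show "poly_eval (g * (Delta d e * var 0)) v = 0"
    proof (cases "poly_eval (Delta d e) v = 0 \<or> v $ 0 = 0")
      case True
      then show ?thesis by (auto simp: poly_eval_mult)
    next
      case False
      then obtain w where w: "w \<in> carrier_vec (m + 1)" "\<And>i. i \<le> d + e \<Longrightarrow> w $ i = v $ i" "vanishes_at w"
        using point_extension[OF v] by blast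
      have "w $ 0 \<noteq> 0" using w(2)[of 0] False by simp
      then have "w \<noteq> 0\<^sub>v (m + 1)" by auto
      then have "poly_eval g w = 0" using van w by blast
      then show ?thesis using poly_eval_cong[OF g, of v w] w(2) by (simp add: poly_eval_mult)
    qed
  qed
  moreover have "var 0 \<noteq> 0"
  proof
    assume "var 0 = 0"
    then have "poly_eval (var 0) (unit_vec 1 0) = poly_eval 0 (unit_vec 1 0)" by (rule arg_cong)
    then show False by simp
  qed
  ultimately show ?thesis using Delta_nonzero by (metis mult_eq_0_iff)
qed

text \<open>Clearing denominators turns \<open>f\<close> into a polynomial in the free variables
  that still vanishes on the zero locus and is therefore zero; regularity of \<open>Delta\<close>
  then cancels the denominator.\<close>

lemma I_contains_vanishing:
  assumes f: "f \<in> carrier (poly_ring m)"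
    and van: "\<And>w. w \<in> carrier_vec (m + 1) \<Longrightarrow> w \<noteq> 0\<^sub>v (m + 1) \<Longrightarrow> vanishes_at w \<Longrightarrow> poly_eval f w = 0"
  shows "f \<in> I"
proof -
  obtain n g where g: "g \<in> carrier (poly_ring (d + e))" "Delta d e ^ n * f - g \<in> I"
    using Delta_clear_denominators[OF f] by blast
  have "g = 0"
  proof (rule generic_vanishing[OF g(1)])
    fix w assume w: "w \<in> carrier_vec (m + 1)" "w \<noteq> 0\<^sub>v (m + 1)" "vanishes_at w"
    have "poly_eval (Delta d e ^ n * f - g) w = 0" using w(3) g(2) unfolding vanishes_at_def by blast
    then show "poly_eval g w = 0" using van[OF w] by (simp add: poly_eval_diff poly_eval_mult)
  qed
  then show ?thesis using g(2) Delta_power_regular[OF f] by simp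
qed

text \<open>The cleared forms of \<open>f\<close> and \<open>g\<close> lie in a domain, the
  polynomial ring in the free variables, and their product vanishes on the zero locus. So one of
  them is zero, and regularity of \<open>Delta\<close> puts the original factor into
  \<open>I\<close>.\<close>

lemma I_prime:
  assumes f: "f \<in> carrier (poly_ring m)" and g: "g \<in> carrier (poly_ring m)" and fg: "f * g \<in> I"
  shows "f \<in> I \<or> g \<in> I"
proof -
  obtain n f' where f': "f' \<in> carrier (poly_ring (d + e))" "Delta d e ^ n * f - f' \<in> I"
    using Delta_clear_denominators[OF f] by blast
  obtain k g' where g': "g' \<in> carrier (poly_ring (d + e))" "Delta d e ^ k * g - g' \<in> I"
    using Delta_clear_denominators[OF g] by blast
  have "f' * g' = 0"
  proof (rule generic_vanishing[OF carrier_mult[OF f'(1) g'(1)]])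
    fix w assume w: "vanishes_at w"
    then have "poly_eval (Delta d e ^ n * f - f') w = 0" "poly_eval (Delta d e ^ k * g - g') w = 0" "poly_eval (f * g) w = 0"
      using f'(2) g'(2) fg unfolding vanishes_at_def by blast+
    then show "poly_eval (f' * g') w = 0" by (auto simp: poly_eval_diff poly_eval_mult)
  qed
  then have "f' = 0 \<or> g' = 0" by simp
  then show ?thesis
  proof
    assume "f' = 0"
    then show ?thesis using f'(2) Delta_power_regular[OF f, of n] by simp
  next
    assume "g' = 0"
    then show ?thesis using g'(2) Delta_power_regular[OF g, of k] by simp
  qed
qed

lemma one_notin_I: "1 \<notin> I"
proof
  assume "1 \<in> I"
  have "(1 :: cpoly) = 0"
  proof (rule generic_vanishing[OF carrier_one])
    fix w assume "vanishes_at w"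
    then show "poly_eval 1 w = 0" using \<open>1 \<in> I\<close> unfolding vanishes_at_def by blast
  qed
  then show False by simp
qed

lemma primeideal_I: "primeideal I (poly_ring m)"
proof (rule primeidealI[OF ideal_I cring_poly_ring])
  show "carrier (poly_ring m) \<noteq> I" using one_notin_I carrier_one by blast
  show "a \<in> I \<or> b \<in> I" if "a \<in> carrier (poly_ring m)" "b \<in> carrier (poly_ring m)" "a \<otimes>\<^bsub>poly_ring m\<^esub> b \<in> I" for a b
    using I_prime that by simp
qed

text \<open>The first column has only subscripts above \<open>d\<close>, so it is zero at this
  point.\<close>

lemma vanishes_at_unit:
  assumes "i \<le> d"
  shows "vanishes_at (unit_vec (m + 1) i)"
proof (rule vanishes_at_kernel[of 0 "\<lambda>j. if j = 0 then 1 else 0"])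
  fix k assume k: "d < k" "k \<le> m"
  show "(\<Sum>j<Suc e. (if j \<le> k then unit_vec (m + 1) i $ (k - j) else 0) * (if j = 0 then 1 else 0)) = (0 :: complex)"
  proof (rule sum.neutral, rule ballI)
    fix j
    show "(if j \<le> k then unit_vec (m + 1) i $ (k - j) else 0) * (if j = 0 then 1 else 0) = (0 :: complex)"
      using k assms by (cases "j = 0") simp_all
  qed
qed simp_all

end

section \<open>Forms and closed sets in projective space\<close>

lemma proj_class_self:
  "v \<in> carrier_vec (m + 1) \<Longrightarrow> v \<noteq> 0\<^sub>v (m + 1) \<Longrightarrow> v \<in> proj_rel m `` {v}"
  by (auto simp: proj_rel_def intro!: exI[of _ 1])

lemma proj_class_in_space:
  "v \<in> carrier_vec (m + 1) \<Longrightarrow> v \<noteq> 0\<^sub>v (m + 1) \<Longrightarrow> proj_rel m `` {v} \<in> proj_space m"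
  unfolding proj_space_def by (rule quotientI) simp

lemma proj_space_nonempty: "p \<in> proj_space m \<Longrightarrow> \<exists>v. v \<in> p"
  unfolding proj_space_def by (metis DiffD1 DiffD2 proj_class_self quotientE singletonI)

lemma proj_space_members:
  assumes "p \<in> proj_space m" "v \<in> p"
  shows "v \<in> carrier_vec (m + 1)" "v \<noteq> 0\<^sub>v (m + 1)"
proof -
  obtain u where u: "u \<in> carrier_vec (m + 1)" "u \<noteq> 0\<^sub>v (m + 1)" "p = proj_rel m `` {u}"
    using assms(1) unfolding proj_space_def by (auto elim!: quotientE)
  obtain t where t: "t \<noteq> 0" "v = t \<cdot>\<^sub>v u" using assms(2) unfolding u(3) proj_rel_def by auto
  show "v \<in> carrier_vec (m + 1)" using t u by simp
  show "v \<noteq> 0\<^sub>v (m + 1)"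
  proof
    assume "v = 0\<^sub>v (m + 1)"
    then have "(1 / t) \<cdot>\<^sub>v (t \<cdot>\<^sub>v u) = (1 / t) \<cdot>\<^sub>v 0\<^sub>v (m + 1)" using t(2) by simp
    moreover have "(1 / t) \<cdot>\<^sub>v 0\<^sub>v (m + 1) = (0\<^sub>v (m + 1) :: complex vec)" by (intro eq_vecI) simp_all
    ultimately have "u = 0\<^sub>v (m + 1)" using t(1) by (simp add: smult_smult_assoc)
    then show False using u(2) by contradiction
  qed
qed

lemma proj_space_scale:
  assumes "p \<in> proj_space m" "v \<in> p" "w \<in> p"
  shows "\<exists>t. t \<noteq> 0 \<and> w = t \<cdot>\<^sub>v v"
proof -
  obtain u where u: "p = proj_rel m `` {u}"
    using assms(1) unfolding proj_space_def by (auto elim!: quotientE)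
  obtain s t where "s \<noteq> 0" "v = s \<cdot>\<^sub>v u" "t \<noteq> 0" "w = t \<cdot>\<^sub>v u"
    using assms(2,3) unfolding u proj_rel_def by auto
  then show ?thesis by (intro exI[of _ "t / s"]) (simp add: smult_smult_assoc)
qed

definition form :: "nat \<Rightarrow> nat \<Rightarrow> cpoly \<Rightarrow> bool" where
  "form m n f \<longleftrightarrow> f \<in> carrier (poly_ring m) \<and> (\<forall>a\<in>supp f. deg a = n)"

lemma homogeneous_form: "f \<in> carrier (poly_ring m) \<Longrightarrow> homogeneous f \<longleftrightarrow> (\<exists>n. form m n f)"
  by (simp add: homogeneous_iff form_def)

lemma form_carrier: "form m n f \<Longrightarrow> f \<in> carrier (poly_ring m)"
  by (simp add: form_def)

lemma form_mult:
  assumes "form m n f" "form m k g"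
  shows "form m (n + k) (f * g)"
  unfolding form_def
proof (intro conjI ballI)
  show "f * g \<in> carrier (poly_ring m)" using assms form_carrier carrier_mult by blast
  fix a assume "a \<in> supp (f * g)"
  then obtain b c where "b \<in> supp f" "c \<in> supp g" "a = b + c" using keys_mult[of f g] by blast
  then show "deg a = n + k" using assms by (simp add: form_def deg_add)
qed

lemma form_one: "form m 0 1"
  by (simp add: form_def carrier_one)

lemma form_zero: "form m n 0"
  by (simp add: form_def carrier_zero)

lemma form_const: "form m 0 (sgl 0 c)"
  by (simp add: form_def carrier_single)

lemma form_scale: "form m n f \<Longrightarrow> form m n (sgl 0 c * f)"
  using form_mult[OF form_const, of m n f c] by simp

lemma form_var: "i \<le> m \<Longrightarrow> form m 1 (var i)"
  by (simp add: form_def carrier_var) (simp add: var_def)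

lemma form_power: "form m n f \<Longrightarrow> form m (n * k) (f ^ k)"
  by (induction k) (simp_all add: form_one form_mult)

lemma form_add:
  assumes "form m n f" "form m n g"
  shows "form m n (f + g)"
  unfolding form_def
proof (intro conjI ballI)
  show "f + g \<in> carrier (poly_ring m)" using assms form_carrier carrier_add by blast
  fix a assume "a \<in> supp (f + g)"
  then have "a \<in> supp f \<union> supp g" by (rule rev_subsetD[OF _ keys_add])
  then show "deg a = n" using assms by (auto simp: form_def)
qed

lemma form_sum: "(\<And>x. x \<in> A \<Longrightarrow> form m n (f x)) \<Longrightarrow> form m n (sum f A)"
  by (induction A rule: infinite_finite_induct) (simp_all add: form_zero form_add)

lemma form_eval_smult:
  assumes "form m n f" "v \<in> carrier_vec (m + 1)"
  shows "poly_eval f (t \<cdot>\<^sub>v v) = t ^ n * poly_eval f v"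
proof (rule poly_eval_smult)
  show "\<forall>a\<in>supp f. deg a = n" using assms by (simp add: form_def)
  show "\<forall>a\<in>supp f. supp a \<subseteq> {..<dim_vec v}"
    using assms by (simp add: form_def carrier_poly_ring lessThan_Suc_atMost)
qed

definition vanishes_on :: "cpoly \<Rightarrow> complex vec set set \<Rightarrow> bool" where
  "vanishes_on f Z \<longleftrightarrow> (\<forall>p\<in>Z. \<forall>v\<in>p. poly_eval f v = 0)"

lemma form_eval_point:
  assumes "form m n f" "p \<in> proj_space m" "v \<in> p" "poly_eval f v = 0" "w \<in> p"
  shows "poly_eval f w = 0"
proof -
  obtain t where "w = t \<cdot>\<^sub>v v" using proj_space_scale[OF assms(2,3,5)] by blast
  then show ?thesis using form_eval_smult[OF assms(1) proj_space_members(1)[OF assms(2,3)]] assms(4) by simp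
qed

lemma zariski_closed_space: "zariski_closed m Z \<Longrightarrow> Z \<subseteq> proj_space m"
  unfolding zariski_closed_def proj_zeros_def by blast

lemma zariski_closed_Int_form:
  assumes "zariski_closed m Z" "form m n f"
  shows "zariski_closed m {p \<in> Z. \<forall>v\<in>p. poly_eval f v = 0}"
proof -
  obtain S where S: "S \<subseteq> carrier (poly_ring m)" "\<forall>f\<in>S. homogeneous f" "Z = proj_zeros m S"
    using assms(1) unfolding zariski_closed_def by blast
  show ?thesis
    unfolding zariski_closed_def
  proof (intro exI[of _ "insert f S"] conjI)
    show "insert f S \<subseteq> carrier (poly_ring m)" using S(1) assms(2) form_carrier by blast
    show "\<forall>g\<in>insert f S. homogeneous g"
      using S(2) assms(2) homogeneous_form[OF form_carrier[OF assms(2)]] by blast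
    show "{p \<in> Z. \<forall>v\<in>p. poly_eval f v = 0} = proj_zeros m (insert f S)"
      unfolding S(3) proj_zeros_def by blast
  qed
qed

text \<open>The zeros of \<open>f\<close> and of \<open>g\<close> in \<open>Z\<close> are closed and
  cover \<open>Z\<close>. Covering uses that the vanishing of a form at a point does not depend on
  the representative.\<close>

lemma irreducible_prime:
  assumes Z: "irreducible_proj_variety m Z" and f: "form m n f" and g: "form m k g"
    and fg: "vanishes_on (f * g) Z"
  shows "vanishes_on f Z \<or> vanishes_on g Z"
proof -
  have cl: "zariski_closed m Z" using Z unfolding irreducible_proj_variety_def by blast
  define A where "A = {p \<in> Z. \<forall>v\<in>p. poly_eval f v = 0}"
  define B where "B = {p \<in> Z. \<forall>v\<in>p. poly_eval g v = 0}"
  have "p \<in> A \<union> B" if p: "p \<in> Z" for p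
  proof -
    have ps: "p \<in> proj_space m" using zariski_closed_space[OF cl] p by blast
    obtain v where v: "v \<in> p" using proj_space_nonempty[OF ps] by blast
    have "poly_eval f v = 0 \<or> poly_eval g v = 0"
      using fg p v unfolding vanishes_on_def by (simp add: poly_eval_mult)
    then show ?thesis
      using form_eval_point[OF f ps v] form_eval_point[OF g ps v] p unfolding A_def B_def by blast
  qed
  then have "Z = A \<union> B" unfolding A_def B_def by blast
  moreover have "zariski_closed m A" "zariski_closed m B"
    unfolding A_def B_def using zariski_closed_Int_form[OF cl] f g by blast+
  ultimately have "Z = A \<or> Z = B" using Z unfolding irreducible_proj_variety_def by blast
  then show ?thesis unfolding A_def B_def vanishes_on_def by blast
qed

text \<open>Gaussian elimination by induction on the equations: if some \<open>M a0 b\<close> is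
  nonzero, equation \<open>b\<close> is solved for the unknown \<open>a0\<close>, which is
  substituted into the others.\<close>

lemma underdetermined_system:
  fixes M :: "'a \<Rightarrow> 'b \<Rightarrow> complex"
  assumes "finite S" "finite A" "card S < card A"
  shows "\<exists>c. (\<exists>a\<in>A. c a \<noteq> 0) \<and> (\<forall>b\<in>S. (\<Sum>a\<in>A. c a * M a b) = 0)"
  using assms
proof (induction S arbitrary: A M rule: finite_induct)
  case empty
  then have "A \<noteq> {}" by auto
  then show ?case by (intro exI[of _ "\<lambda>_. 1"]) auto
next
  case (insert b S)
  show ?case
  proof (cases "\<forall>a\<in>A. M a b = 0")
    case True
    obtain c where c: "\<exists>a\<in>A. c a \<noteq> 0" "\<forall>b\<in>S. (\<Sum>a\<in>A. c a * M a b) = 0"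
      using insert.IH[of A M] insert.prems insert.hyps by auto
    have "(\<Sum>a\<in>A. c a * M a b) = 0" by (rule sum.neutral) (simp add: True)
    then show ?thesis using c by (intro exI[of _ c]) simp
  next
    case False
    then obtain a0 where a0: "a0 \<in> A" "M a0 b \<noteq> 0" by blast
    define A' where "A' = A - {a0}"
    have A': "finite A'" "card S < card A'" "a0 \<notin> A'" "A = insert a0 A'"
      using insert.prems insert.hyps a0(1) unfolding A'_def by auto
    obtain c where c: "\<exists>a\<in>A'. c a \<noteq> 0"
        "\<forall>x\<in>S. (\<Sum>a\<in>A'. c a * (M a x - M a b / M a0 b * M a0 x)) = 0"
      using insert.IH[OF A'(1,2), of "\<lambda>a x. M a x - M a b / M a0 b * M a0 x"] by blast
    define c' where "c' a = (if a = a0 then - (\<Sum>a\<in>A'. c a * M a b) / M a0 b else c a)" for a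
    have sum_eq: "(\<Sum>a\<in>A. c' a * M a x) =
        (\<Sum>a\<in>A'. c a * M a x) - (\<Sum>a\<in>A'. c a * M a b) / M a0 b * M a0 x" for x
    proof -
      have "(\<Sum>a\<in>A'. c' a * M a x) = (\<Sum>a\<in>A'. c a * M a x)"
        by (rule sum.cong) (use A'(3) in \<open>auto simp: c'_def\<close>)
      then show ?thesis unfolding A'(4) using A'(1,3) by (simp add: c'_def)
    qed
    have "(\<Sum>a\<in>A. c' a * M a x) = 0" if "x \<in> insert b S" for x
    proof (cases "x = b")
      case True
      then show ?thesis using a0(2) by (simp add: sum_eq)
    next
      case False
      have "(\<Sum>a\<in>A'. c a * (M a x - M a b / M a0 b * M a0 x)) =
          (\<Sum>a\<in>A'. c a * M a x) - (\<Sum>a\<in>A'. c a * M a b) / M a0 b * M a0 x"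
        by (simp add: right_diff_distrib sum_subtractf sum_divide_distrib sum_distrib_right mult.assoc)
      then show ?thesis using c(2) that False by (simp add: sum_eq)
    qed
    moreover have "\<exists>a\<in>A. c' a \<noteq> 0" using c(1) A'(3,4) unfolding c'_def by auto
    ultimately show ?thesis by blast
  qed
qed

section \<open>Independent forms along a chain\<close>

definition exps :: "nat \<Rightarrow> nat \<Rightarrow> nat list set" where
  "exps B n = {as. set as \<subseteq> {..B} \<and> length as = n}"

lemma card_exps: "card (exps B n) = Suc B ^ n"
  unfolding exps_def by (subst card_lists_length_eq) simp_all

lemma finite_exps: "finite (exps B n)"
  unfolding exps_def by (rule finite_lists_length_eq) simp

lemma sum_exps_Suc: "(\<Sum>as\<in>exps B (Suc n). F as) = (\<Sum>a\<le>B. \<Sum>as\<in>exps B n. F (a # as))"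
proof -
  have "(\<Sum>a\<le>B. \<Sum>as\<in>exps B n. F (a # as)) = (\<Sum>(a, as)\<in>{..B} \<times> exps B n. F (a # as))"
    using finite_exps by (simp add: sum.cartesian_product)
  also have "\<dots> = (\<Sum>as\<in>exps B (Suc n). F as)"
    by (rule sum.reindex_bij_witness[of _ "\<lambda>as. (hd as, tl as)" "\<lambda>(a, as). a # as"])
      (auto simp: exps_def length_Suc_conv)
  finally show ?thesis by simp
qed

text \<open>Products of powers of the forms \<open>F i\<close> of degree \<open>dl i\<close>, filled up with powers of the linear
  form \<open>l\<close> to total degree \<open>D\<close>. The exponent list is ordered by decreasing index.\<close>

fun form_prod :: "(nat \<Rightarrow> cpoly) \<Rightarrow> (nat \<Rightarrow> nat) \<Rightarrow> cpoly \<Rightarrow> nat \<Rightarrow> nat list \<Rightarrow> cpoly" where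
  "form_prod F dl l D [] = l ^ D"
| "form_prod F dl l D (a # as) = F (length as) ^ a * form_prod F dl l (D - a * dl (length as)) as"

text \<open>The bound on \<open>D\<close> keeps every subtraction
  \<open>D - a * dl (length as)\<close> exact, so the power of \<open>l\<close> fills up the degree
  precisely.\<close>

lemma form_form_prod:
  assumes F: "\<And>i. i < n \<Longrightarrow> form m (dl i) (F i)" and l: "form m 1 l"
  shows "as \<in> exps B n \<Longrightarrow> B * (\<Sum>i<n. dl i) \<le> D \<Longrightarrow> form m D (form_prod F dl l D as)"
  using F
proof (induction n arbitrary: as D)
  case 0
  then show ?case using form_power[OF l, of D] by (simp add: exps_def)
next
  case (Suc n)
  then obtain a as' where as: "as = a # as'" "as' \<in> exps B n" "a \<le> B"
    by (auto simp: exps_def length_Suc_conv)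
  have len: "length as' = n" using as(2) by (simp add: exps_def)
  have adl: "a * dl n \<le> B * dl n" using as(3) by simp
  have "B * (\<Sum>i<n. dl i) + B * dl n \<le> D" using Suc.prems(2) by (simp add: algebra_simps)
  then have D: "B * (\<Sum>i<n. dl i) \<le> D - a * dl n" "a * dl n \<le> D" using adl by linarith+
  have "form m (dl n * a + (D - a * dl n)) (F n ^ a * form_prod F dl l (D - a * dl n) as')"
    using Suc.prems(3) by (intro form_mult form_power Suc.IH as(2) D(1)) simp_all
  then show ?case using D(2) by (simp add: as(1) len mult.commute)
qed

text \<open>\<open>F n\<close> vanishes on \<open>C n\<close> but not on \<open>C (Suc n)\<close>.
  Sort the combination by powers of \<open>F n\<close>: the lowest power not yet known to drop out
  is cancelled on the irreducible set \<open>C (Suc n)\<close>, and restriction to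
  \<open>C n\<close> kills all higher powers. What remains is a relation among shorter products on
  \<open>C n\<close>.\<close>

lemma form_prod_independent:
  assumes C: "\<And>i. i \<le> n \<Longrightarrow> irreducible_proj_variety m (C i)" and sub: "\<And>i. i < n \<Longrightarrow> C i \<subseteq> C (Suc i)"
    and F: "\<And>i. i < n \<Longrightarrow> form m (dl i) (F i)" "\<And>i. i < n \<Longrightarrow> vanishes_on (F i) (C i)"
      "\<And>i. i < n \<Longrightarrow> \<not> vanishes_on (F i) (C (Suc i))"
    and l: "form m 1 l" "\<not> vanishes_on l (C 0)"
    and D: "B * (\<Sum>i<n. dl i) \<le> D"
    and van: "vanishes_on (\<Sum>as\<in>exps B n. sgl 0 (c as) * form_prod F dl l D as) (C n)"
  shows "\<forall>as\<in>exps B n. c as = 0"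
  using C sub F D van
proof (induction n arbitrary: c D)
  case 0
  have e: "exps B 0 = {[]}" by (auto simp: exps_def)
  obtain p v where cpoly_vs: "p \<in> C 0" "v \<in> p" "poly_eval l v \<noteq> 0" using l(2) unfolding vanishes_on_def by blast
  have "poly_eval (sgl 0 (c []) * l ^ D) v = 0" using 0(7) cpoly_vs(1,2) unfolding vanishes_on_def e by simp
  then have "c [] = 0" using cpoly_vs(3) by (simp add: poly_eval_mult poly_eval_power)
  then show ?case by (simp add: e)
next
  case (Suc n)
  define G where "G a = (\<Sum>as\<in>exps B n. sgl 0 (c (a # as)) * form_prod F dl l (D - a * dl n) as)" for a
  have "B * (\<Sum>i<n. dl i) + B * dl n \<le> D" using Suc.prems(6) by (simp add: algebra_simps)
  then have D: "B * (\<Sum>i<n. dl i) \<le> D - a * dl n \<and> a * dl n \<le> D" if "a \<le> B" for a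
    using mult_le_mono1[OF that, of "dl n"] by linarith
  have formG: "form m (D - a * dl n) (G a)" if "a \<le> B" for a
    unfolding G_def
  proof (intro form_sum form_scale)
    fix as assume as: "as \<in> exps B n"
    show "form m (D - a * dl n) (form_prod F dl l (D - a * dl n) as)"
      by (rule form_form_prod[OF _ l(1) as conjunct1[OF D[OF that]]]) (use Suc.prems(3) in simp)
  qed
  have "(\<Sum>as\<in>exps B (Suc n). sgl 0 (c as) * form_prod F dl l D as) = (\<Sum>a\<le>B. F n ^ a * G a)"
    unfolding sum_exps_Suc G_def sum_distrib_left
    by (intro sum.cong refl) (simp add: exps_def mult.left_commute)
  then have vanF: "vanishes_on (\<Sum>a\<le>B. F n ^ a * G a) (C (Suc n))" using Suc.prems(7) by simp
  have zero: "\<forall>as\<in>exps B n. c (a # as) = 0" if "a \<le> B" for a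
    using that
  proof (induction a rule: less_induct)
    case (less a)
    have G0: "G a' = 0" if "a' < a" for a'
      unfolding G_def using less.IH[OF that] that less.prems by (intro sum.neutral) simp
    define H where "H = (\<Sum>a'\<in>{a..B}. F n ^ (a' - a) * G a')"
    have "(\<Sum>a'\<le>B. F n ^ a' * G a') = (\<Sum>a'\<in>{a..B}. F n ^ a' * G a')"
      by (rule sum.mono_neutral_right) (use G0 in auto)
    also have "\<dots> = F n ^ a * H"
      unfolding H_def sum_distrib_left by (intro sum.cong refl) (simp flip: power_add mult.assoc)
    finally have "vanishes_on (F n ^ a * H) (C (Suc n))" using vanF by simp
    moreover have "form m (D - a * dl n) H"
      unfolding H_def
    proof (rule form_sum)
      fix a' assume a': "a' \<in> {a..B}"
      have "form m (dl n * (a' - a) + (D - a' * dl n)) (F n ^ (a' - a) * G a')"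
        using a' Suc.prems(3) by (intro form_mult form_power formG) simp_all
      moreover have "dl n * (a' - a) + (D - a' * dl n) = D - a * dl n"
      proof -
        have "a' * dl n \<le> D" using D[of a'] a' by simp
        moreover have "a' * dl n = a * dl n + dl n * (a' - a)"
          using a' by (metis atLeastAtMost_iff add_mult_distrib2 le_add_diff_inverse mult.commute)
        ultimately show ?thesis by linarith
      qed
      ultimately show "form m (D - a * dl n) (F n ^ (a' - a) * G a')" by simp
    qed
    moreover have "form m (dl n * a) (F n ^ a)" using Suc.prems(3) by (intro form_power) simp
    moreover have "\<not> vanishes_on (F n ^ a) (C (Suc n))"
      using Suc.prems(5)[of n] unfolding vanishes_on_def by (auto simp: poly_eval_power)
    moreover have "irreducible_proj_variety m (C (Suc n))" using Suc.prems(1) by blast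
    ultimately have vanH: "vanishes_on H (C (Suc n))" using irreducible_prime by blast
    have "vanishes_on (G a) (C n)"
      unfolding vanishes_on_def
    proof (intro ballI)
      fix p v assume cpoly_vs: "p \<in> C n" "v \<in> p"
      have "p \<in> C (Suc n)" using Suc.prems(2)[of n] cpoly_vs(1) by blast
      then have "poly_eval H v = 0" using vanH cpoly_vs(2) unfolding vanishes_on_def by blast
      moreover have "poly_eval (F n) v = 0" using Suc.prems(4)[of n] cpoly_vs unfolding vanishes_on_def by blast
      then have "poly_eval H v = (\<Sum>a'\<in>{a..B}. if a' = a then poly_eval (G a) v else 0)"
        unfolding H_def poly_eval_sum poly_eval_mult poly_eval_power
        by (intro sum.cong) auto
      ultimately show "poly_eval (G a) v = 0" using less.prems by simp
    qed
    then show ?case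
      unfolding G_def using D[OF less.prems] Suc.prems(1-5)
      by (intro Suc.IH[of "D - a * dl n"]) simp_all
  qed
  show ?case
  proof
    fix as assume "as \<in> exps B (Suc n)"
    then obtain a as' where "as = a # as'" "as' \<in> exps B n" "a \<le> B"
      by (auto simp: exps_def length_Suc_conv)
    then show "c as = 0" using zero by blast
  qed
qed

section \<open>Irreducibility and dimension\<close>

context pade
begin

lemma form_diag_minor:
  assumes "good X"
  shows "form m (Suc e) (diag_minor X)"
  unfolding form_def
proof (intro conjI ballI)
  show "diag_minor X \<in> carrier (poly_ring m)" by (rule diag_minor_carrier[OF assms])
  fix a assume a: "a \<in> supp (diag_minor X)"
  show "deg a = Suc e"
  proof (cases "a = mon X")
    case True
    then show ?thesis using assms by (simp add: deg_mon good_def)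
  next
    case False
    then have "a \<in> supp (diag_minor X - sgl (mon X) 1)" using a by (simp add: in_keys_iff lookup_minus coef_single)
    then show ?thesis using diag_minor_lead[OF assms] by blast
  qed
qed

lemma vanishes_at_scale:
  assumes "vanishes_at v" "v \<in> carrier_vec (m + 1)"
  shows "vanishes_at (t \<cdot>\<^sub>v v)"
proof (rule vanishes_atI)
  fix X assume X: "good X"
  have "poly_eval (diag_minor X) v = 0" using assms(1) diag_minor_in_I[OF X] unfolding vanishes_at_def by blast
  then show "poly_eval (diag_minor X) (t \<cdot>\<^sub>v v) = 0" using form_eval_smult[OF form_diag_minor[OF X] assms(2)] by simp
qed

lemma in_zeros_iff: "p \<in> proj_zeros m I \<longleftrightarrow> p \<in> proj_space m \<and> (\<forall>v\<in>p. vanishes_at v)"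
  unfolding proj_zeros_def vanishes_at_def by blast

lemma zeros_point:
  assumes "v \<in> carrier_vec (m + 1)" "v \<noteq> 0\<^sub>v (m + 1)" "vanishes_at v"
  shows "proj_rel m `` {v} \<in> proj_zeros m I"
  unfolding in_zeros_iff
proof (intro conjI ballI)
  show "proj_rel m `` {v} \<in> proj_space m" using assms(1,2) by (rule proj_class_in_space)
  fix w assume "w \<in> proj_rel m `` {v}"
  then obtain t where "w = t \<cdot>\<^sub>v v" unfolding proj_rel_def by auto
  then show "vanishes_at w" using vanishes_at_scale[OF assms(3,1)] by simp
qed

lemma vanishes_on_zeros_iff:
  assumes "f \<in> carrier (poly_ring m)"
  shows "vanishes_on f (proj_zeros m I) \<longleftrightarrow> f \<in> I"
proof
  assume "f \<in> I"
  then show "vanishes_on f (proj_zeros m I)" unfolding vanishes_on_def proj_zeros_def by blast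
next
  assume v: "vanishes_on f (proj_zeros m I)"
  show "f \<in> I"
  proof (rule I_contains_vanishing[OF assms])
    fix w assume w: "w \<in> carrier_vec (m + 1)" "w \<noteq> 0\<^sub>v (m + 1)" "vanishes_at w"
    show "poly_eval f w = 0"
      using v zeros_point[OF w] proj_class_self[OF w(1,2)] unfolding vanishes_on_def by blast
  qed
qed

lemma zariski_closed_zeros: "zariski_closed m (proj_zeros m I)"
  unfolding zariski_closed_def
proof (intro exI[of _ "diag_minor ` {X. good X}"] conjI)
  show "diag_minor ` {X. good X} \<subseteq> carrier (poly_ring m)" using diag_minor_carrier by blast
  show "\<forall>f\<in>diag_minor ` {X. good X}. homogeneous f"
    using form_diag_minor homogeneous_form[OF diag_minor_carrier] by blast
  show "proj_zeros m I = proj_zeros m (diag_minor ` {X. good X})"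
  proof (rule equalityI; rule subsetI)
    fix p assume "p \<in> proj_zeros m I"
    then show "p \<in> proj_zeros m (diag_minor ` {X. good X})" unfolding proj_zeros_def using diag_minor_in_I by blast
  next
    fix p assume p: "p \<in> proj_zeros m (diag_minor ` {X. good X})"
    have "vanishes_at v" if "v \<in> p" for v
      by (rule vanishes_atI) (use p that in \<open>unfold proj_zeros_def, blast\<close>)
    then show "p \<in> proj_zeros m I" unfolding in_zeros_iff using p unfolding proj_zeros_def by blast
  qed
qed

text \<open>A closed set that does not contain the zero locus lies in the zeros of some polynomial
  outside \<open>I\<close>. If neither \<open>A\<close> nor \<open>B\<close> were the whole locus,
  the product of two such polynomials would vanish on it and so lie in the prime ideal.\<close>

lemma irreducible_zeros: "irreducible_proj_variety m (proj_zeros m I)"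
  unfolding irreducible_proj_variety_def
proof (intro conjI allI impI)
  show "zariski_closed m (proj_zeros m I)" by (rule zariski_closed_zeros)
  have "unit_vec (m + 1) 0 \<noteq> (0\<^sub>v (m + 1) :: complex vec)"
  proof
    assume "unit_vec (m + 1) 0 = (0\<^sub>v (m + 1) :: complex vec)"
    then have "unit_vec (m + 1) 0 $ 0 = (0\<^sub>v (m + 1) :: complex vec) $ 0" by simp
    then show False by simp
  qed
  then have "proj_rel m `` {unit_vec (m + 1) 0} \<in> proj_zeros m I"
    by (intro zeros_point vanishes_at_unit) simp_all
  then show "proj_zeros m I \<noteq> {}" by blast
  have test: "\<exists>f\<in>carrier (poly_ring m). f \<notin> I \<and> vanishes_on f A"
    if A: "zariski_closed m A" and ne: "\<not> proj_zeros m I \<subseteq> A" for A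
  proof -
    obtain S where S: "S \<subseteq> carrier (poly_ring m)" "A = proj_zeros m S"
      using A unfolding zariski_closed_def by blast
    obtain p where p: "p \<in> proj_zeros m I" "p \<notin> A" using ne by blast
    then obtain f v where f: "f \<in> S" "v \<in> p" "poly_eval f v \<noteq> 0"
      unfolding S(2) proj_zeros_def by blast
    have "f \<notin> I" using f(2,3) p(1) unfolding in_zeros_iff vanishes_at_def by blast
    moreover have "vanishes_on f A" using f(1) unfolding S(2) proj_zeros_def vanishes_on_def by blast
    ultimately show ?thesis using S(1) f(1) by blast
  qed
  fix A B assume AB: "zariski_closed m A" "zariski_closed m B" "proj_zeros m I = A \<union> B"
  show "proj_zeros m I = A \<or> proj_zeros m I = B"
  proof (rule ccontr)
    assume "\<not> (proj_zeros m I = A \<or> proj_zeros m I = B)"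
    then have "\<not> proj_zeros m I \<subseteq> A" "\<not> proj_zeros m I \<subseteq> B" using AB(3) by blast+
    then obtain f g where f: "f \<in> carrier (poly_ring m)" "f \<notin> I" "vanishes_on f A"
      and g: "g \<in> carrier (poly_ring m)" "g \<notin> I" "vanishes_on g B"
      using test[OF AB(1)] test[OF AB(2)] by blast
    have "vanishes_on (f * g) (proj_zeros m I)"
      using f(3) g(3) unfolding AB(3) vanishes_on_def by (auto simp: poly_eval_mult)
    then have "f * g \<in> I" using vanishes_on_zeros_iff[OF carrier_mult[OF f(1) g(1)]] by blast
    then show False using I_prime[OF f(1) g(1)] f(2) g(2) by blast
  qed
qed

section \<open>The upper bound for the dimension\<close>

definition reduced :: "nat \<Rightarrow> monomial set" where
  "reduced D = {b. supp b \<subseteq> {..m} \<and> Ydeg b \<le> e \<and> deg b = D}"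

text \<open>The exponent of \<open>c\<^sub>0\<close> is determined by the degree and the other exponents.\<close>

lemma card_reduced: "finite (reduced D) \<and> card (reduced D) \<le> Suc e ^ (m - d - e) * Suc D ^ (d + e)"
proof -
  \<comment> \<open>Exponents of middle variables are at most \<open>e\<close> and contribute a
    factor independent of \<open>D\<close>. Among \<open>c_1, ..., c_m\<close> there remain
    \<open>d + e\<close> variables with exponents up to \<open>D\<close>.\<close>
  define P where "P = PiE {1..m} (\<lambda>i. if i \<in> {Suc d..m - e} then {..e} else {..D})"
  have finP: "finite P" unfolding P_def by (intro finite_PiE) auto
  define r where "r b = restrict (coef b) {1..m}" for b :: monomial
  have wts: "wt u b = (\<Sum>i\<in>{..m}. coef b i * u i)" if "b \<in> reduced D" for u b
    using that by (intro wt_superset) (simp_all add: reduced_def)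
  have "r ` reduced D \<subseteq> P"
  proof (rule image_subsetI)
    fix b assume b: "b \<in> reduced D"
    have D: "coef b i \<le> D" if "i \<le> m" for i
    proof -
      have "coef b i * 1 \<le> (\<Sum>i\<in>{..m}. coef b i * 1)"
        by (rule member_le_sum[of i "{..m}" "\<lambda>i. coef b i * 1"]) (use that in simp_all)
      then show ?thesis using b wts[OF b, of "\<lambda>_. 1"] by (simp add: reduced_def deg_def)
    qed
    have Y: "coef b i \<le> e" if "i \<in> {Suc d..m - e}" for i
    proof -
      define u :: "nat \<Rightarrow> nat" where "u i = (if i \<in> {Suc d..m - e} then 1 else 0)" for i
      have "i \<in> {..m}" using that by (meson atLeastAtMost_iff atMost_iff diff_le_self le_trans)
      then have "coef b i * u i \<le> (\<Sum>i\<in>{..m}. coef b i * u i)"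
        by (intro member_le_sum[of i "{..m}" "\<lambda>i. coef b i * u i"]) simp_all
      also have "\<dots> = Ydeg b" using wts[OF b, of u] by (simp add: Ydeg_def u_def[abs_def])
      also have "\<dots> \<le> e" using b by (simp add: reduced_def)
      finally show ?thesis using that unfolding u_def by simp
    qed
    show "r b \<in> P" unfolding P_def r_def using D Y by (intro PiE_I) auto
  qed
  moreover have "inj_on r (reduced D)"
  proof (rule inj_onI)
    fix a b assume a: "a \<in> reduced D" and b: "b \<in> reduced D" and ab: "r a = r b"
    have pos: "coef a i = coef b i" if "i \<in> {1..m}" for i
      using fun_cong[OF ab, of i] that by (simp add: r_def)
    have split: "(\<Sum>i\<in>{..m}. coef c i * 1) = coef c 0 + (\<Sum>i\<in>{1..m}. coef c i)" for c :: monomial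
    proof -
      have "{..m} = insert 0 {1..m}" by auto
      then show ?thesis by simp
    qed
    have "D = coef c 0 + (\<Sum>i\<in>{1..m}. coef c i)" if "c \<in> reduced D" for c
      using wts[OF that, of "\<lambda>_. 1"] that unfolding split by (simp add: reduced_def deg_def)
    from this[OF a] this[OF b] have "coef a 0 = coef b 0" using pos by simp
    then have low: "coef a i = coef b i" if "i \<le> m" for i
      using pos[of i] that by (cases "i = 0") simp_all
    have "coef a i = coef b i" for i
    proof (cases "i \<le> m")
      case False
      then have "i \<notin> supp a" "i \<notin> supp b" using a b unfolding reduced_def by auto
      then show ?thesis by (simp add: in_keys_iff)
    qed (rule low)
    then show "a = b" by (rule poly_mapping_eqI)
  qed
  ultimately have fc: "finite (reduced D)" "card (reduced D) \<le> card P"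
    using finP by (meson inj_on_finite card_inj_on_le)+
  have "card P = (\<Prod>i\<in>{1..m}. if i \<in> {Suc d..m - e} then Suc e else Suc D)"
    unfolding P_def by (subst card_PiE) (auto intro!: prod.cong)
  also have "\<dots> = Suc e ^ card ({1..m} \<inter> {Suc d..m - e}) * Suc D ^ card ({1..m} - {Suc d..m - e})"
    by (subst prod.If_cases) (simp_all only: finite_atLeastAtMost Collect_mem_eq prod_constant Diff_eq)
  also have "{1..m} \<inter> {Suc d..m - e} = {Suc d..m - e}" by auto
  also have "card {Suc d..m - e} = m - d - e" by simp
  also have "card ({1..m} - {Suc d..m - e}) = d + e"
    by (subst card_Diff_subset) (use dem in auto)
  finally show ?thesis using fc by simp
qed

lemma chain_length_le:
  assumes C: "\<And>i. i \<le> n \<Longrightarrow> irreducible_proj_variety m (C i)" "\<And>i. i \<le> n \<Longrightarrow> C i \<subseteq> proj_zeros m I"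
    and strict: "\<And>i. i < n \<Longrightarrow> C i \<subset> C (Suc i)"
  shows "n \<le> d + e"
proof (rule ccontr)
  assume "\<not> n \<le> d + e"
  then have n: "Suc (d + e) \<le> n" by simp
  have closed: "zariski_closed m (C i)" if "i \<le> n" for i
    using C(1)[OF that] unfolding irreducible_proj_variety_def by blast
  have "\<exists>f k. form m k f \<and> vanishes_on f (C i) \<and> \<not> vanishes_on f (C (Suc i))" if i: "i < n" for i
  proof -
    obtain S where S: "S \<subseteq> carrier (poly_ring m)" "\<forall>f\<in>S. homogeneous f" "C i = proj_zeros m S"
      using closed[of i] i unfolding zariski_closed_def by auto
    obtain p where p: "p \<in> C (Suc i)" "p \<notin> C i" using strict[OF i] by blast
    have "p \<in> proj_space m" using zariski_closed_space[OF closed[of "Suc i"]] i p(1) by auto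
    then obtain f v where f: "f \<in> S" "v \<in> p" "poly_eval f v \<noteq> 0"
      using p(2) unfolding S(3) proj_zeros_def by blast
    have "f \<in> carrier (poly_ring m)" "homogeneous f" using S f(1) by blast+
    then obtain k where "form m k f" using homogeneous_form by blast
    moreover have "vanishes_on f (C i)" using f(1) unfolding S(3) proj_zeros_def vanishes_on_def by blast
    moreover have "\<not> vanishes_on f (C (Suc i))" using f(2,3) p(1) unfolding vanishes_on_def by blast
    ultimately show ?thesis by blast
  qed
  then obtain F dl where F: "\<And>i. i < n \<Longrightarrow> form m (dl i) (F i)" "\<And>i. i < n \<Longrightarrow> vanishes_on (F i) (C i)"
      "\<And>i. i < n \<Longrightarrow> \<not> vanishes_on (F i) (C (Suc i))"
    by metis
  obtain l where l: "form m 1 l" "\<not> vanishes_on l (C 0)"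
  proof -
    have "C 0 \<noteq> {}" using C(1)[of 0] unfolding irreducible_proj_variety_def by simp
    then obtain p where p: "p \<in> C 0" by blast
    then have ps: "p \<in> proj_space m" using zariski_closed_space[OF closed[of 0]] by blast
    then obtain v where v: "v \<in> p" using proj_space_nonempty by blast
    have "\<exists>i. i < m + 1 \<and> v $ i \<noteq> 0"
    proof (rule ccontr)
      assume "\<not> (\<exists>i. i < m + 1 \<and> v $ i \<noteq> 0)"
      then have "v = 0\<^sub>v (m + 1)" using proj_space_members(1)[OF ps v] by (intro eq_vecI) auto
      then show False using proj_space_members(2)[OF ps v] by contradiction
    qed
    then obtain i where i: "i < m + 1" "v $ i \<noteq> 0" by blast
    have "form m 1 (var i)" using i(1) by (intro form_var) simp
    moreover have "\<not> vanishes_on (var i) (C 0)" using p v i(2) unfolding vanishes_on_def by auto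
    ultimately show ?thesis using that by blast
  qed
  define s where "s = (\<Sum>i<n. dl i)"
  \<comment> \<open>All products get degree \<open>B * s\<close>. Since
    \<open>Suc (B * s) \<le> Suc s * Suc B\<close>, this \<open>B\<close> bounds the number of
    reduced monomials of that degree by \<open>B * Suc B ^ (d + e)\<close>, which is less than
    \<open>Suc B ^ Suc (d + e)\<close> and so less than the number \<open>Suc B ^ n\<close> of
    products.\<close>
  define B where "B = Suc e ^ (m - d - e) * Suc s ^ (d + e)"
  define f where "f = form_prod F dl l (B * s)"
  have ff: "form m (B * s) (f as)" if "as \<in> exps B n" for as
    unfolding f_def by (rule form_form_prod[OF F(1) l(1) that]) (simp_all add: s_def)
  have "\<exists>g. f as - g \<in> I \<and> supp g \<subseteq> reduced (B * s)" if as: "as \<in> exps B n" for as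
  proof -
    obtain g where g: "f as - g \<in> I" "supp g \<subseteq> (\<Union>a\<in>supp (f as). reduced_over a)"
      using normal_form[OF form_carrier[OF ff[OF as]]] by blast
    have "reduced_over a \<subseteq> reduced (B * s)" if "a \<in> supp (f as)" for a
      using ff[OF as] that unfolding form_def reduced_over_def reduced_def by auto
    then show ?thesis using g by blast
  qed
  then obtain G where G: "\<And>as. as \<in> exps B n \<Longrightarrow> f as - G as \<in> I"
      "\<And>as. as \<in> exps B n \<Longrightarrow> supp (G as) \<subseteq> reduced (B * s)"
    by metis
  have "Suc (B * s) \<le> Suc s * Suc B" by simp
  then have "Suc (B * s) ^ (d + e) \<le> (Suc s * Suc B) ^ (d + e)" by (rule power_mono) simp
  then have "Suc e ^ (m - d - e) * Suc (B * s) ^ (d + e) \<le> Suc e ^ (m - d - e) * (Suc s * Suc B) ^ (d + e)"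
    by (rule mult_le_mono2)
  also have "\<dots> = B * Suc B ^ (d + e)" unfolding B_def power_mult_distrib by (simp only: mult.assoc)
  also have "\<dots> < Suc B ^ Suc (d + e)" by simp
  also have "\<dots> \<le> Suc B ^ n" by (rule power_increasing[OF n]) simp
  finally have "card (reduced (B * s)) < card (exps B n)"
    using card_reduced[of "B * s"] unfolding card_exps by linarith
  then obtain c where c: "\<exists>as\<in>exps B n. c as \<noteq> 0"
      "\<And>b. b \<in> reduced (B * s) \<Longrightarrow> (\<Sum>as\<in>exps B n. c as * coef (G as) b) = 0"
    using underdetermined_system[of "reduced (B * s)" "exps B n" "\<lambda>as. coef (G as)"]
      card_reduced[of "B * s"] finite_exps by blast
  \<comment> \<open>A relation between normal forms is a relation between the products modulo
    \<open>I\<close>, hence on \<open>C n\<close>.\<close>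
  have "(\<Sum>as\<in>exps B n. sgl 0 (c as) * G as) = 0"
  proof (rule poly_mapping_eqI)
    fix b
    have "(\<Sum>as\<in>exps B n. c as * coef (G as) b) = 0"
    proof (cases "b \<in> reduced (B * s)")
      case False
      then have "coef (G as) b = 0" if "as \<in> exps B n" for as using G(2)[OF that] by (meson in_keys_iff subsetD)
      then show ?thesis by simp
    qed (rule c(2))
    then show "coef (\<Sum>as\<in>exps B n. sgl 0 (c as) * G as) b = coef 0 b"
      by (simp add: lookup_sum coef_scale)
  qed
  then have "(\<Sum>as\<in>exps B n. sgl 0 (c as) * f as) = (\<Sum>as\<in>exps B n. sgl 0 (c as) * (f as - G as))"
    by (simp add: right_diff_distrib sum_subtractf)
  also have "\<dots> \<in> I" by (intro I_sum I_mult G(1) carrier_single) simp_all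
  finally have sI: "(\<Sum>as\<in>exps B n. sgl 0 (c as) * f as) \<in> I" .
  then have "vanishes_on (\<Sum>as\<in>exps B n. sgl 0 (c as) * f as) (proj_zeros m I)"
    using vanishes_on_zeros_iff[OF I_carrier[OF sI]] by blast
  then have van: "vanishes_on (\<Sum>as\<in>exps B n. sgl 0 (c as) * form_prod F dl l (B * s) as) (C n)"
    using C(2)[of n] unfolding vanishes_on_def f_def by blast
  have "\<forall>as\<in>exps B n. c as = 0"
  proof (rule form_prod_independent[OF C(1) _ F l _ van])
    show "C i \<subseteq> C (Suc i)" if "i < n" for i using strict[OF that] by blast
    show "B * (\<Sum>i<n. dl i) \<le> B * s" by (simp add: s_def)
  qed
  then show False using c(1) by blast
qed

section \<open>A chain of full length\<close>

lemma row_minor_in_I: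
  assumes "\<And>i j. i < j \<Longrightarrow> j \<le> e \<Longrightarrow> k i < k j" "\<And>i. i \<le> e \<Longrightarrow> d < k i \<and> k i \<le> m"
  shows "row_minor e k \<in> I"
proof -
  have "good (mset (map (\<lambda>i. k i - i) [0..<Suc e])) \<and> row_minor e k = diag_minor (mset (map (\<lambda>i. k i - i) [0..<Suc e]))"
    by (rule row_minor_eq_diag_minor) (use assms in blast)+
  then show ?thesis using diag_minor_in_I by simp
qed

lemma first_rows_in_I: "row_minor e (\<lambda>i. Suc (d + i)) \<in> I"
  by (rule row_minor_in_I) (use dem in simp_all)

end

lemma proj_zeros_antimono: "S \<subseteq> S' \<Longrightarrow> proj_zeros m S' \<subseteq> proj_zeros m S"
  unfolding proj_zeros_def by blast

text \<open>For \<open>e = 0\<close> the variety is the linear subspace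
  \<open>c_(d+1) = ... = c_m = 0\<close>, so the unit vector with index \<open>d + 1\<close>
  separates it from the next one.\<close>

lemma zeros_strict_d:
  assumes "Suc d < m"
  shows "proj_zeros m (pade.I d 0 m) \<subset> proj_zeros m (pade.I (Suc d) 0 m)"
proof -
  interpret a: pade d 0 m by unfold_locales (use assms in simp)
  interpret b: pade "Suc d" 0 m by unfold_locales (use assms in simp)
  have "b.I \<subseteq> a.I"
  proof (rule b.I_minimal[OF a.ideal_I])
    have "minors (Suc 0) (P_T (Suc d) 0 m) \<subseteq> minors (Suc 0) (P_T d 0 m)"
      unfolding minors_P_T[OF b.dem] minors_P_T[OF a.dem] by (fastforce dest: Suc_lessD)
    then show "minors (Suc 0) (P_T (Suc d) 0 m) \<subseteq> a.I" using a.minors_subset_I by blast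
  qed
  then have "proj_zeros m a.I \<subseteq> proj_zeros m b.I" by (rule proj_zeros_antimono)
  moreover define w :: "complex vec" where "w = unit_vec (m + 1) (Suc d)"
  have wd: "w $ Suc d = 1" using assms by (simp add: w_def)
  have w: "w \<in> carrier_vec (m + 1)" "w \<noteq> 0\<^sub>v (m + 1)"
    using wd assms by (simp_all add: w_def)
  have "b.vanishes_at w" unfolding w_def by (rule b.vanishes_at_unit) simp
  then have "proj_rel m `` {w} \<in> proj_zeros m b.I" by (rule b.zeros_point[OF w])
  moreover have "proj_rel m `` {w} \<notin> proj_zeros m a.I"
  proof
    assume "proj_rel m `` {w} \<in> proj_zeros m a.I"
    then have "a.vanishes_at w" using proj_class_self[OF w] unfolding a.in_zeros_iff by blast
    then have "poly_eval (row_minor 0 (\<lambda>i. Suc (d + i))) w = 0"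
      using a.first_rows_in_I unfolding a.vanishes_at_def by blast
    moreover have "poly_eval (row_minor 0 (\<lambda>i. Suc (d + i))) w \<noteq> 0"
      by (rule poly_eval_row_minor_nonzero) (use wd in fastforce)
    ultimately show False by contradiction
  qed
  ultimately show ?thesis by blast
qed

text \<open>Expansion along the last column writes minors of size \<open>e + 2\<close> through
  minors of size \<open>e + 1\<close>. For strictness take the coefficients of
  \<open>t^d / (1 - t^(e+1))\<close>: the denominator is a kernel vector with \<open>e + 2\<close>
  entries, while the rows with subscripts \<open>d + 1, ..., d + e + 1\<close>, cut to
  \<open>e + 1\<close> columns, form a permutation matrix.\<close>

lemma zeros_strict_e:
  assumes "d + Suc e < m"
  shows "proj_zeros m (pade.I d e m) \<subset> proj_zeros m (pade.I d (Suc e) m)"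
proof -
  interpret a: pade d e m by unfold_locales (use assms in simp)
  interpret b: pade d "Suc e" m by unfold_locales (use assms in simp)
  have "b.I \<subseteq> a.I"
  proof (rule b.I_minimal[OF a.ideal_I], rule subsetI)
    fix f assume "f \<in> minors (Suc (Suc e)) (P_T d (Suc e) m)"
    then obtain k where f: "f = signof (rev_perm (Suc e)) * row_minor (Suc e) k"
      and k: "\<And>i j. i < j \<Longrightarrow> j \<le> Suc e \<Longrightarrow> k i < k j" "\<And>i. i \<le> Suc e \<Longrightarrow> d < k i \<and> k i \<le> m"
      unfolding minors_P_T[OF b.dem] by blast
    define A where "A = mat (Suc (Suc e)) (Suc (Suc e)) (\<lambda>(i, j). toeplitz_entry (k i) j)"
    have A: "A \<in> carrier_mat (Suc (Suc e)) (Suc (Suc e))" by (simp add: A_def)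
    have "row_minor (Suc e) k = (\<Sum>i<Suc (Suc e). A $$ (i, Suc e) * cofactor A i (Suc e))"
      unfolding row_minor_def A_def[symmetric] by (rule laplace_expansion_column[OF A]) simp
    also have "\<dots> \<in> a.I"
    proof (rule a.I_sum)
      fix i assume "i \<in> {..<Suc (Suc e)}"
      then have i: "i < Suc (Suc e)" by simp
      have "mat_delete A i (Suc e) = mat (Suc e) (Suc e) (\<lambda>(i', j). toeplitz_entry (k (insert_index i i')) j)"
        using i by (intro eq_matI) (auto simp: mat_delete_def A_def insert_index_def)
      then have "det (mat_delete A i (Suc e)) = row_minor e (\<lambda>i'. k (insert_index i i'))" by (simp add: row_minor_def)
      moreover have "row_minor e (\<lambda>i'. k (insert_index i i')) \<in> a.I"
        by (rule a.row_minor_in_I) (use k in \<open>auto simp: insert_index_def\<close>)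
      ultimately have "cofactor A i (Suc e) \<in> a.I" unfolding cofactor_def
        by (metis a.I_mult carrier_power carrier_uminus carrier_one)
      moreover have "A $$ (i, Suc e) \<in> carrier (poly_ring m)"
        using i k(2)[of i] by (simp add: A_def toeplitz_entry_carrier)
      ultimately show "A $$ (i, Suc e) * cofactor A i (Suc e) \<in> a.I" by (rule a.I_mult)
    qed
    finally show "f \<in> a.I" unfolding f using a.I_uminus by (simp add: sign_def)
  qed
  then have "proj_zeros m a.I \<subseteq> proj_zeros m b.I" by (rule proj_zeros_antimono)
  moreover define w :: "complex vec" where
    "w = vec (m + 1) (\<lambda>k. if d \<le> k \<and> Suc e dvd k - d then 1 else 0)"
  have wk: "w $ k = (if d \<le> k \<and> Suc e dvd k - d then 1 else 0)" if "k \<le> m" for k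
    using that by (simp add: w_def)
  have w: "w \<in> carrier_vec (m + 1)" by (simp add: w_def)
  have w0: "w \<noteq> 0\<^sub>v (m + 1)"
  proof
    assume "w = 0\<^sub>v (m + 1)"
    then have "w $ d = 0" using assms by simp
    then show False using wk[of d] assms by simp
  qed
  have "b.vanishes_at w"
  proof (rule b.vanishes_at_kernel[of 0 "\<lambda>j. if j = 0 then 1 else if j = Suc e then - 1 else 0"])
    fix k assume k: "d < k" "k \<le> m"
    define h where "h j = (if j \<le> k then w $ (k - j) else 0)" for j
    have "(\<Sum>j<Suc (Suc e). h j * (if j = 0 then 1 else if j = Suc e then - 1 else 0)) = h 0 - h (Suc e)"
    proof -
      have "(\<Sum>j<Suc (Suc e). h j * (if j = 0 then 1 else if j = Suc e then - 1 else 0)) =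
          (\<Sum>j<Suc (Suc e). (if j = 0 then h 0 else 0) + (if j = Suc e then - h (Suc e) else 0))"
        by (rule sum.cong) auto
      then show ?thesis by (simp add: sum.distrib del: sum.lessThan_Suc)
    qed
    moreover have "h 0 = h (Suc e)"
    proof (cases "d + Suc e \<le> k")
      case True
      then have "k - d = (k - Suc e - d) + Suc e" by simp
      then have "Suc e dvd k - d \<longleftrightarrow> Suc e dvd k - Suc e - d" by (metis dvd_add_triv_right_iff)
      moreover have "k - Suc e \<le> m" "Suc e \<le> k" "d \<le> k - Suc e" using True k by simp_all
      ultimately show ?thesis using wk[of k] wk[of "k - Suc e"] k by (simp add: h_def)
    next
      case False
      have "\<not> Suc e dvd k - d"
      proof
        assume "Suc e dvd k - d"
        then have "Suc e \<le> k - d" using k by (intro dvd_imp_le) simp_all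
        then show False using False by simp
      qed
      then have "h 0 = 0" using wk[of k] k by (simp add: h_def)
      moreover have "h (Suc e) = 0" using False k wk[of "k - Suc e"] by (auto simp: h_def)
      ultimately show ?thesis by simp
    qed
    ultimately show "(\<Sum>j<Suc (Suc e). (if j \<le> k then w $ (k - j) else 0) *
        (if j = 0 then 1 else if j = Suc e then - 1 else 0)) = 0"
      unfolding h_def by simp
  qed simp_all
  then have "proj_rel m `` {w} \<in> proj_zeros m b.I" by (rule b.zeros_point[OF w w0])
  moreover have "proj_rel m `` {w} \<notin> proj_zeros m a.I"
  proof
    assume "proj_rel m `` {w} \<in> proj_zeros m a.I"
    then have "a.vanishes_at w" using proj_class_self[OF w w0] unfolding a.in_zeros_iff by blast
    then have "poly_eval (row_minor e (\<lambda>i. Suc (d + i))) w = 0"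
      using a.first_rows_in_I unfolding a.vanishes_at_def by blast
    moreover have "poly_eval (row_minor e (\<lambda>i. Suc (d + i))) w \<noteq> 0"
    proof (rule poly_eval_row_minor_nonzero)
      fix x j assume x: "\<And>i. i \<le> e \<Longrightarrow>
          (\<Sum>j<Suc e. (if j \<le> Suc (d + i) then w $ (Suc (d + i) - j) else 0) * x j) = 0" and j: "j \<le> e"
      \<comment> \<open>The row whose only nonzero entry stands in column \<open>j\<close>:
        subscript \<open>d\<close> is met in row \<open>j - 1\<close>, and for \<open>j = 0\<close>
        subscript \<open>d + e + 1\<close> is met in row \<open>e\<close>.\<close>
      define i where "i = (if j = 0 then e else j - 1)"
      have i: "i \<le> e" using j by (auto simp: i_def)
      have entry: "(if j' \<le> Suc (d + i) then w $ (Suc (d + i) - j') else 0) = (if j' = j then 1 else 0)"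
        if j': "j' \<le> e" for j'
      proof (cases "d + j' \<le> Suc (d + i)")
        case True
        then have le: "j' \<le> Suc i" by simp
        have lt: "Suc i - j' \<le> Suc e" using i by simp
        have "Suc e dvd Suc i - j' \<longleftrightarrow> Suc i - j' = 0 \<or> Suc i - j' = Suc e"
        proof
          assume "Suc e dvd Suc i - j'"
          then show "Suc i - j' = 0 \<or> Suc i - j' = Suc e" using lt dvd_imp_le[of "Suc e" "Suc i - j'"] by linarith
        qed (elim disjE; simp)
        also have "\<dots> \<longleftrightarrow> j' = j" using le j' j by (auto simp: i_def split: if_splits)
        finally have "Suc e dvd Suc i - j' \<longleftrightarrow> j' = j" .
        moreover have "Suc (d + i) - j' - d = Suc i - j'" by simp
        moreover have "d \<le> Suc (d + i) - j'" using le by linarith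
        moreover have "Suc (d + i) - j' \<le> m" using i assms by simp
        ultimately show ?thesis using wk[of "Suc (d + i) - j'"] True by simp
      next
        case False
        have "j' \<noteq> j" using False j' by (auto simp: i_def split: if_splits)
        moreover have "Suc (d + i) - j' \<le> m" using i assms by simp
        moreover have "\<not> d \<le> Suc (d + i) - j'" if "j' \<le> Suc (d + i)" using False that by linarith
        ultimately show ?thesis using wk[of "Suc (d + i) - j'"] by (cases "j' \<le> Suc (d + i)") simp_all
      qed
      have "(\<Sum>j'<Suc e. (if j' \<le> Suc (d + i) then w $ (Suc (d + i) - j') else 0) * x j') =
          (\<Sum>j'<Suc e. if j' = j then x j else 0)"
      proof (rule sum.cong)
        fix j' assume "j' \<in> {..<Suc e}"
        then have "j' \<le> e" by simp
        then show "(if j' \<le> Suc (d + i) then w $ (Suc (d + i) - j') else 0) * x j' = (if j' = j then x j else 0)"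
          using entry[of j'] by (cases "j' = j") simp_all
      qed simp
      also have "\<dots> = x j" using j by (simp del: sum.lessThan_Suc)
      finally show "x j = 0" using x[OF i] by (simp only:)
    qed
    ultimately show False by contradiction
  qed
  ultimately show ?thesis by blast
qed

theorem theorem2p3:
  fixes d e m :: nat
  assumes "d + e < m"
  defines "I \<equiv> minors_ideal m (e + 1) (P_T d e m)"
  shows "primeideal I (poly_ring m) \<and>
         irreducible_proj_variety m (proj_zeros m I) \<and>
         proj_dim m (proj_zeros m I) = enat (d + e)"
proof -
  interpret pade d e m by unfold_locales (rule assms(1))
  have I: "I = pade.I d e m" by (simp add: assms(2) I_def)
  have "proj_dim m (proj_zeros m I) = enat (d + e)"
    unfolding proj_dim_def
  proof (rule antisym)
    show "Sup {enat n |n. \<exists>C. (\<forall>i\<le>n. irreducible_proj_variety m (C i) \<and> C i \<subseteq> proj_zeros m I) \<and>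
        (\<forall>i<n. C i \<subset> C (Suc i))} \<le> enat (d + e)"
    proof (rule Sup_least)
      fix x assume "x \<in> {enat n |n. \<exists>C. (\<forall>i\<le>n. irreducible_proj_variety m (C i) \<and> C i \<subseteq> proj_zeros m I) \<and>
        (\<forall>i<n. C i \<subset> C (Suc i))}"
      then obtain n C where C: "x = enat n" "\<And>i. i \<le> n \<Longrightarrow> irreducible_proj_variety m (C i)"
          "\<And>i. i \<le> n \<Longrightarrow> C i \<subseteq> proj_zeros m (pade.I d e m)" "\<And>i. i < n \<Longrightarrow> C i \<subset> C (Suc i)"
        unfolding I by blast
      have "n \<le> d + e" by (rule chain_length_le[of n C, OF C(2,3,4)])
      then show "x \<le> enat (d + e)" by (simp add: C(1))
    qed
    define C where "C i = (if i \<le> d then proj_zeros m (pade.I i 0 m) else proj_zeros m (pade.I d (i - d) m))" for i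
    have C: "C (d + j) = proj_zeros m (pade.I d j m)" for j by (cases j) (simp_all add: C_def)
    have irr: "irreducible_proj_variety m (C i)" if "i \<le> d + e" for i
    proof -
      \<comment> \<open>Both pieces of the chain at once: for \<open>i \<le> d\<close> the truncated
        \<open>i - d\<close> is \<open>0\<close>, and otherwise \<open>min i d\<close> is
        \<open>d\<close>.\<close>
      interpret a: pade "min i d" "i - d" m by unfold_locales (use assms(1) that in auto)
      show ?thesis using a.irreducible_zeros by (simp add: C_def min_def split: if_splits)
    qed
    have strict: "C i \<subset> C (Suc i)" if i: "i < d + e" for i
    proof (cases "i < d")
      case True
      then show ?thesis using zeros_strict_d[of i m] assms(1) by (simp add: C_def)
    next
      case False
      then obtain j where j: "i = d + j" using le_Suc_ex not_less by blast
      then show ?thesis using zeros_strict_e[of d j m] assms(1) i C[of j] C[of "Suc j"] by simp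
    qed
    have "C i \<subseteq> C (d + e)" if "i \<le> d + e" for i
      using that
    proof (induction rule: inc_induct)
      case (step n)
      then show ?case using strict[of n] by blast
    qed simp
    then have "C i \<subseteq> proj_zeros m I" if "i \<le> d + e" for i using that C[of e] I by simp
    then show "enat (d + e) \<le> Sup {enat n |n. \<exists>C. (\<forall>i\<le>n. irreducible_proj_variety m (C i) \<and> C i \<subseteq> proj_zeros m I) \<and>
        (\<forall>i<n. C i \<subset> C (Suc i))}"
      using irr strict by (intro Sup_upper) blast
  qed
  then show ?thesis using primeideal_I irreducible_zeros I by simp
qed

end
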